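(* Let $\Omega\subset\mathbb{R}^3$ be a bounded domain with $C^{1,1}$-boundary, and let $\lambda_0,\mu_0>0$ be constants. Let $D_1,D_2\subset\Omega$ be open sets such that $\partial D_1$ is Lipschitz continuous, $\partial D_2$ is smooth, $D_2\neq\emptyset$, $D_1\cap D_2=\emptyset$, and $\Omega\setminus\overline{(D_1\cup D_2)}$ is connected. Assume also that $D_1\cup D_2$ is relatively compact in $\Omega$ (i.e. $\overline{D_1\cup D_2}$ is a compact subset of $\Omega$) and has Lipschitz boundary. Then there exist sequences $(g_j)_{j\in\mathbb{N}}$ in $\mathcal{R}^\perp$ and $(u_j)_{j\in\mathbb{N}}$ in $\mathcal{H}(\Omega)$ such that, for every $j$, $u_j$ is the weak solution of $$\nabla\cdot\big(\lambda_0(\nabla\cdot u_j)I+2\mu_0\widehat{\nabla}u_j\big)=0\ \text{ in }\Omega,\qquad \big(\lambda_0(\nabla\cdot u_j)I+2\mu_0\widehat{\nabla}u_j\big)\nu=g_j\ \text{ on }\partial\Omega,$$ and $$\nabla\cdot u_j=0\ \text{ in }\Omega,$$ and such that, as $j\to\infty$, $$\|\widehat{\nabla}u_j\|_{L^2(D_1')^{3\times3}}\to0\quad\text{for any } D_1'\Subset D_1,\qquad\text{and}\qquad \|\widehat{\nabla}u_j\|_{L^2(D_2)^{3\times3}}\to\infty.$$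
   Context: Notation: $\widehat{\nabla}u=\frac12(\nabla u+\nabla u^\top)$ is the symmetric derivative, $\nu$ is the exterior unit normal of $\partial\Omega$, and $A:B=\sum_{i,j}A_{ij}B_{ij}$. The notation $D_1'\Subset D_1$ means that $\overline{D_1'}$ is compact and contained in $D_1$. Rigid motions: $\mathcal{R}=\{A\colon\Omega\to\mathbb{R}^3 : A(x)=Bx+\eta,\ \eta\in\mathbb{R}^3,\ B\in\mathbb{R}^{3\times3}\text{ antisymmetric}\}$ (also regarded as functions on $\partial\Omega$ by restriction). $\mathcal{R}^\perp=\{g\in L^2(\partial\Omega)^3:\int_{\partial\Omega}g\cdot r\,dS=0\text{ for all }r\in\mathcal{R}\}$. $\mathcal{H}(\Omega)=\{u\in H^1(\Omega)^3:\int_\Omega u\cdot r\,dx=0\text{ for all }r\in\mathcal{R}\}$ (centered displacements). For $g\in\mathcal{R}^\perp$, the boundary value problem $\nabla\cdot(\lambda_0(\nabla\cdot u)I+2\mu_0\widehat\nabla u)=0$ in $\Omega$, $(\lambda_0(\nabla\cdot u)I+2\mu_0\widehat\nabla u)\nu=g$ on $\partial\Omega$, is understood weakly: $$\int_\Omega\lambda_0(\nabla\cdot u)(\nabla\cdot v)+2\mu_0\widehat{\nabla}u:\widehat{\nabla}v\,dx=\int_{\partial\Omega}g\cdot v\,dS\quad\text{for all }v\in H^1(\Omega)^3;$$ it has a unique weak solution $u\in\mathcal{H}(\Omega)$. *)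

theory Defs
  imports "HOL-Analysis.Analysis"
begin

section \<open>Smooth functions and regularity of boundaries\<close>

definition partial_deriv :: "'n::finite \<Rightarrow> (real^'n \<Rightarrow> real) \<Rightarrow> real^'n \<Rightarrow> real" where
  "partial_deriv i f x = frechet_derivative f (at x) (axis i 1)"

text \<open>All iterated partial derivatives exist as Frechet differentiable functions, i.e. \<open>f\<close> is
  \<open>C\<close>-infinity on the whole space.\<close>

definition smooth :: "(real^'n::finite \<Rightarrow> real) \<Rightarrow> bool" where
  "smooth f \<longleftrightarrow> (\<forall>is. foldr partial_deriv is f differentiable_on UNIV)"

definition C11_function :: "(real^'n::finite \<Rightarrow> real) \<Rightarrow> bool" where
  "C11_function f \<longleftrightarrow>
     f differentiable_on UNIV \<and> (\<forall>i. \<exists>L. L-lipschitz_on UNIV (partial_deriv i f))"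

definition lipschitz_function :: "(real^'n::finite \<Rightarrow> real) \<Rightarrow> bool" where
  "lipschitz_function f \<longleftrightarrow> (\<exists>L. L-lipschitz_on UNIV f)"

text \<open>Near each of its boundary points, and in suitable orthonormal coordinates, the set is
  the region strictly above the graph of a function of class \<open>C\<close>; in particular it lies
  on one side of its boundary. Since only the ball around \<open>p\<close> matters, it is no restriction that
  \<open>\<gamma>\<close> is defined, and of class \<open>C\<close>, on the whole plane.\<close>

definition boundary_of_class :: "((real^2 \<Rightarrow> real) \<Rightarrow> bool) \<Rightarrow> (real^3) set \<Rightarrow> bool" where
  "boundary_of_class C D \<longleftrightarrow>
     (\<forall>p\<in>frontier D. \<exists>r>0. \<exists>(Q :: real^3 \<Rightarrow> real^3) \<gamma>. orthogonal_transformation Q \<and> C \<gamma> \<and>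
        D \<inter> ball p r = {x \<in> ball p r. Q x $ 3 > \<gamma> (vector [Q x $ 1, Q x $ 2])})"

abbreviation "C11_boundary \<equiv> boundary_of_class C11_function"
abbreviation "lipschitz_boundary \<equiv> boundary_of_class lipschitz_function"
abbreviation "smooth_boundary \<equiv> boundary_of_class smooth"

definition compactly_contained :: "'a::metric_space set \<Rightarrow> 'a set \<Rightarrow> bool" where
  "compactly_contained A B \<longleftrightarrow> compact (closure A) \<and> closure A \<subseteq> B"


section \<open>Surface measure\<close>

text \<open>Surface measure on \<open>\<partial>\<Omega>\<close> is two-dimensional Hausdorff measure, with the normalisation
  \<open>\<pi> (diam / 2)\<^sup>2\<close> that makes it agree with area. Boundedness of the covering sets is required
  because \<^const>\<open>diameter\<close> is meaningless for unbounded sets.\<close>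

definition hausdorff2_premeasure :: "real \<Rightarrow> (real^3) set \<Rightarrow> ennreal" where
  "hausdorff2_premeasure \<delta> A =
     (INF U \<in> {U :: nat \<Rightarrow> (real^3) set.
                 A \<subseteq> (\<Union>n. U n) \<and> (\<forall>n. bounded (U n) \<and> diameter (U n) \<le> \<delta>)}.
        \<Sum>n. ennreal (pi * (diameter (U n) / 2)\<^sup>2))"

definition hausdorff2 :: "(real^3) measure" where
  "hausdorff2 = measure_of UNIV (sets borel) (\<lambda>A. SUP \<delta>\<in>{0<..}. hausdorff2_premeasure \<delta> A)"

definition surface_measure :: "(real^3) set \<Rightarrow> (real^3) measure" where
  "surface_measure \<Omega> = restrict_space hausdorff2 (frontier \<Omega>)"


section \<open>Function spaces\<close>

text \<open>Elements of \<open>L\<^sup>2\<close> and of Sobolev spaces are represented by functions on the whole space, of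
  which only the values on \<open>\<Omega>\<close> (or \<open>\<partial>\<Omega>\<close>), up to null sets, are relevant. The library norm on
  \<^typ>\<open>real^3^3\<close> is the Frobenius norm, and its inner product is the contraction \<open>A : B\<close>.\<close>

definition square_integrable :: "'a measure \<Rightarrow> ('a \<Rightarrow> 'b::euclidean_space) \<Rightarrow> bool" where
  "square_integrable M f \<longleftrightarrow> f \<in> borel_measurable M \<and> integrable M (\<lambda>x. (norm (f x))\<^sup>2)"

definition L2_norm :: "'a measure \<Rightarrow> ('a \<Rightarrow> 'b::euclidean_space) \<Rightarrow> real" where
  "L2_norm M f = sqrt (LINT x|M. (norm (f x))\<^sup>2)"

definition test_functions :: "(real^'n::finite) set \<Rightarrow> (real^'n \<Rightarrow> real) set" where
  "test_functions \<Omega> =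
     {\<phi>. smooth \<phi> \<and> (\<exists>K. compact K \<and> K \<subseteq> \<Omega> \<and> (\<forall>x. x \<notin> K \<longrightarrow> \<phi> x = 0))}"

text \<open>\<open>J\<close> is the weak Jacobian matrix (entry \<open>i, j\<close> is \<open>\<partial>\<^sub>j u\<^sub>i\<close>), with \<open>u\<close> and \<open>J\<close> both in \<open>L\<^sup>2(\<Omega>)\<close>.\<close>

definition has_L2_jacobian ::
  "(real^3) set \<Rightarrow> (real^3 \<Rightarrow> real^3) \<Rightarrow> (real^3 \<Rightarrow> real^3^3) \<Rightarrow> bool" where
  "has_L2_jacobian \<Omega> u J \<longleftrightarrow>
     square_integrable (lebesgue_on \<Omega>) u \<and> square_integrable (lebesgue_on \<Omega>) J \<and>
     (\<forall>\<phi>\<in>test_functions \<Omega>. \<forall>i j.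
        (LINT x|lebesgue_on \<Omega>. u x $ i * partial_deriv j \<phi> x) =
        - (LINT x|lebesgue_on \<Omega>. J x $ i $ j * \<phi> x))"

definition H1 :: "(real^3) set \<Rightarrow> (real^3 \<Rightarrow> real^3) set" where
  "H1 \<Omega> = {u. \<exists>J. has_L2_jacobian \<Omega> u J}"

definition weak_jacobian :: "(real^3) set \<Rightarrow> (real^3 \<Rightarrow> real^3) \<Rightarrow> real^3 \<Rightarrow> real^3^3" where
  "weak_jacobian \<Omega> u = (SOME J. has_L2_jacobian \<Omega> u J)"

definition sym_grad :: "(real^3) set \<Rightarrow> (real^3 \<Rightarrow> real^3) \<Rightarrow> real^3 \<Rightarrow> real^3^3" where
  "sym_grad \<Omega> u x = (1/2) *\<^sub>R (weak_jacobian \<Omega> u x + transpose (weak_jacobian \<Omega> u x))"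

definition weak_div :: "(real^3) set \<Rightarrow> (real^3 \<Rightarrow> real^3) \<Rightarrow> real^3 \<Rightarrow> real" where
  "weak_div \<Omega> u x = trace (weak_jacobian \<Omega> u x)"

text \<open>\<open>t\<close> is the boundary trace of \<open>v \<in> H\<^sup>1(\<Omega>)\<close>: the continuous extension to \<open>H\<^sup>1(\<Omega>)\<close> of
  the restriction map \<open>\<phi> \<mapsto> \<phi>|\<^sub>\<partial>\<^sub>\<Omega>\<close>, valued in \<open>L\<^sup>2(\<partial>\<Omega>)\<close>, from fields smooth up to the boundary. For a bounded
  Lipschitz domain every \<open>v \<in> H\<^sup>1(\<Omega>)\<close> has such a \<open>t\<close>, unique up to null sets.\<close>

definition has_trace :: "(real^3) set \<Rightarrow> (real^3 \<Rightarrow> real^3) \<Rightarrow> (real^3 \<Rightarrow> real^3) \<Rightarrow> bool" where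
  "has_trace \<Omega> v t \<longleftrightarrow>
     v \<in> H1 \<Omega> \<and> square_integrable (surface_measure \<Omega>) t \<and>
     (\<exists>\<phi> :: nat \<Rightarrow> real^3 \<Rightarrow> real^3.
        (\<forall>n i. smooth (\<lambda>x. \<phi> n x $ i)) \<and>
        (\<lambda>n. L2_norm (lebesgue_on \<Omega>) (\<lambda>x. \<phi> n x - v x)) \<longlonglongrightarrow> 0 \<and>
        (\<lambda>n. L2_norm (lebesgue_on \<Omega>)
               (\<lambda>x. matrix (frechet_derivative (\<phi> n) (at x)) - weak_jacobian \<Omega> v x)) \<longlonglongrightarrow> 0 \<and>
        (\<lambda>n. L2_norm (surface_measure \<Omega>) (\<lambda>x. \<phi> n x - t x)) \<longlonglongrightarrow> 0)"


section \<open>Linear elasticity\<close>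

definition rigid_motions :: "(real^3 \<Rightarrow> real^3) set" where
  "rigid_motions = {\<lambda>x. B *v x + \<eta> | (B :: real^3^3) \<eta>. transpose B = - B}"

definition rigid_perp :: "(real^3) set \<Rightarrow> (real^3 \<Rightarrow> real^3) set" where
  "rigid_perp \<Omega> =
     {g. square_integrable (surface_measure \<Omega>) g \<and>
         (\<forall>r\<in>rigid_motions. (LINT x|surface_measure \<Omega>. g x \<bullet> r x) = 0)}"

definition centered_displacements :: "(real^3) set \<Rightarrow> (real^3 \<Rightarrow> real^3) set" where
  "centered_displacements \<Omega> =
     {u \<in> H1 \<Omega>. \<forall>r\<in>rigid_motions. (LINT x|lebesgue_on \<Omega>. u x \<bullet> r x) = 0}"

text \<open>Weak form of the traction problem for constant Lame parameters \<open>\<lambda>\<^sub>0 = lam0\<close>, \<open>\<mu>\<^sub>0 = mu0\<close> and boundary load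
  \<open>g\<close>; the test field \<open>v\<close> enters the boundary integral through its trace \<open>t\<close>.\<close>

definition weak_lame_solution ::
  "real \<Rightarrow> real \<Rightarrow> (real^3) set \<Rightarrow> (real^3 \<Rightarrow> real^3) \<Rightarrow> (real^3 \<Rightarrow> real^3) \<Rightarrow> bool" where
  "weak_lame_solution lam0 mu0 \<Omega> g u \<longleftrightarrow>
     u \<in> H1 \<Omega> \<and>
     (\<forall>v\<in>H1 \<Omega>. \<forall>t. has_trace \<Omega> v t \<longrightarrow>
        (LINT x|lebesgue_on \<Omega>. lam0 * (weak_div \<Omega> u x * weak_div \<Omega> v x)
            + 2 * mu0 * (sym_grad \<Omega> u x \<bullet> sym_grad \<Omega> v x))
        = (LINT x|surface_measure \<Omega>. g x \<bullet> t x))"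

end

theory Submission
  imports Defs "HOL-Complex_Analysis.Cauchy_Integral_Formula"
begin

text \<open>If \<open>\<phi>\<close> is harmonic, then \<open>\<nabla>\<phi>\<close> is divergence free, solves the Lame system for all
  constant parameters, and has the Hessian of \<open>\<phi>\<close> as its symmetric derivative; subtracting a rigid motion
  centres it without changing that derivative. So it suffices to find functions harmonic near the closure of
  \<open>\<Omega>\<close> whose Hessians tend to zero uniformly on \<open>D1\<close> and blow up in \<open>L\<^sup>2(D2)\<close>.

  Since \<open>D1 \<union> D2\<close> has a Lipschitz boundary, the closures of \<open>D1\<close> and \<open>D2\<close> are disjoint, and
  every boundary point \<open>p\<close> of \<open>D2\<close> is a limit of points \<open>y\<close> outside the closure of
  \<open>D1 \<union> D2\<close>. As \<open>y\<close> tends to a point \<open>p\<close> at which \<open>D2\<close> has an interior touching ball,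
  the Hessian of the Newton kernel with pole \<open>y\<close> stays bounded on \<open>D1\<close>, while its \<open>L\<^sup>2\<close> norm on
  \<open>D2\<close> tends to infinity. The complement of the closure of \<open>D1 \<union> D2\<close> is connected, so the pole can be
  moved along it to the outside of a ball around \<open>\<Omega>\<close>, at the price of a uniformly small error.

  No divergence theorem is needed for the boundary load. The lower density bound for the Hausdorff measure of
  \<open>\<partial>\<Omega>\<close> gives \<open>\<bar>\<integral>\<^sub>\<Omega> \<partial>\<^sub>k f\<bar> \<le> C \<integral>\<^sub>\<partial>\<^sub>\<Omega> \<bar>f\<bar>\<close>;
  hence the stress acts on the boundary values of test fields as an \<open>L\<^sup>2\<close>-bounded functional, and the
  Riesz representation theorem yields the load.\<close>

section \<open>Two-dimensional Hausdorff measure\<close>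

text \<open>The squared norm of the Hessian of 1/|w| is 6/|w|^6. In three dimensions a ball of
  radius s that touches the boundary close to the pole therefore contributes a multiple of 1/s^3,
  and this non-integrability is the whole source of the blow-up. A touching ball comes from the
  boundary point nearest to an arbitrary point of \<open>D2\<close>. One sequence has to decay on
  \<open>D1\<close> and grow on \<open>D2\<close>: poles are taken so close that the norm on
  \<open>D2\<close> is at least (j+1)^2, and the Hessian is then divided by j+1, which leaves growth
  of order j+1 against decay of order 1/(j+1). Moving the pole may cost 1/(j+1) without harm. Moving
  a pole is a Runge argument in Taylor form: the Hessian is analytic in the position of its pole,
  with a radius of convergence governed only by the distance of the pole from the compact set. On
  the boundary side, surface measure is Hausdorff measure and traces are limits of smooth fields, so
  neither a normal nor an area formula is at hand. The load only has to exist, hence an inequality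
  with some constant can replace an exact formula. Orthogonality of the load to rigid motions comes
  from the symmetry of the stress.\<close>

lemma suminf_tail_small:
  fixes g :: "nat \<Rightarrow> ennreal"
  assumes "suminf g < \<infinity>" "0 < e"
  obtains n where "(\<Sum>k. g (k + n)) < ennreal e"
proof -
  have fin: "g k < top" for k
    using ennreal_suminf_lessD[OF assms(1), of k] by simp
  define r where "r k = enn2real (g k)" for k
  have g: "g k = ennreal (r k)" for k using fin[of k] by (simp add: r_def)
  have r0: "0 \<le> r k" for k by (simp add: r_def)
  have sm: "summable r"
    by (rule summable_suminf_not_top) (use assms(1) g r0 in \<open>auto simp flip: g\<close>)
  obtain n where n: "norm (\<Sum>k. r (k + n)) < e"
    using suminf_exist_split[OF assms(2) sm] by auto
  have "(\<Sum>k. g (k + n)) = ennreal (\<Sum>k. r (k + n))"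
    unfolding g using sm r0 by (intro suminf_ennreal2) (auto simp: summable_iff_shift)
  moreover have "(\<Sum>k. r (k + n)) < e" using n by simp
  ultimately have "(\<Sum>k. g (k + n)) < ennreal e" using assms(2) by (simp add: ennreal_lessI)
  then show ?thesis by (rule that)
qed

text \<open>Induction on the number of sets: each new set has positive distance from the union of
  all earlier ones, so the metric property adds one summand at a time. The premise
  \<open>i < n\<close> in \<open>sep\<close> says that n is positive.\<close>

lemma metric_outer_measure_sum_le:
  fixes f :: "'a::metric_space set \<Rightarrow> ennreal" and B :: "nat \<Rightarrow> 'a set"
  assumes oms: "outer_measure_space UNIV f"
    and met: "\<And>A B e. 0 < e \<Longrightarrow> (\<And>a b. a \<in> A \<Longrightarrow> b \<in> B \<Longrightarrow> e \<le> dist a b) \<Longrightarrow> f A + f B \<le> f (A \<union> B)"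
    and sep: "\<And>i n. i < n \<Longrightarrow> \<exists>e>0. \<forall>m<n. \<forall>a\<in>B m. \<forall>b\<in>B n. e \<le> dist a b"
  shows "(\<Sum>k<n. f (B k)) \<le> f (\<Union>k<n. B k)"
proof (induction n)
  case 0 then show ?case by simp
next
  case (Suc n)
  have "f (\<Union>k<n. B k) + f (B n) \<le> f ((\<Union>k<n. B k) \<union> B n)"
  proof (cases "n = 0")
    case True
    then show ?thesis using oms by (simp add: outer_measure_space_def positive_def)
  next
    case False
    then obtain e where "e > 0" "\<forall>m<n. \<forall>a\<in>B m. \<forall>b\<in>B n. e \<le> dist a b"
      using sep[of 0 n] by auto
    then show ?thesis by (intro met[of e]) auto
  qed
  also have "(\<Union>k<n. B k) \<union> B n = (\<Union>k<Suc n. B k)"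
    by (auto simp: less_Suc_eq)
  finally have "f (\<Union>k<n. B k) + f (B n) \<le> f (\<Union>k<Suc n. B k)" .
  moreover have "(\<Sum>k<Suc n. f (B k)) \<le> f (\<Union>k<n. B k) + f (B n)"
    using add_right_mono[OF Suc] by simp
  ultimately show ?case by (rule order.trans[rotated])
qed

text \<open>Caratheodory's argument: the part of \<open>A - C\<close> close to \<open>C\<close> is cut into shells. Shells whose
  indices differ by at least 2 have positive distance, so the series of their measures converges.\<close>

lemma metric_outer_measure_closed:
  fixes f :: "'a::metric_space set \<Rightarrow> ennreal"
  assumes oms: "outer_measure_space UNIV f"
    and met: "\<And>A B e. 0 < e \<Longrightarrow> (\<And>a b. a \<in> A \<Longrightarrow> b \<in> B \<Longrightarrow> e \<le> dist a b) \<Longrightarrow> f A + f B \<le> f (A \<union> B)"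
    and sub: "\<And>A :: nat \<Rightarrow> 'a set. f (\<Union>i. A i) \<le> (\<Sum>i. f (A i))"
    and sub2: "\<And>A B. f (A \<union> B) \<le> f A + f B"
    and C: "closed C"
  shows "f (A \<inter> C) + f (A - C) \<le> f A"
proof (cases "f A = \<infinity> \<or> C = {}")
  case True
  then show ?thesis using oms by (auto simp: outer_measure_space_def positive_def)
next
  case False
  then have fA: "f A < \<infinity>" and C0: "C \<noteq> {}" by (auto simp: less_top)
  have mono: "f X \<le> f Y" if "X \<subseteq> Y" for X Y
    using oms that by (auto simp: outer_measure_space_def increasing_def)
  define h where "h n = 1 / (real n + 1)" for n
  have hmono: "h m \<le> h n" if "n \<le> m" for m n using that by (simp add: h_def field_simps)
  have hless: "h m < h n" if "n < m" for m n using that by (simp add: h_def field_simps)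
  define B where "B k = {x \<in> A. h (Suc k) \<le> infdist x C \<and> infdist x C < h k}" for k
  define D where "D n = {x \<in> A. h n \<le> infdist x C}" for n
  have sepB: "\<exists>e>0. \<forall>m. m + 2 \<le> n \<longrightarrow> (\<forall>a\<in>B m. \<forall>b\<in>B n. e \<le> dist a b)" if "2 \<le> n" for n
  proof (intro exI conjI allI impI ballI)
    \<comment> \<open>The gap is the thickness of the shell \<open>n - 1\<close> lying between
      \<open>B m\<close> and \<open>B n\<close>; the distance to \<open>C\<close> is 1-Lipschitz, so
      it is a lower bound for the distance of the two shells.\<close>
    show "0 < h (n - 1) - h n" using hless[of "n-1" n] that by simp
    fix m a b assume m: "m + 2 \<le> n" and ab: "a \<in> B m" "b \<in> B n"
    have "infdist a C \<le> infdist b C + dist a b"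
      using infdist_triangle by blast
    moreover have "h (Suc m) \<ge> h (n-1)" using m by (intro hmono) auto
    ultimately show "h (n - 1) - h n \<le> dist a b" using ab by (auto simp: B_def)
  qed
  have "(\<Sum>k<n. f (B (2*k))) \<le> f A" for n
  proof -
    have "(\<Sum>k<n. f (B (2*k))) \<le> f (\<Union>k<n. B (2*k))"
    proof (rule metric_outer_measure_sum_le[OF oms met])
      fix i n :: nat assume "i < n"
      show "\<exists>e>0. \<forall>m<n. \<forall>a\<in>B (2*m). \<forall>b\<in>B (2*n). e \<le> dist a b"
      proof -
        have "2 \<le> 2*n" using \<open>i < n\<close> by simp
        from sepB[OF this] obtain e where e: "e > 0"
          "\<And>m a b. m + 2 \<le> 2*n \<Longrightarrow> a \<in> B m \<Longrightarrow> b \<in> B (2*n) \<Longrightarrow> e \<le> dist a b" by blast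
        show ?thesis by (rule exI[of _ e]) (simp add: e(1), intro allI impI ballI e(2), auto)
      qed
    qed
    also have "\<dots> \<le> f A" by (intro mono) (auto simp: B_def)
    finally show ?thesis .
  qed
  then have e: "(\<Sum>k. f (B (2*k))) \<le> f A"
    by (intro suminf_le_const) auto
  have "(\<Sum>k<n. f (B (2*k+1))) \<le> f A" for n
  proof -
    have "(\<Sum>k<n. f (B (2*k+1))) \<le> f (\<Union>k<n. B (2*k+1))"
    proof (rule metric_outer_measure_sum_le[OF oms met])
      fix i n :: nat assume "i < n"
      show "\<exists>e>0. \<forall>m<n. \<forall>a\<in>B (2*m+1). \<forall>b\<in>B (2*n+1). e \<le> dist a b"
      proof -
        have "2 \<le> 2*n+1" using \<open>i < n\<close> by simp
        from sepB[OF this] obtain e where e: "e > 0"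
          "\<And>m a b. m + 2 \<le> 2*n+1 \<Longrightarrow> a \<in> B m \<Longrightarrow> b \<in> B (2*n+1) \<Longrightarrow> e \<le> dist a b" by blast
        show ?thesis by (rule exI[of _ e]) (simp add: e(1), intro allI impI ballI e(2), auto)
      qed
    qed
    also have "\<dots> \<le> f A" by (intro mono) (auto simp: B_def)
    finally show ?thesis .
  qed
  then have o: "(\<Sum>k. f (B (2*k+1))) \<le> f A"
    by (intro suminf_le_const) auto
  have fin: "(\<Sum>k. f (B k)) < \<infinity>"
  proof -
    have "(\<Sum>k<n. f (B k)) \<le> f A + f A" for n
    proof -
      have "(\<Sum>k<n. f (B k)) \<le> (\<Sum>k<2*n. f (B k))" by (intro sum_mono2) auto
      also have "\<dots> = (\<Sum>k<n. f (B (2*k))) + (\<Sum>k<n. f (B (2*k+1)))"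
        by (induction n) (auto simp: algebra_simps)
      also have "\<dots> \<le> f A + f A"
        by (intro add_mono order.trans[OF _ e] order.trans[OF _ o] sum_le_suminf) auto
      finally show ?thesis .
    qed
    then have "(\<Sum>k. f (B k)) \<le> f A + f A" by (intro suminf_le_const) auto
    also have "\<dots> < \<infinity>" using fA by simp
    finally show ?thesis .
  qed
  have DB: "A - C \<subseteq> D n \<union> (\<Union>k. B (k + n))" for n
  proof
    fix x assume x: "x \<in> A - C"
    then have pos: "0 < infdist x C"
      by (metis C C0 DiffD2 in_closed_iff_infdist_zero infdist_nonneg order_le_less)
    show "x \<in> D n \<union> (\<Union>k. B (k + n))"
    proof (cases "h n \<le> infdist x C")
      case True then show ?thesis using x by (auto simp: D_def)
    next
      case False
      obtain m where m: "h m < infdist x C"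
        using reals_Archimedean[OF pos] by (auto simp: h_def inverse_eq_divide add.commute)
      \<comment> \<open>The first threshold not above the distance of x to \<open>C\<close>; x then
        lies in the shell \<open>l - 1\<close>, and \<open>n < l\<close> puts that shell into the
        tail.\<close>
      define l where "l = (LEAST m. h m \<le> infdist x C)"
      have l: "h l \<le> infdist x C" unfolding l_def by (rule LeastI[of _ m]) (use m in auto)
      have "n < l" using False l hmono[of l n] by (meson linorder_not_less order.trans)
      moreover have "infdist x C < h (l - 1)"
        using not_less_Least[of "l - 1" "\<lambda>m. h m \<le> infdist x C"] \<open>n < l\<close> unfolding l_def[symmetric] by auto
      ultimately have "x \<in> B ((l - 1 - n) + n)" using x l by (auto simp: B_def)
      then show ?thesis by blast
    qed
  qed
  have "f (A \<inter> C) + f (A - C) \<le> f A + ennreal e" if "0 < e" for e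
  proof -
    obtain n where n: "(\<Sum>k. f (B (k + n))) < ennreal e"
      using suminf_tail_small[OF fin \<open>0 < e\<close>] by blast
    have "f (A - C) \<le> f (D n) + f (\<Union>k. B (k + n))"
      using mono[OF DB[of n]] sub2 order.trans by blast
    also have "\<dots> \<le> f (D n) + (\<Sum>k. f (B (k + n)))" by (intro add_left_mono sub)
    also have "\<dots> \<le> f (D n) + ennreal e" using n by (intro add_left_mono) auto
    finally have "f (A \<inter> C) + f (A - C) \<le> (f (A \<inter> C) + f (D n)) + ennreal e"
      by (metis add.assoc add_left_mono)
    also have "f (A \<inter> C) + f (D n) \<le> f ((A \<inter> C) \<union> D n)"
    proof (rule met[of "h n"])
      show "0 < h n" by (simp add: h_def)
      fix a b assume "a \<in> A \<inter> C" "b \<in> D n"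
      then show "h n \<le> dist a b"
        using infdist_le[of a C b] by (auto simp: D_def dist_commute)
    qed
    also have "\<dots> \<le> f A" by (intro mono) (auto simp: D_def)
    finally show ?thesis by simp
  qed
  then show ?thesis using ennreal_le_epsilon by blast
qed

text \<open>Caratheodory's criterion: the sets that split every set additively form a sigma-algebra
  on which f is a measure. Closed sets are among them by the preceding lemma, and they generate the
  Borel sets.\<close>

lemma metric_outer_measure_space_borel:
  fixes f :: "'a::metric_space set \<Rightarrow> ennreal"
  assumes oms: "outer_measure_space UNIV f"
    and met: "\<And>A B e. 0 < e \<Longrightarrow> (\<And>a b. a \<in> A \<Longrightarrow> b \<in> B \<Longrightarrow> e \<le> dist a b) \<Longrightarrow> f A + f B \<le> f (A \<union> B)"
    and sub: "\<And>A :: nat \<Rightarrow> 'a set. f (\<Union>i. A i) \<le> (\<Sum>i. f (A i))"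
  shows "measure_space UNIV (sets borel) f"
proof -
  let ?L = "lambda_system UNIV UNIV f"
  interpret sigma_algebra "UNIV :: 'a set" "UNIV :: 'a set set"
    using sigma_algebra_Pow[of "UNIV :: 'a set"] by simp
  have e: "f {} = 0" using oms by (simp add: outer_measure_space_def positive_def)
  have sub2: "f (A \<union> B) \<le> f A + f B" for A B
  proof -
    define S where "S n = (if n = 0 then A else if n = 1 then B else {})" for n :: nat
    have "(\<Union>n. S n) = A \<union> B" by (force simp: S_def)
    moreover have "(\<Sum>n. f (S n)) = (\<Sum>n\<in>{0,1}. f (S n))"
      by (rule suminf_finite) (auto simp: S_def e)
    ultimately show ?thesis using sub[of S] by (simp add: S_def)
  qed
  have ms: "measure_space UNIV ?L f" by (rule caratheodory_lemma[OF oms])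
  have "closed C \<Longrightarrow> C \<in> ?L" for C
  proof -
    assume C: "closed C"
    have "f (C \<inter> x) + f ((UNIV - C) \<inter> x) = f x" for x
    proof (rule antisym)
      show "f (C \<inter> x) + f ((UNIV - C) \<inter> x) \<le> f x"
        using metric_outer_measure_closed[OF oms met sub sub2 C, where A = x]
        by (simp add: Int_commute Diff_eq)
      have "x = (C \<inter> x) \<union> ((UNIV - C) \<inter> x)" by auto
      then show "f x \<le> f (C \<inter> x) + f ((UNIV - C) \<inter> x)" using sub2 by metis
    qed
    then show ?thesis by (simp add: lambda_system_def)
  qed
  then have "sigma_sets UNIV (Collect closed) \<subseteq> ?L"
    using ms by (intro sigma_algebra.sigma_sets_subset) (auto simp: measure_space_def)
  then have *: "sets borel \<subseteq> ?L" by (simp add: borel_eq_closed)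
  show ?thesis
    by (rule measure_down[OF ms _ *]) (simp add: sets.sigma_algebra_axioms[of borel, simplified])
qed

section \<open>The Hausdorff outer measure and its metric property\<close>

text \<open>The set function inside \<open>hausdorff2\<close>. Since \<open>measure_of\<close>
  yields the zero measure for anything that is not a measure on the given sets,
  \<open>emeasure hausdorff2\<close> can be computed only after
  \<open>measure_space_hausdorff2\<close>.\<close>

definition hausdorff2_outer :: "(real^3) set \<Rightarrow> ennreal" where
  "hausdorff2_outer A = (SUP \<delta>\<in>{0<..}. hausdorff2_premeasure \<delta> A)"

lemma hausdorff2_premeasure_le:
  assumes "A \<subseteq> (\<Union>n. U n)" "\<And>n. bounded (U n)" "\<And>n. diameter (U n) \<le> \<delta>"
  shows "hausdorff2_premeasure \<delta> A \<le> (\<Sum>n. ennreal (pi * (diameter (U n) / 2)\<^sup>2))"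
  unfolding hausdorff2_premeasure_def by (rule INF_lower) (use assms in auto)

lemma hausdorff2_premeasure_cover:
  assumes "hausdorff2_premeasure \<delta> A < \<infinity>" "0 < e"
  obtains U :: "nat \<Rightarrow> (real^3) set" where "A \<subseteq> (\<Union>n. U n)" "\<And>n. bounded (U n)" "\<And>n. diameter (U n) \<le> \<delta>"
    "(\<Sum>n. ennreal (pi * (diameter (U n) / 2)\<^sup>2)) < hausdorff2_premeasure \<delta> A + ennreal e"
proof -
  have "hausdorff2_premeasure \<delta> A < hausdorff2_premeasure \<delta> A + ennreal e"
    using assms by (cases "hausdorff2_premeasure \<delta> A") (auto simp flip: ennreal_plus intro!: ennreal_lessI)
  then have "\<exists>U\<in>{U. A \<subseteq> (\<Union>n. U n) \<and> (\<forall>n. bounded (U n) \<and> diameter (U n) \<le> \<delta>)}.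
      (\<Sum>n. ennreal (pi * (diameter (U n) / 2)\<^sup>2)) < hausdorff2_premeasure \<delta> A + ennreal e"
    by (subst (asm) (1) hausdorff2_premeasure_def) (simp only: INF_less_iff)
  then show ?thesis using that by auto
qed

lemma hausdorff2_premeasure_mono:
  "A \<subseteq> B \<Longrightarrow> hausdorff2_premeasure \<delta> A \<le> hausdorff2_premeasure \<delta> B"
  unfolding hausdorff2_premeasure_def by (rule INF_superset_mono) auto

lemma hausdorff2_premeasure_antimono:
  "\<delta> \<le> \<delta>' \<Longrightarrow> hausdorff2_premeasure \<delta>' A \<le> hausdorff2_premeasure \<delta> A"
  unfolding hausdorff2_premeasure_def by (rule INF_superset_mono) (auto intro: order.trans)

lemma hausdorff2_premeasure_empty: "0 < \<delta> \<Longrightarrow> hausdorff2_premeasure \<delta> {} = 0"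
  using hausdorff2_premeasure_le[of "{}" "\<lambda>_. {}" \<delta>] by simp

lemma hausdorff2_premeasure_subadditive:
  assumes "0 < \<delta>"
  shows "hausdorff2_premeasure \<delta> (\<Union>i. A i) \<le> (\<Sum>i. hausdorff2_premeasure \<delta> (A i))"
proof (rule ennreal_le_epsilon)
  fix e :: real assume e: "0 < e" and fin: "(\<Sum>i. hausdorff2_premeasure \<delta> (A i)) < top"
  have "\<exists>U. A i \<subseteq> (\<Union>n. U n) \<and> (\<forall>n. bounded (U n)) \<and> (\<forall>n. diameter (U n) \<le> \<delta>) \<and>
    (\<Sum>n. ennreal (pi * (diameter (U n) / 2)\<^sup>2)) \<le> hausdorff2_premeasure \<delta> (A i) + e * (1/2) ^ Suc i" for i
  proof -
    have "hausdorff2_premeasure \<delta> (A i) < \<infinity>"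
      using ennreal_suminf_lessD[OF fin] by simp
    moreover have "0 < e * (1/2) ^ Suc i" using e by simp
    ultimately obtain U where "A i \<subseteq> (\<Union>n. U n)" "\<And>n. bounded (U n)" "\<And>n. diameter (U n) \<le> \<delta>"
      "(\<Sum>n. ennreal (pi * (diameter (U n) / 2)\<^sup>2)) < hausdorff2_premeasure \<delta> (A i) + ennreal (e * (1/2) ^ Suc i)"
      using hausdorff2_premeasure_cover by metis
    then show ?thesis by (intro exI[of _ U] conjI allI) (auto intro: less_imp_le)
  qed
  then obtain U where U: "\<And>i. A i \<subseteq> (\<Union>n. U i n)" "\<And>i n. bounded (U i n)" "\<And>i n. diameter (U i n) \<le> \<delta>"
    "\<And>i. (\<Sum>n. ennreal (pi * (diameter (U i n) / 2)\<^sup>2)) \<le> hausdorff2_premeasure \<delta> (A i) + e * (1/2) ^ Suc i"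
    by metis
  \<comment> \<open>The covers of the sets \<open>A i\<close>, each within e/2^(i+1) of optimal, are
    merged into one sequence along the enumeration of pairs.\<close>
  define V where "V k = (case prod_decode k of (i, n) \<Rightarrow> U i n)" for k
  have VU: "U i n = V (prod_encode (i, n))" for i n by (simp add: V_def)
  have "hausdorff2_premeasure \<delta> (\<Union>i. A i) \<le> (\<Sum>k. ennreal (pi * (diameter (V k) / 2)\<^sup>2))"
  proof (rule hausdorff2_premeasure_le)
    show "(\<Union>i. A i) \<subseteq> (\<Union>n. V n)"
    proof
      fix x assume "x \<in> (\<Union>i. A i)"
      then obtain i n where "x \<in> U i n" using U(1) by blast
      then have "x \<in> V (prod_encode (i, n))" by (simp only: VU)
      then show "x \<in> (\<Union>n. V n)" by (rule UN_I[OF UNIV_I])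
    qed
  qed (auto simp: V_def U split: prod.splits)
  also have "\<dots> = (\<Sum>k. (\<lambda>(i, n). ennreal (pi * (diameter (U i n) / 2)\<^sup>2)) (prod_decode k))"
    by (intro suminf_cong) (auto simp: V_def split: prod.splits)
  also have "\<dots> = (\<Sum>i. \<Sum>n. ennreal (pi * (diameter (U i n) / 2)\<^sup>2))"
    by (rule suminf_ennreal_2dimen) auto
  also have "\<dots> \<le> (\<Sum>i. hausdorff2_premeasure \<delta> (A i) + e * (1/2) ^ Suc i)"
    by (intro suminf_le U) auto
  also have "\<dots> = (\<Sum>n. hausdorff2_premeasure \<delta> (A n)) + (\<Sum>n. ennreal e * ennreal ((1/2) ^ Suc n))"
    using \<open>0 < e\<close> by (subst suminf_add[symmetric])
       (auto simp del: ennreal_suminf_cmult simp add: ennreal_mult[symmetric])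
  also have "\<dots> = (\<Sum>n. hausdorff2_premeasure \<delta> (A n)) + e"
    unfolding ennreal_suminf_cmult
    by (subst suminf_ennreal_eq[OF zero_le_power power_half_series]) auto
  finally show "hausdorff2_premeasure \<delta> (\<Union>i. A i) \<le> (\<Sum>i. hausdorff2_premeasure \<delta> (A i)) + ennreal e" .
qed

text \<open>A set of diameter at most \<delta> < e cannot meet both \<open>A\<close> and
  \<open>B\<close>, so every cover of the union splits into a cover of \<open>A\<close> and one of
  \<open>B\<close>.\<close>

lemma hausdorff2_premeasure_metric:
  assumes "0 < e" and sep: "\<And>a b. a \<in> A \<Longrightarrow> b \<in> B \<Longrightarrow> e \<le> dist a b" and "\<delta> < e"
  shows "hausdorff2_premeasure \<delta> A + hausdorff2_premeasure \<delta> B \<le> hausdorff2_premeasure \<delta> (A \<union> B)"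
  unfolding hausdorff2_premeasure_def[of \<delta> "A \<union> B"]
proof (rule INF_greatest, safe)
  fix U :: "nat \<Rightarrow> (real^3) set"
  assume cov: "A \<union> B \<subseteq> (\<Union>n. U n)" and bd: "\<forall>n. bounded (U n) \<and> diameter (U n) \<le> \<delta>"
  have "0 \<le> \<delta>" using bd diameter_ge_0 order.trans by blast
  \<comment> \<open>Sets belonging to the other part are replaced by the empty set, which costs
    nothing and keeps both covers indexed by all natural numbers.\<close>
  define V W where "V n = (if U n \<inter> A = {} then {} else U n)"
    and "W n = (if U n \<inter> A = {} then U n else {})" for n
  have UB: "U n \<inter> B = {}" if UA: "U n \<inter> A \<noteq> {}" for n
  proof (rule ccontr)
    assume "U n \<inter> B \<noteq> {}"
    then obtain b where "b \<in> U n" "b \<in> B" by auto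
    moreover obtain a where "a \<in> U n" "a \<in> A" using UA by auto
    ultimately have "e \<le> \<delta>"
      using sep[of a b] diameter_bounded_bound[of "U n" a b] bd by (meson order.trans)
    then show False using \<open>\<delta> < e\<close> by simp
  qed
  have VA: "A \<subseteq> (\<Union>n. V n)"
  proof
    fix x assume x: "x \<in> A"
    then obtain n where "x \<in> U n" using cov by auto
    with x have "x \<in> V n" by (auto simp: V_def)
    then show "x \<in> (\<Union>n. V n)" by blast
  qed
  have WB: "B \<subseteq> (\<Union>n. W n)"
  proof
    fix x assume x: "x \<in> B"
    then obtain n where "x \<in> U n" using cov by auto
    with x UB[of n] have "x \<in> W n" by (auto simp: W_def)
    then show "x \<in> (\<Union>n. W n)" by blast
  qed
  have "hausdorff2_premeasure \<delta> A + hausdorff2_premeasure \<delta> B \<le>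
    (\<Sum>n. ennreal (pi * (diameter (V n) / 2)\<^sup>2)) + (\<Sum>n. ennreal (pi * (diameter (W n) / 2)\<^sup>2))"
    by (intro add_mono hausdorff2_premeasure_le VA WB) (use bd \<open>0 \<le> \<delta>\<close> in \<open>auto simp: V_def W_def\<close>)
  also have "\<dots> = (\<Sum>n. ennreal (pi * (diameter (V n) / 2)\<^sup>2) + ennreal (pi * (diameter (W n) / 2)\<^sup>2))"
    by (rule suminf_add) auto
  also have "\<dots> = (\<Sum>n. ennreal (pi * (diameter (U n) / 2)\<^sup>2))"
    by (intro suminf_cong) (auto simp: V_def W_def)
  finally show "hausdorff2_premeasure \<delta> A + hausdorff2_premeasure \<delta> B
    \<le> (\<Sum>n. ennreal (pi * (diameter (U n) / 2)\<^sup>2))" .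
qed

lemma hausdorff2_premeasure_le_outer: "0 < \<delta> \<Longrightarrow> hausdorff2_premeasure \<delta> A \<le> hausdorff2_outer A"
  unfolding hausdorff2_outer_def by (rule SUP_upper) auto

lemma hausdorff2_outer_subadditive: "hausdorff2_outer (\<Union>i. A i) \<le> (\<Sum>i. hausdorff2_outer (A i))"
  unfolding hausdorff2_outer_def[of "\<Union>i. A i"]
proof (rule SUP_least)
  fix \<delta> :: real assume d: "\<delta> \<in> {0<..}"
  have "hausdorff2_premeasure \<delta> (\<Union>i. A i) \<le> (\<Sum>i. hausdorff2_premeasure \<delta> (A i))"
    using d by (intro hausdorff2_premeasure_subadditive) auto
  also have "\<dots> \<le> (\<Sum>i. hausdorff2_outer (A i))"
    using d by (intro suminf_le hausdorff2_premeasure_le_outer) auto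
  finally show "hausdorff2_premeasure \<delta> (\<Union>i. A i) \<le> (\<Sum>i. hausdorff2_outer (A i))" .
qed

lemma hausdorff2_outer_mono: "A \<subseteq> B \<Longrightarrow> hausdorff2_outer A \<le> hausdorff2_outer B"
  unfolding hausdorff2_outer_def by (intro SUP_mono' hausdorff2_premeasure_mono)

lemma hausdorff2_outer_empty: "hausdorff2_outer {} = 0"
  by (auto simp: hausdorff2_outer_def hausdorff2_premeasure_empty)

lemma hausdorff2_outer_metric:
  assumes "0 < e" "\<And>a b. a \<in> A \<Longrightarrow> b \<in> B \<Longrightarrow> e \<le> dist a b"
  shows "hausdorff2_outer A + hausdorff2_outer B \<le> hausdorff2_outer (A \<union> B)"
proof -
  \<comment> \<open>The supremum over all scales is reached along a decreasing sequence of scales,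
    so that the sum of two suprema is a supremum of sums. The shift by 2 makes every scale smaller
    than e, as the splitting of covers demands.\<close>
  have "hausdorff2_outer X = (SUP n. hausdorff2_premeasure (e / real (n + 2)) X)" for X
  proof (rule antisym)
    show "hausdorff2_outer X \<le> (SUP n. hausdorff2_premeasure (e / real (n + 2)) X)"
      unfolding hausdorff2_outer_def
    proof (rule SUP_mono)
      fix \<delta> :: real assume "\<delta> \<in> {0<..}"
      then obtain n where n: "e / \<delta> < real n" using reals_Archimedean2 by blast
      then have "e / real (n + 2) \<le> \<delta>" using \<open>\<delta> \<in> _\<close> \<open>0 < e\<close>
        by (auto simp: field_simps intro: order.trans[of e "real n * \<delta>"])
      then show "\<exists>n\<in>UNIV. hausdorff2_premeasure \<delta> X \<le> hausdorff2_premeasure (e / real (n + 2)) X"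
        using hausdorff2_premeasure_antimono by blast
    qed
    show "(SUP n. hausdorff2_premeasure (e / real (n + 2)) X) \<le> hausdorff2_outer X"
      using \<open>0 < e\<close> by (intro SUP_least hausdorff2_premeasure_le_outer) auto
  qed note eq = this
  have inc: "incseq (\<lambda>n. hausdorff2_premeasure (e / real (n + 2)) X)" for X
    using \<open>0 < e\<close> by (intro incseq_SucI hausdorff2_premeasure_antimono) (auto simp: field_simps)
  have "hausdorff2_outer A + hausdorff2_outer B =
      (SUP n. hausdorff2_premeasure (e / real (n + 2)) A + hausdorff2_premeasure (e / real (n + 2)) B)"
    unfolding eq by (rule ennreal_SUP_add[symmetric]) (intro inc)+
  also have "\<dots> \<le> hausdorff2_outer (A \<union> B)"
  proof (rule SUP_least)
    fix n :: nat
    have "hausdorff2_premeasure (e / real (n + 2)) A + hausdorff2_premeasure (e / real (n + 2)) B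
      \<le> hausdorff2_premeasure (e / real (n + 2)) (A \<union> B)"
    proof (rule hausdorff2_premeasure_metric[of e])
      have "e * 1 < e * real (n + 2)" using \<open>0 < e\<close> by (intro mult_strict_left_mono) auto
      then show "e / real (n + 2) < e" by (simp add: field_simps)
    qed (use assms in auto)
    also have "\<dots> \<le> hausdorff2_outer (A \<union> B)"
      using assms by (intro hausdorff2_premeasure_le_outer) auto
    finally show "hausdorff2_premeasure (e / real (n + 2)) A + hausdorff2_premeasure (e / real (n + 2)) B
      \<le> hausdorff2_outer (A \<union> B)" .
  qed
  finally show ?thesis .
qed

lemma hausdorff2_outer_Un: "hausdorff2_outer (A \<union> B) \<le> hausdorff2_outer A + hausdorff2_outer B"
proof -
  define S where "S n = (if n = 0 then A else if n = 1 then B else {})" for n :: nat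
  have "(\<Union>n. S n) = A \<union> B" by (force simp: S_def)
  moreover have "(\<Sum>n. hausdorff2_outer (S n)) = (\<Sum>n\<in>{0,1}. hausdorff2_outer (S n))"
    by (rule suminf_finite) (auto simp: S_def hausdorff2_outer_empty)
  ultimately show ?thesis using hausdorff2_outer_subadditive[of S] by (simp add: S_def)
qed

lemma measure_space_hausdorff2: "measure_space UNIV (sets borel) hausdorff2_outer"
proof (rule metric_outer_measure_space_borel)
  show "outer_measure_space UNIV hausdorff2_outer"
    by (auto simp: outer_measure_space_def positive_def increasing_def countably_subadditive_def
        hausdorff2_outer_empty hausdorff2_outer_mono hausdorff2_outer_subadditive)
qed (rule hausdorff2_outer_metric hausdorff2_outer_subadditive; assumption?; blast?)+

section \<open>Hausdorff measure and surface measure on Borel sets\<close>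

lemma space_hausdorff2 [simp]: "space hausdorff2 = UNIV"
  and sets_hausdorff2 [simp]: "sets hausdorff2 = sets borel"
  unfolding hausdorff2_def by (simp_all, metis sets.sigma_sets_eq space_borel)

lemma emeasure_hausdorff2: "A \<in> sets borel \<Longrightarrow> emeasure hausdorff2 A = hausdorff2_outer A"
  unfolding hausdorff2_def
  using emeasure_measure_of_sigma[of UNIV "sets borel" hausdorff2_outer A] measure_space_hausdorff2
    sets.sigma_algebra_axioms[of borel]
  by (simp add: measure_space_def hausdorff2_outer_def[abs_def])

lemma space_surface_measure [simp]: "space (surface_measure \<Omega>) = frontier \<Omega>"
  by (simp add: surface_measure_def space_restrict_space)

lemma sets_surface_measure: "sets (surface_measure \<Omega>) = sets (restrict_space borel (frontier \<Omega>))"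
  unfolding surface_measure_def by (rule sets_restrict_space_cong) simp

lemma emeasure_surface_measure:
  "A \<in> sets borel \<Longrightarrow> A \<subseteq> frontier \<Omega> \<Longrightarrow> emeasure (surface_measure \<Omega>) A = hausdorff2_outer A"
  unfolding surface_measure_def
  by (subst emeasure_restrict_space) (auto simp: emeasure_hausdorff2)

text \<open>A set of diameter \<open>d\<close> lies in a disc of area \<open>\<pi> d\<^sup>2\<close>, which is four times its contribution
  \<open>\<pi> (d / 2)\<^sup>2\<close> to the premeasure.\<close>

lemma area_projection_le_hausdorff2:
  fixes P :: "real^3 \<Rightarrow> real^2"
  assumes P: "\<And>x y. dist (P x) (P y) \<le> dist x y" and S: "S \<subseteq> P ` A" "S \<in> sets lborel"
  shows "emeasure lborel S \<le> 4 * hausdorff2_outer A"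
proof -
  have "emeasure lborel S / 4 \<le> hausdorff2_premeasure 1 A"
    unfolding hausdorff2_premeasure_def
  proof (rule INF_greatest, safe)
    fix U :: "nat \<Rightarrow> (real^3) set"
    assume cov: "A \<subseteq> (\<Union>n. U n)" and bd: "\<forall>n. bounded (U n) \<and> diameter (U n) \<le> 1"
    define B where "B n = (if U n = {} then {} else cball (P (SOME x. x \<in> U n)) (diameter (U n)))" for n
    have PB: "P ` U n \<subseteq> B n" for n
    proof (cases "U n = {}")
      case False
      then have s: "(SOME x. x \<in> U n) \<in> U n" by (simp add: some_in_eq)
      show ?thesis
      proof
        fix y assume "y \<in> P ` U n"
        then obtain x where x: "x \<in> U n" "y = P x" by auto
        have "dist (P (SOME x. x \<in> U n)) (P x) \<le> diameter (U n)"
          using P diameter_bounded_bound[of "U n", OF _ s x(1)] bd order.trans by blast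
        then show "y \<in> B n" using False x by (auto simp: B_def)
      qed
    qed auto
    have "emeasure lborel (B n) \<le> 4 * ennreal (pi * (diameter (U n) / 2)\<^sup>2)" for n
    proof (cases "U n = {}")
      case False
      then have "emeasure lborel (B n) = ennreal (pi * (diameter (U n))\<^sup>2)"
        using bd by (simp add: B_def emeasure_cball diameter_ge_0 unit_ball_vol_2)
      also have "\<dots> = ennreal (4 * (pi * (diameter (U n) / 2)\<^sup>2))" by (simp add: power_divide)
      also have "\<dots> = 4 * ennreal (pi * (diameter (U n) / 2)\<^sup>2)" by (subst ennreal_mult) auto
      finally show ?thesis by simp
    qed (auto simp: B_def)
    have "emeasure lborel S \<le> emeasure lborel (\<Union>n. B n)"
    proof (rule emeasure_mono)
      show "S \<subseteq> (\<Union>n. B n)"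
      proof
        fix y assume "y \<in> S"
        then obtain x where x: "x \<in> A" "y = P x" using S by auto
        then obtain n where "x \<in> U n" using cov by auto
        then have "y \<in> B n" using PB[of n] x by auto
        then show "y \<in> (\<Union>n. B n)" by blast
      qed
    qed (auto simp: B_def)
    also have "\<dots> \<le> (\<Sum>n. emeasure lborel (B n))"
      by (rule emeasure_subadditive_countably) (auto simp: B_def)
    also have "\<dots> \<le> (\<Sum>n. 4 * ennreal (pi * (diameter (U n) / 2)\<^sup>2))"
      by (intro suminf_le) (auto simp: \<open>\<And>n. emeasure lborel (B n) \<le> _\<close>)
    also have "\<dots> = 4 * (\<Sum>n. ennreal (pi * (diameter (U n) / 2)\<^sup>2))" by simp
    finally show "emeasure lborel S / 4 \<le> (\<Sum>n. ennreal (pi * (diameter (U n) / 2)\<^sup>2))"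
      by (simp add: divide_le_posI_ennreal mult.commute)
  qed
  also have "\<dots> \<le> hausdorff2_outer A" by (rule hausdorff2_premeasure_le_outer) simp
  finally have "4 * (emeasure lborel S / 4) \<le> 4 * hausdorff2_outer A" by (rule mult_left_mono) simp
  moreover have "4 * (emeasure lborel S / 4) = emeasure lborel S * 4 / 4"
    using ennreal_times_divide[of 4 "emeasure lborel S" 4] mult.commute[of 4 "emeasure lborel S"] by metis
  ultimately show ?thesis using ennreal_mult_divide_eq[of 4 "emeasure lborel S"] by simp
qed

section \<open>Boundaries that are locally Lipschitz graphs\<close>

text \<open>The square is cut into cells of side 2m/N. Their images have diameter at most 4Lm/N, and
  as there are of order N^2 of them the total contribution is bounded independently of N, hence of
  the scale \<delta>.\<close>

lemma hausdorff2_lipschitz_image_finite: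
  fixes G :: "real^2 \<Rightarrow> real^3"
  assumes m: "0 < m" and L: "L-lipschitz_on {a. \<forall>i. \<bar>a $ i\<bar> \<le> m} G"
  shows "hausdorff2_outer (G ` {a. \<forall>i. \<bar>a $ i\<bar> \<le> m}) < \<infinity>"
proof -
  let ?S = "{a :: real^2. \<forall>i. \<bar>a $ i\<bar> \<le> m}"
  have L0: "0 \<le> L" using L by (rule lipschitz_on_nonneg)
  have "hausdorff2_premeasure \<delta> (G ` ?S) \<le> ennreal (16 * pi * L\<^sup>2 * m\<^sup>2)" if d: "0 < \<delta>" for \<delta>
  proof -
    obtain N :: nat where N: "4 * L * m / \<delta> < real N" "N > 0"
      by (metis gr_zeroI less_trans of_nat_0_less_iff reals_Archimedean2 zero_less_one of_nat_1 max_less_iff_conj)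
    \<comment> \<open>One more row and column than the square has: a coordinate equal to m gets the
      index N.\<close>
    define M where "M = N + 1"
    define cell where "cell j k = {a \<in> ?S. - m + 2 * m * real j / N \<le> a $ 1 \<and> a $ 1 \<le> - m + 2 * m * real (Suc j) / N \<and>
       - m + 2 * m * real k / N \<le> a $ 2 \<and> a $ 2 \<le> - m + 2 * m * real (Suc k) / N}" for j k :: nat
    define U where "U n = (if n < M*M then G ` cell (n div M) (n mod M) else {})" for n
    have cd: "dist (G a) (G b) \<le> L * (4 * m / N)" if "a \<in> cell j k" "b \<in> cell j k" for a b j k
    proof -
      have "\<bar>a $ 1 - b $ 1\<bar> \<le> 2 * m / N" "\<bar>a $ 2 - b $ 2\<bar> \<le> 2 * m / N"
        using that by (auto simp: cell_def abs_le_iff add_divide_distrib distrib_left)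
      then have "dist a b \<le> 4 * m / N"
        using norm_le_l1_cart[of "a - b"] by (simp add: dist_norm sum_2)
      moreover have "dist (G a) (G b) \<le> L * dist a b"
        using that by (intro lipschitz_onD[OF L]) (auto simp: cell_def)
      ultimately show ?thesis using L0 by (meson mult_left_mono order.trans)
    qed
    have diam: "diameter (U n) \<le> L * (4 * m / N)" for n
      unfolding U_def using cd L0 m by (auto intro!: diameter_le simp: dist_norm)
    have bdd: "bounded (U n)" for n
    proof -
      have "bounded (G ` cell j k)" for j k
      proof (cases "cell j k = {}")
        case False
        then obtain a where "a \<in> cell j k" by auto
        then show ?thesis unfolding bounded_def using cd by blast
      qed auto
      then show ?thesis by (simp add: U_def)
    qed
    have cov: "G ` ?S \<subseteq> (\<Union>n. U n)"
    proof
      fix y assume "y \<in> G ` ?S"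
      then obtain a where a: "a \<in> ?S" "y = G a" by auto
      define j where "j i = nat \<lfloor>(a $ i + m) * N / (2 * m)\<rfloor>" for i
      have j: "real (j i) \<le> (a $ i + m) * N / (2 * m)" "(a $ i + m) * N / (2 * m) < real (j i) + 1" "j i \<le> N" for i
      proof -
        have am: "- m \<le> a $ i" "a $ i \<le> m" using a by (auto simp: abs_le_iff minus_le_iff)
        have p: "0 \<le> (a $ i + m) * N / (2 * m)" using am m by simp
        show 1: "real (j i) \<le> (a $ i + m) * N / (2 * m)" "(a $ i + m) * N / (2 * m) < real (j i) + 1"
          using p unfolding j_def by auto
        have "(a $ i + m) * N / (2 * m) \<le> (2 * m) * N / (2 * m)"
          using am m by (intro divide_right_mono mult_right_mono) auto
        also have "\<dots> = N" using m by simp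
        finally show "j i \<le> N" using 1 by linarith
      qed
      have "a \<in> cell (j 1) (j 2)"
        using a j[of 1] j[of 2] m \<open>N > 0\<close> by (auto simp: cell_def field_simps)
      moreover have "(j 1 * M + j 2) div M = j 1" "(j 1 * M + j 2) mod M = j 2"
      proof -
        have "j 2 < M" using j(3)[of 2] by (simp add: M_def)
        then show "(j 1 * M + j 2) div M = j 1" "(j 1 * M + j 2) mod M = j 2" by simp_all
      qed
      moreover have "j 1 * M + j 2 < M*M"
      proof -
        have "j 1 * M \<le> N * M" using j(3)[of 1] by (rule mult_right_mono) simp
        then show ?thesis using j(3)[of 2] by (simp add: M_def)
      qed
      ultimately have "y \<in> U (j 1 * M + j 2)" using a by (simp add: U_def del: add_mult_distrib2)
      then show "y \<in> (\<Union>n. U n)" by blast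
    qed
    have "L * (4 * m / N) \<le> \<delta>" using N d by (simp add: field_simps)
    then have "hausdorff2_premeasure \<delta> (G ` ?S) \<le> (\<Sum>n. ennreal (pi * (diameter (U n) / 2)\<^sup>2))"
      using diam by (intro hausdorff2_premeasure_le cov bdd) (meson order.trans)
    also have "\<dots> = (\<Sum>n<M*M. ennreal (pi * (diameter (U n) / 2)\<^sup>2))"
      by (rule suminf_finite) (auto simp: U_def)
    also have "\<dots> \<le> (\<Sum>n<M*M. ennreal (pi * (L * (4 * m / N) / 2)\<^sup>2))"
      using diam bdd by (intro sum_mono ennreal_leI mult_left_mono power_mono divide_right_mono)
        (auto simp: diameter_ge_0)
    also have "\<dots> = ennreal (real (M*M) * (pi * (L * (4 * m / N) / 2)\<^sup>2))"
      by (simp add: ennreal_mult ennreal_of_nat_eq_real_of_nat del: of_nat_mult of_nat_add)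
    also have "\<dots> \<le> ennreal ((real N * 2)^2 * (pi * (L * (4 * m / N) / 2)\<^sup>2))"
    proof (intro ennreal_leI mult_right_mono)
      have "real M * real M \<le> (real N * 2) * (real N * 2)"
        using N(2) by (intro mult_mono) (auto simp: M_def)
      then show "real (M*M) \<le> (real N * 2)^2" by (simp add: power2_eq_square)
    qed auto
    also have "(real N * 2)^2 * (pi * (L * (4 * m / N) / 2)\<^sup>2) = 16 * pi * L\<^sup>2 * m\<^sup>2"
      using N(2) by (simp add: power_mult_distrib power_divide)
    finally show ?thesis .
  qed
  then have "hausdorff2_outer (G ` ?S) \<le> ennreal (16 * pi * L\<^sup>2 * m\<^sup>2)"
    unfolding hausdorff2_outer_def by (intro SUP_least) auto
  then show ?thesis by (rule order.strict_trans1) simp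
qed

section \<open>Locally Lipschitz graph functions\<close>

text \<open>A common weakening of \<open>lipschitz_function\<close> and \<open>C11_function\<close>,
  so that one set of chart lemmas serves both. The gradient of a C11 function may grow linearly, so
  such a function can fail to be globally Lipschitz.\<close>

definition locally_lipschitz :: "('a::real_normed_vector \<Rightarrow> 'b::metric_space) \<Rightarrow> bool" where
  "locally_lipschitz f \<longleftrightarrow> (\<forall>m. \<exists>L. L-lipschitz_on (cball 0 m) f)"

lemma locally_lipschitz_continuous:
  fixes f :: "'a::real_normed_vector \<Rightarrow> 'b::metric_space"
  assumes *: "locally_lipschitz f"
  shows "continuous_on UNIV f"
proof (intro continuous_at_imp_continuous_on ballI)
  fix x :: 'a
  from * [unfolded locally_lipschitz_def] obtain L where L: "L-lipschitz_on (cball 0 (norm x + 1)) f" by blast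
  have "continuous_on (ball 0 (norm x + 1)) f"
    using lipschitz_on_continuous_on[OF L] continuous_on_subset by (meson ball_subset_cball)
  then show "isCont f x" by (rule continuous_on_interior) simp
qed

lemma lipschitz_function_locally_lipschitz: "lipschitz_function f \<Longrightarrow> locally_lipschitz f"
  unfolding locally_lipschitz_def lipschitz_function_def by (meson lipschitz_on_subset subset_UNIV)

lemma frechet_derivative_partial_deriv:
  fixes f :: "real^'n::finite \<Rightarrow> real"
  assumes "f differentiable at x"
  shows "frechet_derivative f (at x) h = (\<Sum>i\<in>UNIV. h $ i * partial_deriv i f x)"
proof -
  have lin: "linear (frechet_derivative f (at x))" using assms by (rule linear_frechet_derivative)
  have "frechet_derivative f (at x) h = frechet_derivative f (at x) (\<Sum>i\<in>UNIV. h $ i *\<^sub>R axis i 1)"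
    using basis_expansion[of h] by (simp add: scalar_mult_eq_scaleR)
  also have "\<dots> = (\<Sum>i\<in>UNIV. h $ i * partial_deriv i f x)"
    by (simp add: linear_sum[OF lin] linear_cmul[OF lin] partial_deriv_def)
  finally show ?thesis .
qed

lemma C11_function_locally_lipschitz:
  assumes "C11_function f"
  shows "locally_lipschitz f"
  unfolding locally_lipschitz_def
proof
  fix m :: real
  from assms have df: "\<And>x. f differentiable at x" and "\<forall>i. \<exists>L. L-lipschitz_on UNIV (partial_deriv i f)"
    by (auto simp: C11_function_def differentiable_on_def)
  then obtain L where L: "\<And>i. (L i)-lipschitz_on UNIV (partial_deriv i f)" by metis
  \<comment> \<open>On \<open>cball 0 m\<close> the i-th partial derivative differs from its value
    at 0 by at most \<open>L i\<close> times |m|; \<open>B\<close> thus bounds the gradient there,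
    and the mean value inequality makes it a Lipschitz constant.\<close>
  define B where "B = (\<Sum>i\<in>UNIV. \<bar>partial_deriv i f 0\<bar> + L i * \<bar>m\<bar>)"
  have B0: "0 \<le> B" unfolding B_def using lipschitz_on_nonneg[OF L] by (intro sum_nonneg) auto
  have "norm (frechet_derivative f (at x) h) \<le> B * norm h" if "x \<in> cball 0 m" for x h
  proof -
    have "norm (frechet_derivative f (at x) h) \<le> (\<Sum>i\<in>UNIV. \<bar>h $ i * partial_deriv i f x\<bar>)"
      unfolding frechet_derivative_partial_deriv[OF df] by (simp add: sum_abs)
    also have "\<dots> \<le> (\<Sum>i\<in>UNIV. norm h * (\<bar>partial_deriv i f 0\<bar> + L i * \<bar>m\<bar>))"
    proof (rule sum_mono)
      fix i
      have "\<bar>partial_deriv i f x - partial_deriv i f 0\<bar> \<le> L i * norm x"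
        using lipschitz_onD[OF L, of x 0 i] by (simp add: dist_norm)
      also have "\<dots> \<le> L i * \<bar>m\<bar>"
        using that lipschitz_on_nonneg[OF L, of i] by (intro mult_left_mono) auto
      finally have "\<bar>partial_deriv i f x\<bar> \<le> \<bar>partial_deriv i f 0\<bar> + L i * \<bar>m\<bar>" by linarith
      then show "\<bar>h $ i * partial_deriv i f x\<bar> \<le> norm h * (\<bar>partial_deriv i f 0\<bar> + L i * \<bar>m\<bar>)"
        unfolding abs_mult by (intro mult_mono component_le_norm_cart) auto
    qed
    finally show ?thesis by (simp add: B_def sum_distrib_left mult.commute)
  qed
  then have "onorm (frechet_derivative f (at x)) \<le> B" if "x \<in> cball 0 m" for x
    using that B0 by (intro onorm_bound) auto
  then have "norm (f x - f y) \<le> B * norm (x - y)" if "x \<in> cball 0 m" "y \<in> cball 0 m" for x y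
    using that df by (intro differentiable_bound[of "cball 0 m" f "\<lambda>x. frechet_derivative f (at x)"])
      (auto simp: frechet_derivative_works[symmetric] intro: has_derivative_at_withinI frechet_derivative_works[THEN iffD1])
  then show "\<exists>L. L-lipschitz_on (cball 0 m) f"
    using B0 by (intro exI[of _ B] lipschitz_onI) (auto simp: dist_norm)
qed

section \<open>Horizontal and vertical coordinates in space\<close>

definition proj2 :: "real^3 \<Rightarrow> real^2" where "proj2 y = vector [y $ 1, y $ 2]"

definition embed2 :: "real^2 \<Rightarrow> real \<Rightarrow> real^3" where "embed2 a s = vector [a $ 1, a $ 2, s]"

lemma proj2_nth [simp]: "proj2 y $ 1 = y $ 1" "proj2 y $ 2 = y $ 2"
  by (simp_all add: proj2_def)

lemma embed2_nth [simp]: "embed2 a s $ 1 = a $ 1" "embed2 a s $ 2 = a $ 2" "embed2 a s $ 3 = s"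
  by (simp_all add: embed2_def)

lemma proj2_embed2 [simp]: "proj2 (embed2 a s) = a"
  by (simp add: vec_eq_iff forall_2)

lemma embed2_proj2 [simp]: "embed2 (proj2 y) (y $ 3) = y"
  by (simp add: vec_eq_iff forall_3)

lemma embed2_diff: "embed2 a s - embed2 b t = embed2 (a - b) (s - t)"
  by (simp add: vec_eq_iff forall_3)

lemma proj2_diff: "proj2 x - proj2 y = proj2 (x - y)"
  by (simp add: vec_eq_iff forall_2)

lemma norm_proj2_le: "norm (proj2 y) \<le> norm y"
  by (simp add: norm_vec_def L2_set_def sum_2 sum_3)

lemma norm_embed2_le: "norm (embed2 a s) \<le> norm a + \<bar>s\<bar>"
proof -
  have "norm (embed2 a s) = sqrt ((norm a)\<^sup>2 + s\<^sup>2)"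
    by (simp add: norm_vec_def L2_set_def sum_2 sum_3)
  also have "\<dots> \<le> norm a + \<bar>s\<bar>"
    by (rule sqrt_sum_squares_le_sum_abs[of "norm a" s, simplified])
  finally show ?thesis .
qed

lemma continuous_on_proj2 [continuous_intros]: "continuous_on S f \<Longrightarrow> continuous_on S (\<lambda>x. proj2 (f x))"
  by (rule continuous_on_compose2[of UNIV proj2 S f, OF lipschitz_on_continuous_on[of 1]])
    (auto intro!: lipschitz_onI simp: dist_norm proj2_diff norm_proj2_le)

lemma continuous_on_embed2 [continuous_intros]:
  assumes "continuous_on S f" "continuous_on S g"
  shows "continuous_on S (\<lambda>x. embed2 (f x) (g x))"
proof -
  have eq: "embed2 (f x) (g x) = f x $ 1 *\<^sub>R axis 1 1 + f x $ 2 *\<^sub>R axis 2 1 + g x *\<^sub>R axis 3 1" for x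
    by (simp add: vec_eq_iff forall_3 axis_def)
  show ?thesis unfolding eq by (intro continuous_intros assms)
qed

section \<open>Geometry of a single graph chart\<close>

text \<open>One chart in the sense of \<open>boundary_of_class\<close>, with \<gamma> merely
  continuous. This is enough for the topological facts; the estimates of area add local Lipschitz
  continuity.\<close>

locale graph_chart =
  fixes D :: "(real^3) set" and p :: "real^3" and r :: real and Q :: "real^3 \<Rightarrow> real^3" and \<gamma> :: "real^2 \<Rightarrow> real"
  assumes open_D: "open D" and r_pos: "0 < r" and orth: "orthogonal_transformation Q"
    and cont: "continuous_on UNIV \<gamma>"
    and chart: "D \<inter> ball p r = {x \<in> ball p r. Q x $ 3 > \<gamma> (proj2 (Q x))}"
begin

definition "Q' = inv Q"

lemma Q_Q' [simp]: "Q (Q' x) = x" and Q'_Q [simp]: "Q' (Q x) = x"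
  unfolding Q'_def using orthogonal_transformation_bij[OF orth]
  by (simp_all add: bij_is_surj surj_f_inv_f bij_is_inj)

lemma orth_Q': "orthogonal_transformation Q'"
  unfolding Q'_def by (rule orthogonal_transformation_inv[OF orth])

lemma linear_Q: "linear Q" and linear_Q': "linear Q'"
  using orth orth_Q' by (auto simp: orthogonal_transformation)

lemma dist_Q: "dist (Q x) (Q y) = dist x y" and dist_Q': "dist (Q' x) (Q' y) = dist x y"
  using orth orth_Q' by (auto simp: orthogonal_transformation_isometry)

lemma norm_Q: "norm (Q x) = norm x" and norm_Q': "norm (Q' x) = norm x"
  using orth orth_Q' by (auto simp: orthogonal_transformation_norm)

lemma continuous_on_Q [continuous_intros]: "continuous_on S f \<Longrightarrow> continuous_on S (\<lambda>x. Q (f x))"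
  by (rule bounded_linear.continuous_on[OF linear_Q[unfolded linear_conv_bounded_linear]])

lemma continuous_on_Q' [continuous_intros]: "continuous_on S f \<Longrightarrow> continuous_on S (\<lambda>x. Q' (f x))"
  by (rule bounded_linear.continuous_on[OF linear_Q'[unfolded linear_conv_bounded_linear]])

text \<open>A continuous function on the whole space whose sign decides, inside
  \<open>ball p r\<close>, between domain (positive), boundary (zero) and exterior (negative). It
  changes at unit speed along \<open>up\<close>.\<close>

definition height :: "real^3 \<Rightarrow> real" where "height x = Q x $ 3 - \<gamma> (proj2 (Q x))"

lemma continuous_on_height [continuous_intros]: "continuous_on S f \<Longrightarrow> continuous_on S (\<lambda>x. height (f x))"
  unfolding height_def
  by (intro continuous_intros continuous_on_compose2[OF cont]) auto

lemma in_D_iff: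
  assumes "x \<in> ball p r" shows "x \<in> D \<longleftrightarrow> 0 < height x"
proof -
  have "x \<in> D \<inter> ball p r \<longleftrightarrow> \<gamma> (proj2 (Q x)) < Q x $ 3"
    unfolding chart using assms by simp
  then show ?thesis using assms by (simp add: height_def)
qed

definition up :: "real \<Rightarrow> real^3 \<Rightarrow> real^3" where "up s x = x + s *\<^sub>R Q' (axis 3 1)"

lemma height_up [simp]: "height (up s x) = height x + s"
proof -
  have "Q (up s x) = Q x + s *\<^sub>R axis 3 1"
    by (simp add: up_def linear_add[OF linear_Q] linear_cmul[OF linear_Q])
  moreover from this have "proj2 (Q (up s x)) = proj2 (Q x)"
    by (simp add: vec_eq_iff forall_2 axis_def)
  ultimately show ?thesis by (simp add: height_def axis_def)
qed

lemma dist_up [simp]: "dist (up s x) x = \<bar>s\<bar>"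
  by (simp add: up_def dist_norm norm_Q')

lemma below_not_closure:
  assumes "x \<in> ball p r" "height x < 0" shows "x \<notin> closure D"
proof
  assume c: "x \<in> closure D"
  have "open (ball p r \<inter> {x. height x < 0})"
    by (intro open_Int open_ball open_Collect_less continuous_intros)
  then obtain y where "y \<in> D" "y \<in> ball p r \<inter> {x. height x < 0}"
    using open_Int_closure_eq_empty[of "ball p r \<inter> {x. height x < 0}" D] c assms by blast
  then show False using in_D_iff[of y] by auto
qed

lemma frontier_iff:
  assumes "x \<in> ball p r" shows "x \<in> frontier D \<longleftrightarrow> height x = 0"
proof
  assume f: "x \<in> frontier D"
  then have "x \<notin> D" "x \<in> closure D" using open_D by (auto simp: frontier_def interior_open)
  then show "height x = 0" using below_not_closure[OF assms] in_D_iff[OF assms] by force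
next
  assume h: "height x = 0"
  have "x \<in> closure D"
    unfolding closure_approachable
  proof (intro allI impI)
    fix e :: real assume "0 < e"
    \<comment> \<open>Small enough for the raised point to be within e of x and still inside the
      chart ball.\<close>
    define s where "s = min (e / 2) ((r - dist p x) / 2)"
    have s: "0 < s" "s < e" "s < r - dist p x" using \<open>0 < e\<close> assms by (auto simp: s_def min_def)
    have "up s x \<in> ball p r" using s dist_triangle[of p "up s x" x] dist_up[of s x] by (simp add: dist_commute del: dist_up)
    then have "up s x \<in> D" using in_D_iff h s by simp
    then show "\<exists>y\<in>D. dist y x < e" using s by (intro bexI[of _ "up s x"]) auto
  qed
  moreover have "x \<notin> D" using in_D_iff[OF assms] h by simp
  ultimately show "x \<in> frontier D" using open_D by (auto simp: frontier_def interior_open)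
qed

lemma exterior_near:
  assumes "x \<in> ball p r" "x \<in> frontier D" "0 < e"
  shows "\<exists>y. y \<notin> closure D \<and> dist y x < e"
proof -
  define s where "s = min (e / 2) ((r - dist p x) / 2)"
  have s: "0 < s" "s < e" "s < r - dist p x" using assms by (auto simp: s_def min_def)
  have "up (-s) x \<in> ball p r" using s dist_triangle[of p "up (-s) x" x] dist_up[of "-s" x] by (simp add: dist_commute del: dist_up)
  then have "up (-s) x \<notin> closure D"
    using s assms frontier_iff by (intro below_not_closure) auto
  then show ?thesis using s by (intro exI[of _ "up (-s) x"]) auto
qed

definition graph :: "real^2 \<Rightarrow> real^3" where "graph a = Q' (embed2 a (\<gamma> a))"

lemma height_graph [simp]: "height (graph a) = 0" by (simp add: height_def graph_def)

lemma proj2_graph [simp]: "proj2 (Q (graph a)) = a" by (simp add: graph_def)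

lemma graph_proj2: "height x = 0 \<Longrightarrow> graph (proj2 (Q x)) = x"
  by (simp add: graph_def height_def) (metis Q'_Q embed2_proj2)

lemma dist_graph_le: "dist (graph a) (graph b) \<le> dist a b + \<bar>\<gamma> a - \<gamma> b\<bar>"
  unfolding graph_def dist_Q' unfolding dist_norm embed2_diff by (rule norm_embed2_le)

lemma graph_lipschitz:
  assumes "L-lipschitz_on S \<gamma>" shows "(1 + L)-lipschitz_on S graph"
proof (rule lipschitz_onI)
  fix a b assume "a \<in> S" "b \<in> S"
  then have "\<bar>\<gamma> a - \<gamma> b\<bar> \<le> L * dist a b" using lipschitz_onD[OF assms] by (auto simp: dist_real_def)
  then show "dist (graph a) (graph b) \<le> (1 + L) * dist a b"
    using dist_graph_le[of a b] by (simp add: algebra_simps)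
qed (use lipschitz_on_nonneg[OF assms] in simp)

lemma hausdorff2_frontier_finite_local:
  assumes "locally_lipschitz \<gamma>"
  shows "hausdorff2_outer (frontier D \<inter> ball p r) < \<infinity>"
proof -
  \<comment> \<open>Points of \<open>ball p r\<close> have norm at most m and Q is an isometry, so
    the square of half side m contains all their projections; the square itself lies in the disc of
    radius 2m, where \<gamma> is Lipschitz.\<close>
  define m where "m = norm p + r"
  have m: "0 < m" using r_pos by (simp add: m_def add_nonneg_pos)
  let ?S = "{a :: real^2. \<forall>i. \<bar>a $ i\<bar> \<le> m}"
  have S: "?S \<subseteq> cball 0 (2 * m)"
  proof
    fix a :: "real^2" assume "a \<in> ?S"
    then have "\<bar>a $ 1\<bar> \<le> m" "\<bar>a $ 2\<bar> \<le> m" by auto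
    then have "norm a \<le> m + m"
      using norm_le_l1_cart[of a] by (simp add: sum_2)
    then show "a \<in> cball 0 (2 * m)" by simp
  qed
  obtain L where "L-lipschitz_on (cball 0 (2 * m)) \<gamma>" using assms by (auto simp: locally_lipschitz_def)
  then have "(1 + L)-lipschitz_on ?S graph" using S lipschitz_on_subset graph_lipschitz by blast
  then have "hausdorff2_outer (graph ` ?S) < \<infinity>" by (rule hausdorff2_lipschitz_image_finite[OF m])
  moreover have "frontier D \<inter> ball p r \<subseteq> graph ` ?S"
  proof
    fix x assume x: "x \<in> frontier D \<inter> ball p r"
    then have "graph (proj2 (Q x)) = x" using frontier_iff graph_proj2 by blast
    moreover have "\<bar>proj2 (Q x) $ i\<bar> \<le> m" for i
    proof -
      have "\<bar>proj2 (Q x) $ i\<bar> \<le> norm x"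
        using component_le_norm_cart[of "proj2 (Q x)" i] norm_proj2_le[of "Q x"] norm_Q by simp
      also have "\<dots> \<le> m"
        using x norm_triangle_ineq2[of x p] by (simp add: m_def dist_norm norm_minus_commute)
      finally show ?thesis .
    qed
    ultimately show "x \<in> graph ` ?S" by (intro image_eqI[of _ _ "proj2 (Q x)"]) auto
  qed
  ultimately show ?thesis using hausdorff2_outer_mono order.strict_trans1 by blast
qed

text \<open>The chart projection does not increase distances, and the image of the boundary piece in
  \<open>ball y t\<close> contains a disc of radius t/(1+L), because \<open>graph\<close> is
  (1+L)-Lipschitz. A quarter of the area of this disc bounds the Hausdorff measure from below, which
  gives the constant \<open>pi / (4 * (1 + L)^2)\<close>.\<close>

lemma hausdorff2_frontier_lower_local:
  assumes "locally_lipschitz \<gamma>"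
  shows "\<exists>c>0. \<forall>y t. y \<in> frontier D \<longrightarrow> y \<in> ball p (r/2) \<longrightarrow> 0 < t \<longrightarrow> t \<le> r / 2 \<longrightarrow>
    ennreal (c * t\<^sup>2) \<le> hausdorff2_outer (frontier D \<inter> ball y t)"
proof -
  define m where "m = norm p + 2 * r"
  obtain L where L: "L-lipschitz_on (cball 0 m) \<gamma>" using assms by (auto simp: locally_lipschitz_def)
  have L0: "0 \<le> L" using L by (rule lipschitz_on_nonneg)
  define c where "c = pi / (4 * (1 + L)\<^sup>2)"
  have "0 < c" using L0 by (simp add: c_def)
  moreover have "ennreal (c * t\<^sup>2) \<le> hausdorff2_outer (frontier D \<inter> ball y t)"
    if y: "y \<in> frontier D" "y \<in> ball p (r/2)" and t: "0 < t" "t \<le> r / 2" for y t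
  proof -
    define s where "s = t / (1 + L)"
    have s: "0 < s" "s \<le> t" using t L0 by (auto simp: s_def field_simps)
    have yb: "y \<in> ball p r" using y r_pos by auto
    have gy: "graph (proj2 (Q y)) = y" using y frontier_iff[OF yb] graph_proj2 by blast
    have ny: "norm (proj2 (Q y)) \<le> norm p + r / 2"
      using norm_proj2_le[of "Q y"] norm_Q[of y] y norm_triangle_ineq2[of y p]
      by (simp add: dist_norm norm_minus_commute)
    have sub: "ball (proj2 (Q y)) s \<subseteq> (\<lambda>x. proj2 (Q x)) ` (frontier D \<inter> ball y t)"
    proof
      fix a assume a: "a \<in> ball (proj2 (Q y)) s"
      have "norm a \<le> norm (proj2 (Q y)) + dist (proj2 (Q y)) a"
        by (metis dist_norm norm_minus_commute norm_triangle_sub)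
      then have "a \<in> cball 0 m" "proj2 (Q y) \<in> cball 0 m"
        using a ny s t r_pos by (auto simp: m_def)
      then have "dist (graph (proj2 (Q y))) (graph a) \<le> (1 + L) * dist (proj2 (Q y)) a"
        using lipschitz_onD[OF graph_lipschitz[OF L]] by blast
      also have "\<dots> < (1 + L) * s" using a L0 by (intro mult_strict_left_mono) auto
      also have "\<dots> = t" using L0 by (simp add: s_def)
      finally have d: "graph a \<in> ball y t" by (simp add: gy)
      moreover have "dist p (graph a) \<le> dist p y + dist y (graph a)" by (rule dist_triangle)
      with d y t have "graph a \<in> ball p r" by simp
      ultimately have "graph a \<in> frontier D \<inter> ball y t" using frontier_iff by auto
      then show "a \<in> (\<lambda>x. proj2 (Q x)) ` (frontier D \<inter> ball y t)"
        by (intro image_eqI[of _ _ "graph a"]) simp_all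
    qed
    have "emeasure lborel (ball (proj2 (Q y)) s) \<le> 4 * hausdorff2_outer (frontier D \<inter> ball y t)"
    proof (rule area_projection_le_hausdorff2[OF _ sub])
      fix u v
      have "dist (proj2 (Q u)) (proj2 (Q v)) \<le> dist (Q u) (Q v)"
        unfolding dist_norm proj2_diff by (rule norm_proj2_le)
      then show "dist (proj2 (Q u)) (proj2 (Q v)) \<le> dist u v" by (simp add: dist_Q)
    qed simp
    moreover have "emeasure lborel (ball (proj2 (Q y)) s) = ennreal (4 * (c * t\<^sup>2))"
      using s by (simp add: emeasure_ball unit_ball_vol_2 s_def c_def power_divide)
    moreover have "ennreal (4 * (c * t\<^sup>2)) = 4 * ennreal (c * t\<^sup>2)"
      using \<open>0 < c\<close> by (subst ennreal_mult) auto
    ultimately show ?thesis by (simp add: ennreal_mult_le_mult_iff)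
  qed
  ultimately show ?thesis by blast
qed

end

section \<open>From charts to the whole boundary\<close>

lemma boundary_of_class_chart:
  assumes "boundary_of_class C D" "\<And>\<gamma>. C \<gamma> \<Longrightarrow> locally_lipschitz \<gamma>" "open D" "p \<in> frontier D"
  obtains r Q \<gamma> where "graph_chart D p r Q \<gamma>" "locally_lipschitz \<gamma>"
proof -
  from assms obtain r Q \<gamma> where "r > 0" "orthogonal_transformation Q" "C \<gamma>"
    "D \<inter> ball p r = {x \<in> ball p r. Q x $ 3 > \<gamma> (proj2 (Q x))}"
    unfolding boundary_of_class_def proj2_def by blast
  then show ?thesis
    by (intro that[of r Q \<gamma>] graph_chart.intro assms locally_lipschitz_continuous)
qed

lemma hausdorff2_frontier_finite:
  assumes C: "boundary_of_class C D" "\<And>\<gamma>. C \<gamma> \<Longrightarrow> locally_lipschitz \<gamma>" and D: "open D" "bounded D"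
  shows "hausdorff2_outer (frontier D) < \<infinity>"
proof -
  have "\<exists>r>0. hausdorff2_outer (frontier D \<inter> ball p r) < \<infinity>" if p: "p \<in> frontier D" for p
    using boundary_of_class_chart[OF C D(1) p] graph_chart.hausdorff2_frontier_finite_local graph_chart.r_pos
    by metis
  then obtain r where r: "\<And>p. p \<in> frontier D \<Longrightarrow> r p > 0"
    "\<And>p. p \<in> frontier D \<Longrightarrow> hausdorff2_outer (frontier D \<inter> ball p (r p)) < \<infinity>" by metis
  have "compact (frontier D)" using D by (simp add: compact_frontier_bounded)
  then obtain F where F: "F \<subseteq> frontier D" "finite F" "frontier D \<subseteq> (\<Union>p\<in>F. ball p (r p))"
  proof (rule compactE_image[of _ "frontier D" "\<lambda>p. ball p (r p)"])
    show "frontier D \<subseteq> (\<Union>p\<in>frontier D. ball p (r p))" using r(1) by force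
  qed auto
  have "hausdorff2_outer (\<Union>p\<in>F'. frontier D \<inter> ball p (r p)) < \<infinity>" if "finite F'" "F' \<subseteq> frontier D" for F'
    using that
  proof (induction F')
    case empty then show ?case by (simp add: hausdorff2_outer_empty)
  next
    case (insert p F')
    have "hausdorff2_outer (\<Union>p\<in>insert p F'. frontier D \<inter> ball p (r p)) \<le>
       hausdorff2_outer (frontier D \<inter> ball p (r p)) + hausdorff2_outer (\<Union>p\<in>F'. frontier D \<inter> ball p (r p))"
      using hausdorff2_outer_Un by simp
    also have "\<dots> < \<infinity>" using insert r(2) by simp
    finally show ?case .
  qed
  from this[OF F(2,1)] show ?thesis
    by (rule order.strict_trans1[rotated]) (use F(3) in \<open>intro hausdorff2_outer_mono, blast\<close>)
qed

lemma hausdorff2_frontier_lower: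
  assumes C: "boundary_of_class C D" "\<And>\<gamma>. C \<gamma> \<Longrightarrow> locally_lipschitz \<gamma>" and D: "open D" "bounded D"
  obtains c t0 where "0 < c" "0 < t0"
    "\<And>y t. y \<in> frontier D \<Longrightarrow> 0 < t \<Longrightarrow> t \<le> t0 \<Longrightarrow> ennreal (c * t\<^sup>2) \<le> hausdorff2_outer (frontier D \<inter> ball y t)"
proof -
  have "\<exists>r>0. \<exists>c>0. \<forall>y t. y \<in> frontier D \<longrightarrow> y \<in> ball p r \<longrightarrow> 0 < t \<longrightarrow> t \<le> r \<longrightarrow>
    ennreal (c * t\<^sup>2) \<le> hausdorff2_outer (frontier D \<inter> ball y t)" if p: "p \<in> frontier D" for p
  proof -
    obtain r Q \<gamma> where g: "graph_chart D p r Q \<gamma>" "locally_lipschitz \<gamma>"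
      using boundary_of_class_chart[OF C D(1) p] by blast
    show ?thesis
      using graph_chart.hausdorff2_frontier_lower_local[OF g] graph_chart.r_pos[OF g(1)]
      by (intro exI[of _ "r/2"]) simp
  qed
  then obtain r c where r: "\<And>p. p \<in> frontier D \<Longrightarrow> r p > 0" "\<And>p. p \<in> frontier D \<Longrightarrow> c p > 0"
    "\<And>p y t. p \<in> frontier D \<Longrightarrow> y \<in> frontier D \<Longrightarrow> y \<in> ball p (r p) \<Longrightarrow> 0 < t \<Longrightarrow> t \<le> r p \<Longrightarrow>
    ennreal (c p * t\<^sup>2) \<le> hausdorff2_outer (frontier D \<inter> ball y t)" by metis
  have "compact (frontier D)" using D by (simp add: compact_frontier_bounded)
  then obtain F where F: "F \<subseteq> frontier D" "finite F" "frontier D \<subseteq> (\<Union>p\<in>F. ball p (r p))"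
  proof (rule compactE_image[of _ "frontier D" "\<lambda>p. ball p (r p)"])
    show "frontier D \<subseteq> (\<Union>p\<in>frontier D. ball p (r p))" using r(1) by force
  qed auto
  \<comment> \<open>Minima over a finite subcover; the inserted 1 keeps them meaningful and positive
    even for an empty subcover.\<close>
  define c0 t0 where "c0 = Min (insert 1 (c ` F))" and "t0 = Min (insert 1 (r ` F))"
  have pos: "0 < c0" "0 < t0" using F r by (auto simp: c0_def t0_def subset_iff)
  show ?thesis
  proof (rule that[OF pos])
    fix y t assume y: "y \<in> frontier D" and t: "0 < t" "t \<le> t0"
    then obtain p where p: "p \<in> F" "y \<in> ball p (r p)" using F by auto
    have "t0 \<le> r p" "c0 \<le> c p" using F p by (auto simp: c0_def t0_def)
    then have "ennreal (c0 * t\<^sup>2) \<le> ennreal (c p * t\<^sup>2)"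
      by (intro ennreal_leI mult_right_mono) auto
    also have "\<dots> \<le> hausdorff2_outer (frontier D \<inter> ball y t)"
      using p F y t \<open>t0 \<le> r p\<close> by (intro r(3)[of p]) auto
    finally show "ennreal (c0 * t\<^sup>2) \<le> hausdorff2_outer (frontier D \<inter> ball y t)" .
  qed
qed

section \<open>Integrals of partial derivatives and the surface measure\<close>

lemma integral_lebesgue_on_eq:
  fixes f :: "'a::euclidean_space \<Rightarrow> real"
  assumes "S \<in> sets borel" "(\<lambda>x. indicator S x * f x) \<in> borel_measurable borel"
  shows "(LINT x|lebesgue_on S. f x) = (LINT x|lborel. indicator S x * f x)"
proof -
  have "(LINT x|lebesgue_on S. f x) = (LINT x|lebesgue. indicator S x *\<^sub>R f x)"
    using assms by (intro integral_restrict_space) auto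
  also have "\<dots> = (LINT x|lborel. indicator S x * f x)"
    using assms by (subst integral_completion[symmetric]) auto
  finally show ?thesis .
qed

lemma finite_measure_surface_measure:
  assumes "hausdorff2_outer (frontier \<Omega>) < \<infinity>"
  shows "finite_measure (surface_measure \<Omega>)"
  using assms emeasure_surface_measure[of "frontier \<Omega>" \<Omega>] by (intro finite_measureI) auto

lemma measurable_ident_surface_measure: "(\<lambda>x. x) \<in> measurable (surface_measure \<Omega>) borel"
proof -
  have "(\<lambda>x. x) \<in> measurable (restrict_space borel (frontier \<Omega>)) borel"
    by (rule measurable_restrict_space1) simp
  then show ?thesis using measurable_cong_sets[OF sets_surface_measure refl] by blast
qed

lemma sets_surface_measure_Int: "A \<in> sets borel \<Longrightarrow> frontier \<Omega> \<inter> A \<in> sets (surface_measure \<Omega>)"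
  unfolding sets_surface_measure by (auto simp: sets_restrict_space)

text \<open>Double counting of the pairs of a point \<open>x \<in> N\<close> and a boundary point \<open>y\<close> at distance less than
  \<open>2 t\<close>: for each \<open>x\<close> the points \<open>y\<close> fill an area of order \<open>t\<^sup>2\<close>, for each \<open>y\<close> the
  points \<open>x\<close> fill a volume of order \<open>t\<^sup>3\<close>.\<close>

lemma surface_measure_tube:
  assumes fin: "hausdorff2_outer (frontier \<Omega>) < \<infinity>" and c: "0 < c" and t: "0 < t"
    and low: "\<And>y. y \<in> frontier \<Omega> \<Longrightarrow> ennreal (c * t\<^sup>2) \<le> hausdorff2_outer (frontier \<Omega> \<inter> ball y t)"
    and h: "h \<in> borel_measurable borel" and k: "k \<in> borel_measurable borel"
    and hk: "\<And>x y. y \<in> frontier \<Omega> \<Longrightarrow> dist x y < 2 * t \<Longrightarrow> h x \<le> k y"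
    and N: "N \<in> sets borel" "\<And>x. x \<in> N \<Longrightarrow> \<exists>y\<in>frontier \<Omega>. dist x y \<le> t"
  shows "(\<integral>\<^sup>+x. h x * indicator N x \<partial>lborel)
    \<le> ennreal (8 * unit_ball_vol 3 / c * t) * (\<integral>\<^sup>+y. k y \<partial>surface_measure \<Omega>)"
proof -
  let ?M = "surface_measure \<Omega>"
  interpret M: finite_measure ?M by (rule finite_measure_surface_measure[OF fin])
  interpret pair_sigma_finite lborel ?M ..
  note [measurable] = h k N(1)
  let ?G = "\<lambda>x y. h x * indicator N x * indicator {z. dist (fst z) (snd z) < 2 * t} (x, y)"
  have [measurable]: "(\<lambda>z. dist (fst z) (snd z)) \<in> borel_measurable (lborel \<Otimes>\<^sub>M ?M)"
    by (intro borel_measurable_dist measurable_compose[OF measurable_fst] measurable_compose[OF measurable_snd]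
        measurable_ident_surface_measure) simp
  have [measurable]: "(\<lambda>(x, y). ?G x y) \<in> borel_measurable (lborel \<Otimes>\<^sub>M ?M)"
    unfolding split_beta' by measurable
  have "ennreal (c * t\<^sup>2) * (\<integral>\<^sup>+x. h x * indicator N x \<partial>lborel)
      = (\<integral>\<^sup>+x. ennreal (c * t\<^sup>2) * (h x * indicator N x) \<partial>lborel)"
    by (rule nn_integral_cmult[symmetric]) measurable
  also have "\<dots> \<le> (\<integral>\<^sup>+x. (\<integral>\<^sup>+y. ?G x y \<partial>?M) \<partial>lborel)"
  proof (rule nn_integral_mono)
    fix x
    show "ennreal (c * t\<^sup>2) * (h x * indicator N x) \<le> (\<integral>\<^sup>+y. ?G x y \<partial>?M)"
    proof (cases "x \<in> N")
      case True
      then obtain y0 where y0: "y0 \<in> frontier \<Omega>" "dist x y0 \<le> t" using N by blast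
      have "ball y0 t \<subseteq> ball x (2 * t)"
      proof
        fix z assume "z \<in> ball y0 t"
        then show "z \<in> ball x (2 * t)" using y0 dist_triangle[of x z y0] by auto
      qed
      then have "ennreal (c * t\<^sup>2) \<le> hausdorff2_outer (frontier \<Omega> \<inter> ball x (2 * t))"
        using low[OF y0(1)] hausdorff2_outer_mono by (meson Int_mono order.refl order.trans)
      also have "\<dots> = emeasure ?M (frontier \<Omega> \<inter> ball x (2 * t))"
        by (subst emeasure_surface_measure) auto
      finally have "ennreal (c * t\<^sup>2) * h x \<le> h x * emeasure ?M (frontier \<Omega> \<inter> ball x (2 * t))"
        by (subst mult.commute) (rule mult_left_mono, auto)
      also have "\<dots> = (\<integral>\<^sup>+y. h x * indicator (frontier \<Omega> \<inter> ball x (2 * t)) y \<partial>?M)"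
        by (rule nn_integral_cmult_indicator[symmetric]) (simp add: sets_surface_measure_Int)
      also have "\<dots> = (\<integral>\<^sup>+y. ?G x y \<partial>?M)"
        using True by (intro nn_integral_cong) (auto simp: indicator_def)
      finally show ?thesis using True by simp
    qed simp
  qed
  also have "\<dots> = (\<integral>\<^sup>+y. (\<integral>\<^sup>+x. ?G x y \<partial>lborel) \<partial>?M)"
    by (rule Fubini'[symmetric]) measurable
  also have "\<dots> \<le> (\<integral>\<^sup>+y. ennreal (8 * unit_ball_vol 3 * t ^ 3) * k y \<partial>?M)"
  proof (rule nn_integral_mono)
    fix y assume "y \<in> space ?M"
    then have y: "y \<in> frontier \<Omega>" by simp
    have "(\<integral>\<^sup>+x. ?G x y \<partial>lborel) \<le> (\<integral>\<^sup>+x. k y * indicator (ball y (2 * t)) x \<partial>lborel)"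
      by (intro nn_integral_mono) (auto simp: indicator_def hk[OF y] dist_commute)
    also have "\<dots> = k y * emeasure lborel (ball y (2 * t))"
      by (rule nn_integral_cmult_indicator) simp
    also have "emeasure lborel (ball y (2 * t)) = ennreal (8 * unit_ball_vol 3 * t ^ 3)"
      using t by (simp add: emeasure_ball power_mult_distrib mult_ac)
    finally show "(\<integral>\<^sup>+x. ?G x y \<partial>lborel) \<le> ennreal (8 * unit_ball_vol 3 * t ^ 3) * k y"
      by (simp add: mult.commute)
  qed
  also have "\<dots> = ennreal (8 * unit_ball_vol 3 * t ^ 3) * (\<integral>\<^sup>+y. k y \<partial>?M)"
    by (rule nn_integral_cmult) (rule measurable_compose[OF measurable_ident_surface_measure k])
  also have "8 * unit_ball_vol 3 * t ^ 3 = (c * t\<^sup>2) * (8 * unit_ball_vol 3 / c * t)"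
    using c by (simp add: power2_eq_square power3_eq_cube)
  also have "ennreal \<dots> = ennreal (c * t\<^sup>2) * ennreal (8 * unit_ball_vol 3 / c * t)"
    using c t by (intro ennreal_mult) (auto intro!: mult_nonneg_nonneg divide_nonneg_pos)
  finally have "ennreal (c * t\<^sup>2) * (\<integral>\<^sup>+x. h x * indicator N x \<partial>lborel) \<le>
    ennreal (c * t\<^sup>2) * (ennreal (8 * unit_ball_vol 3 / c * t) * (\<integral>\<^sup>+y. k y \<partial>?M))"
    by (simp add: mult.assoc)
  then show ?thesis using c t by (subst (asm) ennreal_mult_le_mult_iff) auto
qed

lemma integrable_surface_measure_continuous:
  fixes f :: "real^3 \<Rightarrow> real"
  assumes "hausdorff2_outer (frontier \<Omega>) < \<infinity>" "bounded \<Omega>" "continuous_on (frontier \<Omega>) f"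
  shows "integrable (surface_measure \<Omega>) f"
proof -
  interpret finite_measure "surface_measure \<Omega>" by (rule finite_measure_surface_measure) fact
  have "compact (frontier \<Omega>)" using assms(2) by (rule compact_frontier_bounded)
  then have "bounded (f ` frontier \<Omega>)" using assms(3) by (intro compact_imp_bounded compact_continuous_image)
  then obtain B where B: "\<And>x. x \<in> frontier \<Omega> \<Longrightarrow> norm (f x) \<le> B" by (auto simp: bounded_iff)
  have "f \<in> borel_measurable (restrict_space borel (frontier \<Omega>))"
    using assms(3) by (rule borel_measurable_continuous_on_restrict)
  then have "f \<in> borel_measurable (surface_measure \<Omega>)"
    using measurable_cong_sets[OF sets_surface_measure refl] by blast
  then show ?thesis using B by (intro integrable_const_bound[of _ B] AE_I2) auto
qed


section \<open>Difference quotients and translated domains\<close>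

text \<open>Translation invariance moves the shift from F to the domain. What remains is the
  integral of F against a difference of two indicators, which has absolute value at most 1 and
  vanishes outside \<open>N\<close>.\<close>

lemma set_shift_difference_bound:
  fixes F :: "'a::euclidean_space \<Rightarrow> real" and w :: 'a
  assumes [measurable]: "\<Omega> \<in> sets borel" "N \<in> sets borel"
    and F [measurable]: "F \<in> borel_measurable borel" and int: "integrable lborel F"
    and N: "\<And>x. x \<in> \<Omega> \<longleftrightarrow> x - w \<notin> \<Omega> \<Longrightarrow> x \<in> N"
  shows "\<bar>(LINT x|lborel. indicator \<Omega> x * (F (x + w) - F x))\<bar> \<le> (LINT x|lborel. \<bar>F x\<bar> * indicator N x)"
proof -
  have shift: "(LINT x|lborel. G (x + w)) = (LINT x|lborel. G x)" "integrable lborel (\<lambda>x. G (x + w)) \<longleftrightarrow> integrable lborel G"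
    if [measurable]: "G \<in> borel_measurable borel" for G :: "'a \<Rightarrow> real"
  proof -
    have "(LINT x|lborel. G x) = (LINT x|distr lborel borel ((+) w). G x)" by (simp add: lborel_distr_plus)
    also have "\<dots> = (LINT x|lborel. G (w + x))" by (rule integral_distr) auto
    finally show "(LINT x|lborel. G (x + w)) = (LINT x|lborel. G x)" by (simp add: add.commute)
    have "integrable lborel G \<longleftrightarrow> integrable (distr lborel borel ((+) w)) G" by (simp add: lborel_distr_plus)
    also have "\<dots> \<longleftrightarrow> integrable lborel (\<lambda>x. G (w + x))" by (rule integrable_distr_eq) auto
    finally show "integrable lborel (\<lambda>x. G (x + w)) \<longleftrightarrow> integrable lborel G" by (simp add: add.commute)
  qed
  have i1: "integrable lborel (\<lambda>x. indicator \<Omega> (x - w) * F x)" "integrable lborel (\<lambda>x. indicator \<Omega> x * F x)"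
    "integrable lborel (\<lambda>x. \<bar>F x\<bar> * indicator N x)"
    by (rule Bochner_Integration.integrable_bound[OF int]; auto simp: indicator_def)+
  have "(LINT x|lborel. indicator \<Omega> x * (F (x + w) - F x)) =
      (LINT x|lborel. indicator \<Omega> ((x + w) - w) * F (x + w) - indicator \<Omega> x * F x)"
    by (simp add: right_diff_distrib)
  also have "\<dots> = (LINT x|lborel. indicator \<Omega> ((x + w) - w) * F (x + w)) - (LINT x|lborel. indicator \<Omega> x * F x)"
    using shift(2)[of "\<lambda>x. indicator \<Omega> (x - w) * F x"] i1
    by (intro Bochner_Integration.integral_diff) auto
  also have "(LINT x|lborel. indicator \<Omega> ((x + w) - w) * F (x + w)) = (LINT x|lborel. indicator \<Omega> (x - w) * F x)"
    by (rule shift(1)) measurable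
  also have "\<dots> - (LINT x|lborel. indicator \<Omega> x * F x) = (LINT x|lborel. indicator \<Omega> (x - w) * F x - indicator \<Omega> x * F x)"
    using i1 by (intro Bochner_Integration.integral_diff[symmetric]) auto
  also have "\<bar>\<dots>\<bar> \<le> (LINT x|lborel. \<bar>indicator \<Omega> (x - w) * F x - indicator \<Omega> x * F x\<bar>)"
    by (rule integral_abs_bound)
  also have "\<dots> \<le> (LINT x|lborel. \<bar>F x\<bar> * indicator N x)"
    using i1 N by (intro integral_mono integrable_abs Bochner_Integration.integrable_diff) (auto simp: indicator_def)
  finally show ?thesis .
qed

text \<open>Exactly one of x and x - w lies in \<Omega>, so the segment joining them crosses the
  boundary.\<close>

lemma not_in_shift_near_frontier:
  fixes \<Omega> :: "'a::real_normed_vector set"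
  assumes "x \<in> \<Omega> \<longleftrightarrow> x - w \<notin> \<Omega>"
  shows "\<exists>y\<in>frontier \<Omega>. dist x y \<le> norm w"
proof -
  have "closed_segment x (x - w) \<inter> frontier \<Omega> \<noteq> {}"
    using assms by (intro connected_Int_frontier) (auto simp: connected_segment)
  then obtain y where "y \<in> closed_segment x (x - w)" "y \<in> frontier \<Omega>" by blast
  then show ?thesis using segment_bound1[of y x "x - w"] by (intro bexI[of _ y]) (auto simp: dist_norm norm_minus_commute)
qed

text \<open>The integral over \<open>\<Omega>\<close> of a difference quotient of \<open>f\<close> with step \<open>t\<close> is \<open>1 / t\<close> times an
  integral of \<open>f\<close> over the symmetric difference of \<open>\<Omega>\<close> and its translate, which lies in the
  tube of radius \<open>t\<close> around \<open>\<partial>\<Omega>\<close>.\<close>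

lemma integral_partial_le_boundary:
  fixes f g :: "real^3 \<Rightarrow> real"
  assumes \<Omega>: "open \<Omega>" "closure \<Omega> \<subseteq> ball 0 R" and fin: "hausdorff2_outer (frontier \<Omega>) < \<infinity>"
    and c: "0 < c" "0 < t0"
    and low: "\<And>y t. y \<in> frontier \<Omega> \<Longrightarrow> 0 < t \<Longrightarrow> t \<le> t0 \<Longrightarrow> ennreal (c * t\<^sup>2) \<le> hausdorff2_outer (frontier \<Omega> \<inter> ball y t)"
    and f: "continuous_on (cball 0 R) f" and g: "continuous_on (cball 0 R) g" and e: "norm e = 1"
    and fg: "\<And>x. x \<in> ball 0 R \<Longrightarrow> ((\<lambda>s. f (x + s *\<^sub>R e)) has_real_derivative g x) (at 0)"
  shows "\<bar>LINT x|lebesgue_on \<Omega>. g x\<bar> \<le> 8 * unit_ball_vol 3 / c * (LINT y|surface_measure \<Omega>. \<bar>f y\<bar>)"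
proof (rule field_le_epsilon)
  fix \<epsilon>' :: real assume e': "0 < \<epsilon>'"
  let ?M = "surface_measure \<Omega>" let ?C = "8 * unit_ball_vol 3 / c"
  interpret M: finite_measure ?M by (rule finite_measure_surface_measure[OF fin])
  define m where "m = measure ?M (space ?M)"
  have m0: "0 \<le> m" by (simp add: m_def)
  have C0: "0 \<le> ?C" using c by simp
  have bdd: "bounded \<Omega>" using \<Omega>(2) bounded_subset[OF bounded_ball] closure_subset by blast
  have front: "frontier \<Omega> \<subseteq> ball 0 R" using \<Omega> by (auto simp: frontier_def)
  have [measurable]: "\<Omega> \<in> sets borel" using \<Omega> by simp
  \<comment> \<open>Allowance for the oscillation of f near the boundary; after integration over a
    boundary of total area m and multiplication by the constant it stays below the given
    \<epsilon>'.\<close>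
  define \<epsilon> where "\<epsilon> = \<epsilon>' / (?C * m + 1)"
  have eps: "0 < \<epsilon>" "?C * (\<epsilon> * m) \<le> \<epsilon>'"
  proof -
    have p: "0 \<le> ?C * m" using C0 m0 by (rule mult_nonneg_nonneg)
    then show "0 < \<epsilon>" using e' by (simp add: \<epsilon>_def add_nonneg_pos)
    have "?C * (\<epsilon> * m) \<le> \<epsilon> * (?C * m + 1)" using \<open>0 < \<epsilon>\<close> by (simp add: algebra_simps)
    also have "\<dots> = \<epsilon>'"
    proof -
      have "?C * m + 1 \<noteq> 0" using p by linarith
      from nonzero_eq_divide_eq[OF this, THEN iffD1, OF \<epsilon>_def] show ?thesis .
    qed
    finally show "?C * (\<epsilon> * m) \<le> \<epsilon>'" .
  qed
  have "compact (closure \<Omega>)" using bdd by simp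
  then obtain \<rho> where \<rho>: "0 < \<rho>" "\<And>x y. x \<in> closure \<Omega> \<Longrightarrow> dist x y < \<rho> \<Longrightarrow> y \<in> ball 0 R"
  proof (rule compact_subset_open_imp_ball_epsilon_subset[OF _ open_ball \<Omega>(2)])
    fix d assume "0 < d" "(\<Union>x\<in>closure \<Omega>. ball x d) \<subseteq> ball 0 R"
    then show thesis using that[of d] by (auto simp: subset_iff)
  qed
  obtain \<delta> where \<delta>: "0 < \<delta>" "\<And>x y. x \<in> cball 0 R \<Longrightarrow> y \<in> cball 0 R \<Longrightarrow> dist y x < \<delta> \<Longrightarrow> \<bar>f y - f x\<bar> < \<epsilon>"
    using compact_uniformly_continuous[OF f compact_cball] eps(1) unfolding uniformly_continuous_on_def dist_real_def
    by metis
  obtain B where "\<forall>y\<in>g ` cball 0 R. norm y \<le> B"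
    using compact_imp_bounded[OF compact_continuous_image[OF g compact_cball]] unfolding bounded_iff by blast
  then have B: "\<And>x. x \<in> cball 0 R \<Longrightarrow> \<bar>g x\<bar> \<le> B" by simp
  \<comment> \<open>The cut-off makes f globally integrable. It is invisible below: for small s a
    point x + s e with x in \<Omega> is still inside the ball, by the choice of \<rho>.\<close>
  define F where "F x = indicator (cball 0 R) x * f x" for x
  have Fm [measurable]: "F \<in> borel_measurable borel"
    using borel_measurable_continuous_on_indicator[OF _ f] by (simp add: F_def[abs_def])
  have Fint: "integrable lborel F"
    using borel_integrable_compact[OF compact_cball f] by (simp add: F_def[abs_def])
  \<comment> \<open>Majorant on the boundary: for x within 2t of a boundary point y, uniform
    continuity gives |f x| \<le> |f y| + \<epsilon>.\<close>
  define kk where "kk y = ennreal (indicator (cball 0 R) y * (\<bar>f y\<bar> + \<epsilon>))" for y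
  have "continuous_on (cball 0 R) (\<lambda>y. \<bar>f y\<bar> + \<epsilon>)" by (intro continuous_intros f)
  then have [measurable]: "(\<lambda>y. indicator (cball 0 R) y * (\<bar>f y\<bar> + \<epsilon>)) \<in> borel_measurable borel"
    using borel_measurable_continuous_on_indicator[of "cball 0 R" "\<lambda>y. \<bar>f y\<bar> + \<epsilon>"] by simp
  have kkm: "kk \<in> borel_measurable borel" unfolding kk_def[abs_def] by measurable
  have fi: "integrable ?M (\<lambda>y. \<bar>f y\<bar>)"
    by (rule integrable_surface_measure_continuous[OF fin bdd])
       (use front in \<open>intro continuous_intros continuous_on_subset[OF f], auto\<close>)
  have small: "\<bar>LINT x|lborel. indicator \<Omega> x * (F (x + t *\<^sub>R e) - F x)\<bar>
      \<le> t * (?C * ((LINT y|?M. \<bar>f y\<bar>) + \<epsilon> * m))"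
    if t: "0 < t" "t \<le> t0" "2 * t < \<delta>" "2 * t < \<rho>" for t
  proof -
    define N where "N = {x. \<exists>y\<in>frontier \<Omega>. dist x y \<le> t}"
    have Ct: "0 \<le> ?C * t" by (rule mult_nonneg_nonneg[OF C0 less_imp_le[OF t(1)]])
    have I0: "0 \<le> (LINT y|?M. \<bar>f y\<bar>) + \<epsilon> * m"
      using eps(1) m0 by (intro add_nonneg_nonneg mult_nonneg_nonneg) auto
    have NN: "\<And>x. x \<in> N \<Longrightarrow> \<exists>y\<in>frontier \<Omega>. dist x y \<le> t" by (simp add: N_def)
    have "N = (\<Union>x\<in>frontier \<Omega>. \<Union>y\<in>cball 0 t. {x + y})"
    proof (rule set_eqI)
      fix z
      show "z \<in> N \<longleftrightarrow> z \<in> (\<Union>x\<in>frontier \<Omega>. \<Union>y\<in>cball 0 t. {x + y})"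
      proof
        assume "z \<in> N"
        then obtain y where "y \<in> frontier \<Omega>" "dist z y \<le> t" by (auto simp: N_def)
        moreover from this have "z - y \<in> cball 0 t" "z = y + (z - y)" by (auto simp: dist_norm norm_minus_commute)
        ultimately show "z \<in> (\<Union>x\<in>frontier \<Omega>. \<Union>y\<in>cball 0 t. {x + y})" by blast
      qed (force simp: N_def dist_norm)
    qed
    then have "closed N"
      using compact_closed_sums[of "frontier \<Omega>" "cball 0 t"] bdd by (simp add: compact_frontier_bounded)
    then have Nm [measurable]: "N \<in> sets borel" by simp
    have "(\<integral>\<^sup>+x. ennreal \<bar>F x\<bar> * indicator N x \<partial>lborel)
      \<le> ennreal (?C * t) * (\<integral>\<^sup>+y. kk y \<partial>?M)"
    proof (rule surface_measure_tube[OF fin c(1) t(1) low[OF _ t(1,2)]])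
      fix x y assume y: "y \<in> frontier \<Omega>" "dist x y < 2 * t"
      have "x \<in> ball 0 R" using y t by (intro \<rho>(2)[of y]) (auto simp: frontier_def dist_commute)
      moreover have yR: "y \<in> ball 0 R" using y front by auto
      ultimately have "\<bar>f x - f y\<bar> < \<epsilon>" using y t by (intro \<delta>(2)) auto
      then show "ennreal \<bar>F x\<bar> \<le> kk y"
        using \<open>x \<in> ball 0 R\<close> yR unfolding F_def kk_def by (intro ennreal_leI) auto
    qed (use Nm kkm NN Fm in auto)
    also have "(\<integral>\<^sup>+y. kk y \<partial>?M) = (\<integral>\<^sup>+y. ennreal (\<bar>f y\<bar> + \<epsilon>) \<partial>?M)"
      using front by (intro nn_integral_cong) (auto simp: kk_def indicator_def)
    also have "\<dots> = ennreal (LINT y|?M. \<bar>f y\<bar> + \<epsilon>)"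
      using fi eps(1) by (intro nn_integral_eq_integral) auto
    also have "(LINT y|?M. \<bar>f y\<bar> + \<epsilon>) = (LINT y|?M. \<bar>f y\<bar>) + \<epsilon> * m"
      using fi by (simp add: m_def)
    also have "ennreal (?C * t) * ennreal ((LINT y|?M. \<bar>f y\<bar>) + \<epsilon> * m)
        = ennreal (t * (?C * ((LINT y|?M. \<bar>f y\<bar>) + \<epsilon> * m)))"
      unfolding ennreal_mult[OF Ct I0, symmetric] by (simp only: mult_ac)
    finally have 1: "(\<integral>\<^sup>+x. ennreal (\<bar>F x\<bar> * indicator N x) \<partial>lborel)
        \<le> ennreal (t * (?C * ((LINT y|?M. \<bar>f y\<bar>) + \<epsilon> * m)))"
      by (simp add: ennreal_mult ennreal_indicator)
    have i: "integrable lborel (\<lambda>x. \<bar>F x\<bar> * indicator N x)"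
      by (rule Bochner_Integration.integrable_bound[OF Fint]) (auto simp: indicator_def)
    have "ennreal (LINT x|lborel. \<bar>F x\<bar> * indicator N x) \<le> ennreal (t * (?C * ((LINT y|?M. \<bar>f y\<bar>) + \<epsilon> * m)))"
      using 1 by (subst (asm) nn_integral_eq_integral[OF i]) auto
    then have 2: "(LINT x|lborel. \<bar>F x\<bar> * indicator N x) \<le> t * (?C * ((LINT y|?M. \<bar>f y\<bar>) + \<epsilon> * m))"
      by (subst (asm) ennreal_le_iff) (intro mult_nonneg_nonneg C0 I0 less_imp_le[OF t(1)])
    have "\<bar>LINT x|lborel. indicator \<Omega> x * (F (x + t *\<^sub>R e) - F x)\<bar> \<le> (LINT x|lborel. \<bar>F x\<bar> * indicator N x)"
    proof (rule set_shift_difference_bound[OF _ Nm Fm Fint])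
      fix x assume "x \<in> \<Omega> \<longleftrightarrow> x - t *\<^sub>R e \<notin> \<Omega>"
      from not_in_shift_near_frontier[OF this] show "x \<in> N" using e t by (auto simp: N_def)
    qed simp
    with 2 show ?thesis by linarith
  qed
  obtain T where T: "0 < T" "T \<le> t0" "2 * T < \<delta>" "2 * T < \<rho>"
    using c(2) \<delta>(1) \<rho>(1) by (intro that[of "min t0 (min (\<delta>/3) (\<rho>/3))"]) (auto simp: min_def)
  define \<tau> where "\<tau> n = T / real (Suc n)" for n
  have \<tau>: "0 < \<tau> n" "\<tau> n \<le> T" for n using T(1) by (auto simp: \<tau>_def field_simps)
  have \<tau>0: "\<tau> \<longlonglongrightarrow> 0" unfolding \<tau>_def by (rule LIMSEQ_Suc[OF lim_const_over_n])
  define q where "q n x = indicator \<Omega> x * ((F (x + \<tau> n *\<^sub>R e) - F x) / \<tau> n)" for n x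
  have Feq: "F (x + s *\<^sub>R e) = f (x + s *\<^sub>R e)" "x + s *\<^sub>R e \<in> ball 0 R" if "x \<in> \<Omega>" "0 \<le> s" "s \<le> T" for x s
  proof -
    show "x + s *\<^sub>R e \<in> ball 0 R"
      using that T e closure_subset by (intro \<rho>(2)[of x]) (auto simp: dist_norm)
    then show "F (x + s *\<^sub>R e) = f (x + s *\<^sub>R e)" by (auto simp: F_def)
  qed
  \<comment> \<open>Dominated convergence: the difference quotients tend to g pointwise, and by the
    mean value theorem each is a value of g, hence bounded by its maximum on the ball.\<close>
  have lim: "(\<lambda>n. LINT x|lborel. q n x) \<longlonglongrightarrow> (LINT x|lborel. indicator \<Omega> x * g x)"
  proof (rule integral_dominated_convergence[where w = "\<lambda>x. \<bar>B\<bar> * indicator (cball 0 R) x"])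
    have gm: "(\<lambda>x. indicator (cball 0 R) x * g x) \<in> borel_measurable borel"
      using borel_measurable_continuous_on_indicator[OF _ g] by simp
    have "(\<lambda>x. indicator \<Omega> x * (indicator (cball 0 R) x * g x)) \<in> borel_measurable borel"
      by (rule borel_measurable_times[OF borel_measurable_indicator[OF \<open>\<Omega> \<in> sets borel\<close>] gm])
    also have "(\<lambda>x. indicator \<Omega> x * (indicator (cball 0 R) x * g x)) = (\<lambda>x. indicator \<Omega> x * g x)"
      using \<Omega>(2) closure_subset by (intro ext) (force simp: indicator_def)
    finally show "(\<lambda>x. indicator \<Omega> x * g x) \<in> borel_measurable lborel" by simp
    show "q n \<in> borel_measurable lborel" for n unfolding q_def[abs_def] by measurable
    have "integrable lborel (\<lambda>x :: real^3. indicator (cball 0 R) x :: real)"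
      by (rule integrable_real_indicator) (use emeasure_lborel_cball_finite[of "0 :: real^3" R] in \<open>simp_all add: less_top\<close>)
    then show "integrable lborel (\<lambda>x :: real^3. \<bar>B\<bar> * indicator (cball 0 R) x)" by (rule integrable_mult_right)
    show "AE x in lborel. (\<lambda>n. q n x) \<longlonglongrightarrow> indicator \<Omega> x * g x"
    proof (intro AE_I2)
      fix x
      show "(\<lambda>n. q n x) \<longlonglongrightarrow> indicator \<Omega> x * g x"
      proof (cases "x \<in> \<Omega>")
        case True
        then have "x \<in> ball 0 R" using \<Omega>(2) closure_subset by blast
        from fg[OF this] have "((\<lambda>h. (f (x + h *\<^sub>R e) - f x) / h) \<longlongrightarrow> g x) (at 0)"
          by (simp add: DERIV_def)
        moreover have "filterlim \<tau> (at 0) sequentially"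
          using \<tau>0 \<tau>(1) by (auto simp: filterlim_at intro!: always_eventually) (metis less_irrefl)
        ultimately have "(\<lambda>n. (f (x + \<tau> n *\<^sub>R e) - f x) / \<tau> n) \<longlonglongrightarrow> g x"
          by (rule filterlim_compose)
        moreover have "q n x = (f (x + \<tau> n *\<^sub>R e) - f x) / \<tau> n" for n
          using Feq(1)[OF True, of "\<tau> n"] Feq(1)[OF True, of 0] \<tau>[of n] T(1) True by (simp add: q_def)
        ultimately show ?thesis using True by simp
      qed (simp add: q_def)
    qed
    fix n
    show "AE x in lborel. norm (q n x) \<le> \<bar>B\<bar> * indicator (cball 0 R) x"
    proof (intro AE_I2)
      fix x
      show "norm (q n x) \<le> \<bar>B\<bar> * indicator (cball 0 R) x"
      proof (cases "x \<in> \<Omega>")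
        case True
        have "\<exists>z. 0 < z \<and> z < \<tau> n \<and> f (x + \<tau> n *\<^sub>R e) - f (x + 0 *\<^sub>R e) = (\<tau> n - 0) * g (x + z *\<^sub>R e)"
        proof (rule MVT2[OF \<tau>(1)])
          fix s assume s: "0 \<le> s" "s \<le> \<tau> n"
          then have "x + s *\<^sub>R e \<in> ball 0 R" using Feq(2)[OF True] \<tau>(2) order.trans by blast
          from fg[OF this] have "((\<lambda>h. f (x + (s + h) *\<^sub>R e)) has_real_derivative g (x + s *\<^sub>R e)) (at 0)"
            by (simp add: scaleR_add_left add.assoc)
          then show "((\<lambda>s. f (x + s *\<^sub>R e)) has_real_derivative g (x + s *\<^sub>R e)) (at s)"
            using DERIV_shift[of "\<lambda>s. f (x + s *\<^sub>R e)" "g (x + s *\<^sub>R e)" 0 s] by (simp add: add.commute)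
        qed
        then obtain z where z: "0 < z" "z < \<tau> n" "f (x + \<tau> n *\<^sub>R e) - f x = \<tau> n * g (x + z *\<^sub>R e)" by auto
        then have "q n x = g (x + z *\<^sub>R e)"
          using Feq(1)[OF True, of "\<tau> n"] Feq(1)[OF True, of 0] \<tau>[of n] T(1) True by (simp add: q_def)
        moreover have "x + z *\<^sub>R e \<in> ball 0 R"
          using Feq(2)[OF True, of z] z \<tau>(2)[of n] by auto
        ultimately have "\<bar>q n x\<bar> \<le> \<bar>B\<bar>" using B[of "x + z *\<^sub>R e"] by auto
        moreover have "x \<in> cball 0 R" using True \<Omega>(2) closure_subset by force
        ultimately show ?thesis by simp
      qed (simp add: q_def)
    qed
  qed
  have "\<bar>LINT x|lborel. q n x\<bar> \<le> ?C * ((LINT y|?M. \<bar>f y\<bar>) + \<epsilon> * m)" for n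
  proof -
    have "\<bar>LINT x|lborel. indicator \<Omega> x * (F (x + \<tau> n *\<^sub>R e) - F x)\<bar>
      \<le> \<tau> n * (?C * ((LINT y|?M. \<bar>f y\<bar>) + \<epsilon> * m))"
      using \<tau>[of n] T by (intro small) auto
    moreover have "(LINT x|lborel. indicator \<Omega> x * (F (x + \<tau> n *\<^sub>R e) - F x)) = (LINT x|lborel. \<tau> n * q n x)"
      using \<tau>(1)[of n] by (simp add: q_def)
    moreover have "(LINT x|lborel. \<tau> n * q n x) = \<tau> n * (LINT x|lborel. q n x)" by simp
    ultimately have "\<tau> n * \<bar>LINT x|lborel. q n x\<bar> \<le> \<tau> n * (?C * ((LINT y|?M. \<bar>f y\<bar>) + \<epsilon> * m))"
      using \<tau>(1)[of n] by (simp add: abs_mult)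
    then show ?thesis using \<tau>(1)[of n] by (rule mult_left_le_imp_le)
  qed
  then have "\<bar>LINT x|lborel. indicator \<Omega> x * g x\<bar> \<le> ?C * ((LINT y|?M. \<bar>f y\<bar>) + \<epsilon> * m)"
    using tendsto_rabs[OF lim] by (intro LIMSEQ_le_const2) auto
  moreover have "(LINT x|lebesgue_on \<Omega>. g x) = (LINT x|lborel. indicator \<Omega> x * g x)"
  proof (rule integral_lebesgue_on_eq)
    show "(\<lambda>x. indicator \<Omega> x * g x) \<in> borel_measurable borel"
      using borel_measurable_continuous_on_indicator[of \<Omega> g] continuous_on_subset[OF g] \<Omega>(2) closure_subset
      by (metis (no_types, lifting) \<open>\<Omega> \<in> sets borel\<close> ball_subset_cball real_scaleR_def subset_trans measurable_cong)
  qed simp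
  ultimately show "\<bar>LINT x|lebesgue_on \<Omega>. g x\<bar> \<le> ?C * (LINT y|?M. \<bar>f y\<bar>) + \<epsilon>'"
    using eps(2) by (simp add: distrib_left)
qed

section \<open>Square-integrable functions\<close>

lemma square_integrable_measurable: "square_integrable M f \<Longrightarrow> f \<in> borel_measurable M"
  by (simp add: square_integrable_def)

lemma square_integrable_add:
  assumes "square_integrable M f" "square_integrable M g"
  shows "square_integrable M (\<lambda>x. f x + g x)"
  unfolding square_integrable_def
proof
  note [measurable] = assms[THEN square_integrable_measurable]
  show "(\<lambda>x. f x + g x) \<in> borel_measurable M" by measurable
  have "integrable M (\<lambda>x. 2 * (norm (f x))\<^sup>2 + 2 * (norm (g x))\<^sup>2)"
    using assms by (simp add: square_integrable_def)
  then show "integrable M (\<lambda>x. (norm (f x + g x))\<^sup>2)"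
  proof (rule Bochner_Integration.integrable_bound)
    show "AE x in M. norm ((norm (f x + g x))\<^sup>2) \<le> norm (2 * (norm (f x))\<^sup>2 + 2 * (norm (g x))\<^sup>2)"
    proof (intro AE_I2)
      fix x
      have "(norm (f x + g x))\<^sup>2 \<le> (norm (f x) + norm (g x))\<^sup>2"
        by (intro power_mono norm_triangle_ineq) simp
      also have "\<dots> \<le> 2 * (norm (f x))\<^sup>2 + 2 * (norm (g x))\<^sup>2"
        using sum_squares_bound[of "norm (f x)" "norm (g x)"] by (simp add: power2_sum)
      finally show "norm ((norm (f x + g x))\<^sup>2) \<le> norm (2 * (norm (f x))\<^sup>2 + 2 * (norm (g x))\<^sup>2)" by simp
    qed
  qed measurable
qed

lemma square_integrable_scaleR:
  assumes "square_integrable M f" shows "square_integrable M (\<lambda>x. c *\<^sub>R f x)"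
  using assms by (auto simp: square_integrable_def power_mult_distrib intro: borel_measurable_scaleR)

lemma square_integrable_diff:
  assumes "square_integrable M f" "square_integrable M g"
  shows "square_integrable M (\<lambda>x. f x - g x)"
  using square_integrable_add[OF assms(1) square_integrable_scaleR[OF assms(2), of "-1"]] by simp

lemma integrable_inner_square_integrable:
  assumes "square_integrable M f" "square_integrable M g"
  shows "integrable M (\<lambda>x. f x \<bullet> g x)"
proof -
  note [measurable] = assms[THEN square_integrable_measurable]
  have "integrable M (\<lambda>x. (norm (f x))\<^sup>2 + (norm (g x))\<^sup>2)"
    using assms by (simp add: square_integrable_def)
  then show ?thesis
  proof (rule Bochner_Integration.integrable_bound)
    show "AE x in M. norm (f x \<bullet> g x) \<le> norm ((norm (f x))\<^sup>2 + (norm (g x))\<^sup>2)"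
    proof (intro AE_I2)
      fix x
      have "norm (f x \<bullet> g x) \<le> norm (f x) * norm (g x)" by (simp add: Cauchy_Schwarz_ineq2)
      also have "\<dots> \<le> (norm (f x))\<^sup>2 + (norm (g x))\<^sup>2"
        using sum_squares_bound[of "norm (f x)" "norm (g x)"] mult_nonneg_nonneg[OF norm_ge_zero norm_ge_zero, of "f x" "g x"]
        by linarith
      finally show "norm (f x \<bullet> g x) \<le> norm ((norm (f x))\<^sup>2 + (norm (g x))\<^sup>2)" by simp
    qed
  qed measurable
qed

lemma L2_norm_nonneg: "0 \<le> L2_norm M f"
  by (simp add: L2_norm_def integral_nonneg_AE)

lemma L2_norm_squared: "(L2_norm M f)\<^sup>2 = (LINT x|M. (norm (f x))\<^sup>2)"
  by (simp add: L2_norm_def integral_nonneg_AE)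

lemma L2_norm_combination_squared:
  assumes "square_integrable M f" "square_integrable M g"
  shows "(L2_norm M (\<lambda>x. f x + s *\<^sub>R g x))\<^sup>2
    = (L2_norm M f)\<^sup>2 + 2 * s * (LINT x|M. f x \<bullet> g x) + s\<^sup>2 * (L2_norm M g)\<^sup>2"
proof -
  have "(norm (f x + s *\<^sub>R g x))\<^sup>2 = (norm (f x))\<^sup>2 + ((2 * s) * (f x \<bullet> g x) + s\<^sup>2 * (norm (g x))\<^sup>2)" for x
    using dot_norm[of "f x" "s *\<^sub>R g x"] by (simp add: power_mult_distrib)
  then have "(L2_norm M (\<lambda>x. f x + s *\<^sub>R g x))\<^sup>2 =
     (LINT x|M. (norm (f x))\<^sup>2 + ((2 * s) * (f x \<bullet> g x) + s\<^sup>2 * (norm (g x))\<^sup>2))"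
    by (simp only: L2_norm_squared)
  also have "\<dots> = (L2_norm M f)\<^sup>2 + ((2 * s) * (LINT x|M. f x \<bullet> g x) + s\<^sup>2 * (L2_norm M g)\<^sup>2)"
    using assms integrable_inner_square_integrable[OF assms] by (simp add: L2_norm_squared square_integrable_def)
  finally show ?thesis by simp
qed

lemma nonneg_quadratic_linear_coeff:
  fixes a b :: real
  assumes "\<And>s. 0 \<le> 2 * s * a + s\<^sup>2 * b" "0 \<le> b" shows "a = 0"
proof (rule ccontr)
  assume "a \<noteq> 0"
  \<comment> \<open>At s = -t the quadratic equals -t^2 (b + 2), which is negative. Dividing by b +
    1 rather than b covers b = 0.\<close>
  define t where "t = a / (b + 1)"
  have a: "a = t * (b + 1)" using assms(2) by (simp add: t_def)
  have "0 \<le> 2 * (- t) * a + (- t)\<^sup>2 * b" by (rule assms)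
  also have "\<dots> = t\<^sup>2 * (- b - 2)" unfolding a by (simp add: power2_eq_square algebra_simps)
  also have "\<dots> < 0" using \<open>a \<noteq> 0\<close> assms(2) a by (intro mult_pos_neg) auto
  finally show False by simp
qed

lemma L2_Cauchy_Schwarz:
  assumes "square_integrable M f" "square_integrable M g"
  shows "\<bar>LINT x|M. f x \<bullet> g x\<bar> \<le> L2_norm M f * L2_norm M g"
proof -
  let ?a = "(L2_norm M f)\<^sup>2" and ?b = "LINT x|M. f x \<bullet> g x" and ?c = "(L2_norm M g)\<^sup>2"
  have q: "0 \<le> ?a + 2 * s * ?b + s\<^sup>2 * ?c" for s
    unfolding L2_norm_combination_squared[OF assms, symmetric] by simp
  have "?b\<^sup>2 \<le> ?a * ?c"
  proof (cases "?c = 0")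
    \<comment> \<open>With vanishing second norm the quadratic is affine in s; at the chosen s it
      equals -1. In the other case s is the minimiser of the quadratic.\<close>
    case True
    have "?b = 0"
    proof (rule ccontr)
      assume "?b \<noteq> 0"
      then show False using q[of "- (?a + 1) / (2 * ?b)"] True by (simp add: field_simps)
    qed
    then show ?thesis by simp
  next
    case False
    then have "0 < ?c" by (metis less_eq_real_def zero_le_power2)
    moreover have "0 \<le> ?a - ?b\<^sup>2 / ?c" using q[of "- ?b / ?c"] False by (simp add: power2_eq_square)
    ultimately show ?thesis by (simp add: field_simps)
  qed
  also have "\<dots> = (L2_norm M f * L2_norm M g)\<^sup>2" by (simp add: power_mult_distrib)
  finally have "\<bar>?b\<bar> \<le> \<bar>L2_norm M f * L2_norm M g\<bar>" by (simp only: abs_le_square_iff)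
  then show ?thesis by (simp only: abs_of_nonneg[OF mult_nonneg_nonneg[OF L2_norm_nonneg L2_norm_nonneg]])
qed

lemma L2_norm_triangle:
  assumes "square_integrable M f" "square_integrable M g"
  shows "L2_norm M (\<lambda>x. f x + g x) \<le> L2_norm M f + L2_norm M g"
proof (rule power2_le_imp_le)
  have "(L2_norm M (\<lambda>x. f x + g x))\<^sup>2 = (L2_norm M f)\<^sup>2 + 2 * (LINT x|M. f x \<bullet> g x) + (L2_norm M g)\<^sup>2"
    using L2_norm_combination_squared[OF assms, of 1] by simp
  also have "\<dots> \<le> (L2_norm M f + L2_norm M g)\<^sup>2"
    using L2_Cauchy_Schwarz[OF assms] by (simp add: power2_sum)
  finally show "(L2_norm M (\<lambda>x. f x + g x))\<^sup>2 \<le> (L2_norm M f + L2_norm M g)\<^sup>2" .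
qed (simp add: L2_norm_nonneg)

section \<open>Completeness and Riesz representation\<close>

text \<open>Riesz-Fischer: along a fast subsequence the increments are summable almost everywhere,
  which defines the limit, and Fatou's lemma carries the Cauchy estimate of the whole sequence over
  to it.\<close>

lemma L2_complete:
  fixes f :: "nat \<Rightarrow> 'a \<Rightarrow> 'b::euclidean_space"
  assumes sq: "\<And>n. square_integrable M (f n)"
    and cau: "\<And>e. 0 < e \<Longrightarrow> \<exists>N. \<forall>m\<ge>N. \<forall>n\<ge>N. (L2_norm M (\<lambda>x. f m x - f n x))\<^sup>2 < e"
  obtains g where "square_integrable M g" "(\<lambda>n. L2_norm M (\<lambda>x. f n x - g x)) \<longlonglongrightarrow> 0"
proof -
  note fm [measurable] = sq[THEN square_integrable_measurable]
  have nn: "(\<integral>\<^sup>+x. ennreal ((norm (f m x - f n x))\<^sup>2) \<partial>M) = ennreal ((L2_norm M (\<lambda>x. f m x - f n x))\<^sup>2)" for m n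
    unfolding L2_norm_squared
    using square_integrable_diff[OF sq sq] by (intro nn_integral_eq_integral) (auto simp: square_integrable_def)
  have "\<exists>N. \<forall>m\<ge>N. \<forall>n\<ge>N. (L2_norm M (\<lambda>x. f m x - f n x))\<^sup>2 < (1/16)^k" for k :: nat
    by (rule cau) simp
  then obtain N where N: "\<And>k m n. N k \<le> m \<Longrightarrow> N k \<le> n \<Longrightarrow> (L2_norm M (\<lambda>x. f m x - f n x))\<^sup>2 < (1/16)^k"
    by metis
  \<comment> \<open>An index beyond all of \<open>N 0\<close>, ..., \<open>N k\<close> and beyond k,
    so that consecutive terms of the subsequence are controlled by the k-th threshold and the
    subsequence is cofinal.\<close>
  define r where "r k = sum N {..k} + k" for k :: nat
  have rN: "N k \<le> r j" if "k \<le> j" for j k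
    using member_le_sum[of k "{..j}" N] that by (simp add: r_def)
  have rk: "k \<le> r k" for k by (simp add: r_def)
  define D where "D k x = f (r (Suc k)) x - f (r k) x" for k x
  have [measurable]: "D k \<in> borel_measurable M" for k unfolding D_def[abs_def] by measurable
  have "(\<integral>\<^sup>+x. (\<Sum>k. ennreal (4^k * (norm (D k x))\<^sup>2)) \<partial>M) = (\<Sum>k. \<integral>\<^sup>+x. ennreal (4^k * (norm (D k x))\<^sup>2) \<partial>M)"
    by (rule nn_integral_suminf) measurable
  also have "\<dots> \<le> (\<Sum>k. ennreal ((1/4)^k))"
  proof (rule suminf_le)
    fix k
    have "(\<integral>\<^sup>+x. ennreal (4^k * (norm (D k x))\<^sup>2) \<partial>M) = ennreal (4^k) * (\<integral>\<^sup>+x. ennreal ((norm (D k x))\<^sup>2) \<partial>M)"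
      by (subst nn_integral_cmult[symmetric]) (auto simp: ennreal_mult)
    also have "\<dots> = ennreal (4^k) * ennreal ((L2_norm M (D k))\<^sup>2)"
      using nn[of "r (Suc k)" "r k"] by (simp add: D_def[abs_def])
    also have "\<dots> = ennreal (4^k * (L2_norm M (D k))\<^sup>2)" by (simp add: ennreal_mult)
    also have "\<dots> \<le> ennreal (4^k * (1/16)^k)"
      using N[of k "r (Suc k)" "r k"] rN[of k k] rN[of k "Suc k"]
      by (intro ennreal_leI mult_left_mono) (auto simp: D_def[abs_def])
    also have "(4::real)^k * (1/16)^k = (1/4)^k"
      by (simp add: power_mult_distrib[symmetric])
    finally show "(\<integral>\<^sup>+x. ennreal (4^k * (norm (D k x))\<^sup>2) \<partial>M) \<le> ennreal ((1/4)^k)" .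
  qed auto
  also have "\<dots> = ennreal (\<Sum>k. (1/4)^k)" by (rule suminf_ennreal2) (auto intro: summable_geometric)
  also have "\<dots> < \<infinity>" by simp
  finally have "(\<integral>\<^sup>+x. (\<Sum>k. ennreal (4^k * (norm (D k x))\<^sup>2)) \<partial>M) \<noteq> \<infinity>" by simp
  then have ae: "AE x in M. (\<Sum>k. ennreal (4^k * (norm (D k x))\<^sup>2)) \<noteq> \<infinity>"
    by (intro nn_integral_PInf_AE) measurable
  have conv: "convergent (\<lambda>k. f (r k) x)" if fin: "(\<Sum>k. ennreal (4^k * (norm (D k x))\<^sup>2)) \<noteq> \<infinity>" for x
  proof -
    define B where "B = enn2real (\<Sum>k. ennreal (4^k * (norm (D k x))\<^sup>2))"
    have B: "0 \<le> B" "(\<Sum>k. ennreal (4^k * (norm (D k x))\<^sup>2)) = ennreal B"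
      using fin unfolding B_def infinity_ennreal_def by (simp, simp only: ennreal_enn2real_if if_False)
    \<comment> \<open>The point of the weights \<open>4^k\<close>: one finite weighted sum of
      squares bounds the increments themselves by a geometric series. The squared norms were made
      smaller than 16^(-k) to leave room for these weights.\<close>
    have le: "norm (D k x) \<le> sqrt B * (1/2)^k" for k
    proof (rule power2_le_imp_le)
      have "ennreal (4^k * (norm (D k x))\<^sup>2) \<le> ennreal B"
        using sum_le_suminf[of "\<lambda>k. ennreal (4^k * (norm (D k x))\<^sup>2)" "{k}"] B by simp
      then have "4^k * (norm (D k x))\<^sup>2 \<le> B" using B(1) by (simp add: ennreal_le_iff)
      moreover have "((1/2::real)^k)\<^sup>2 = 1 / 4^k" by (simp add: power_divide power2_eq_square flip: power_mult_distrib)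
      ultimately show "(norm (D k x))\<^sup>2 \<le> (sqrt B * (1/2)^k)\<^sup>2"
        using B(1) by (simp add: power_mult_distrib field_simps)
    qed (use B(1) in auto)
    have "summable (\<lambda>k. D k x)"
      by (rule summable_comparison_test'[where N = 0, OF _ le]) (auto intro!: summable_mult summable_geometric)
    then have "convergent (\<lambda>n. \<Sum>k<n. D k x)" by (simp add: summable_iff_convergent)
    then have "convergent (\<lambda>n. f (r n) x - f (r 0) x)" using sum_lessThan_telescope[of "\<lambda>k. f (r k) x"] by (simp add: D_def)
    then show ?thesis using convergent_add[OF _ convergent_const[of "f (r 0) x"]] by fastforce
  qed
  define g where "g x = lim (\<lambda>k. f (r k) x)" for x
  have gm [measurable]: "g \<in> borel_measurable M"
    unfolding g_def[abs_def] by (rule borel_measurable_lim_metric) measurable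
  have lim: "AE x in M. (\<lambda>k. f (r k) x) \<longlonglongrightarrow> g x"
    using ae conv unfolding g_def by (auto simp: convergent_LIMSEQ_iff)
  \<comment> \<open>Fatou's lemma along the subsequence, with the index n held fixed.\<close>
  have small: "(\<integral>\<^sup>+x. ennreal ((norm (f n x - g x))\<^sup>2) \<partial>M) \<le> ennreal e"
    if N: "\<forall>m\<ge>N. \<forall>n\<ge>N. (L2_norm M (\<lambda>x. f m x - f n x))\<^sup>2 < e" "N \<le> n" for e N n
  proof -
    have "(\<integral>\<^sup>+x. ennreal ((norm (f n x - g x))\<^sup>2) \<partial>M) =
       (\<integral>\<^sup>+x. liminf (\<lambda>k. ennreal ((norm (f n x - f (r k) x))\<^sup>2)) \<partial>M)"
    proof (rule nn_integral_cong_AE)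
      show "AE x in M. ennreal ((norm (f n x - g x))\<^sup>2) = liminf (\<lambda>k. ennreal ((norm (f n x - f (r k) x))\<^sup>2))"
        using lim
      proof (eventually_elim)
        case (elim x)
        then have "(\<lambda>k. ennreal ((norm (f n x - f (r k) x))\<^sup>2)) \<longlonglongrightarrow> ennreal ((norm (f n x - g x))\<^sup>2)"
          by (intro tendsto_intros)
        then show ?case by (rule lim_imp_Liminf[symmetric, rotated]) simp
      qed
    qed
    also have "\<dots> \<le> liminf (\<lambda>k. \<integral>\<^sup>+x. ennreal ((norm (f n x - f (r k) x))\<^sup>2) \<partial>M)"
      by (rule nn_integral_liminf) measurable
    also have "\<dots> \<le> limsup (\<lambda>k. \<integral>\<^sup>+x. ennreal ((norm (f n x - f (r k) x))\<^sup>2) \<partial>M)"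
      by (rule Liminf_le_Limsup) simp
    also have "\<dots> \<le> ennreal e"
    proof (rule Limsup_bounded)
      show "\<forall>\<^sub>F k in sequentially. (\<integral>\<^sup>+x. ennreal ((norm (f n x - f (r k) x))\<^sup>2) \<partial>M) \<le> ennreal e"
        using eventually_ge_at_top[of N]
      proof eventually_elim
        case (elim k)
        then have "N \<le> r k" using rk[of k] by simp
        then show ?case unfolding nn using N by (intro ennreal_leI) (auto intro: less_imp_le)
      qed
    qed
    finally show ?thesis .
  qed
  have sqd: "square_integrable M (\<lambda>x. f n x - g x)" "(L2_norm M (\<lambda>x. f n x - g x))\<^sup>2 \<le> e"
    if N: "\<forall>m\<ge>N. \<forall>n\<ge>N. (L2_norm M (\<lambda>x. f m x - f n x))\<^sup>2 < e" "N \<le> n" for e N n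
  proof -
    have "0 \<le> (L2_norm M (\<lambda>x. f N x - f N x))\<^sup>2" by simp
    then have e: "0 < e" using N(1) by (meson le_less_trans order.refl)
    have i: "integrable M (\<lambda>x. (norm (f n x - g x))\<^sup>2)"
      using small[OF N] by (intro integrableI_bounded) (auto simp: order.strict_trans1[OF _ ennreal_less_top])
    then show "square_integrable M (\<lambda>x. f n x - g x)" by (simp add: square_integrable_def)
    show "(L2_norm M (\<lambda>x. f n x - g x))\<^sup>2 \<le> e"
      using small[OF N] e unfolding L2_norm_squared by (subst (asm) nn_integral_eq_integral[OF i]) auto
  qed
  show ?thesis
  proof (rule that)
    obtain N where N: "\<forall>m\<ge>N. \<forall>n\<ge>N. (L2_norm M (\<lambda>x. f m x - f n x))\<^sup>2 < 1" using cau[of 1] by auto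
    from square_integrable_diff[OF sq[of N] sqd(1)[OF N order.refl]]
    show "square_integrable M g" by simp
    show "(\<lambda>n. L2_norm M (\<lambda>x. f n x - g x)) \<longlonglongrightarrow> 0"
    proof (rule LIMSEQ_I)
      fix e :: real assume "0 < e"
      then have "0 < e\<^sup>2 / 4" by simp
      from cau[OF this] obtain N where N: "\<forall>m\<ge>N. \<forall>n\<ge>N. (L2_norm M (\<lambda>x. f m x - f n x))\<^sup>2 < e\<^sup>2 / 4" by auto
      have "L2_norm M (\<lambda>x. f n x - g x) < e" if "N \<le> n" for n
      proof (rule power2_less_imp_less)
        have "e\<^sup>2 / 4 < e\<^sup>2" using \<open>0 < e\<close> by simp
        then show "(L2_norm M (\<lambda>x. f n x - g x))\<^sup>2 < e\<^sup>2" using sqd(2)[OF N that] by linarith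
      qed (use \<open>0 < e\<close> in simp)
      then show "\<exists>N. \<forall>n\<ge>N. norm (L2_norm M (\<lambda>x. f n x - g x) - 0) < e"
        by (auto simp: L2_norm_nonneg)
    qed
  qed
qed

lemma L2_inner_tendsto:
  assumes "\<And>n. square_integrable M (f n)" "square_integrable M g" "square_integrable M h"
    and "(\<lambda>n. L2_norm M (\<lambda>x. f n x - g x)) \<longlonglongrightarrow> 0"
  shows "(\<lambda>n. LINT x|M. f n x \<bullet> h x) \<longlonglongrightarrow> (LINT x|M. g x \<bullet> h x)"
proof -
  have "(\<lambda>n. (LINT x|M. f n x \<bullet> h x) - (LINT x|M. g x \<bullet> h x)) \<longlonglongrightarrow> 0"
  proof (rule tendsto_0_le)
    show "(\<lambda>n. L2_norm M (\<lambda>x. f n x - g x)) \<longlonglongrightarrow> 0" by fact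
    show "\<forall>\<^sub>F n in sequentially. norm ((LINT x|M. f n x \<bullet> h x) - (LINT x|M. g x \<bullet> h x))
        \<le> norm (L2_norm M (\<lambda>x. f n x - g x)) * L2_norm M h"
    proof (intro always_eventually allI)
      fix n
      have "(LINT x|M. f n x \<bullet> h x) - (LINT x|M. g x \<bullet> h x) = (LINT x|M. (f n x - g x) \<bullet> h x)"
        unfolding inner_diff_left
        by (intro Bochner_Integration.integral_diff[symmetric] integrable_inner_square_integrable assms)
      then show "norm ((LINT x|M. f n x \<bullet> h x) - (LINT x|M. g x \<bullet> h x))
        \<le> norm (L2_norm M (\<lambda>x. f n x - g x)) * L2_norm M h"
        using L2_Cauchy_Schwarz[OF square_integrable_diff[OF assms(1,2), of n] assms(3)]
        by (simp add: L2_norm_nonneg)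
    qed
  qed
  then show ?thesis by (simp add: LIM_zero_iff)
qed

text \<open>The representing function is the limit of a minimising sequence of \<open>\<parallel>v\<parallel>\<^sup>2 - 2 \<phi> v\<close> in
  \<open>V\<close>, which is a Cauchy sequence by the parallelogram law.\<close>

theorem L2_Riesz_representation:
  fixes V :: "('a \<Rightarrow> 'b::euclidean_space) set" and \<phi> :: "('a \<Rightarrow> 'b) \<Rightarrow> real"
  assumes V: "V \<noteq> {}" "\<And>v w. v \<in> V \<Longrightarrow> w \<in> V \<Longrightarrow> (\<lambda>x. v x + w x) \<in> V" "\<And>v c. v \<in> V \<Longrightarrow> (\<lambda>x. c *\<^sub>R v x) \<in> V"
    and sq: "\<And>v. v \<in> V \<Longrightarrow> square_integrable M v"
    and lin: "\<And>v w. v \<in> V \<Longrightarrow> w \<in> V \<Longrightarrow> \<phi> (\<lambda>x. v x + w x) = \<phi> v + \<phi> w"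
      "\<And>v c. v \<in> V \<Longrightarrow> \<phi> (\<lambda>x. c *\<^sub>R v x) = c * \<phi> v"
    and bd: "\<And>v. v \<in> V \<Longrightarrow> \<bar>\<phi> v\<bar> \<le> C * L2_norm M v"
  obtains g where "square_integrable M g" "\<And>v. v \<in> V \<Longrightarrow> \<phi> v = (LINT x|M. g x \<bullet> v x)"
proof -
  define J where "J v = (L2_norm M v)\<^sup>2 - 2 * \<phi> v" for v
  have J_low: "- C\<^sup>2 \<le> J v" if "v \<in> V" for v
  proof -
    have "0 \<le> (L2_norm M v - C)\<^sup>2" by simp
    then show ?thesis using bd[OF that] by (simp add: J_def power2_diff abs_le_iff mult.commute)
  qed
  have J_comb: "J (\<lambda>x. v x + s *\<^sub>R w x) = J v + 2 * s * ((LINT x|M. v x \<bullet> w x) - \<phi> w) + s\<^sup>2 * (L2_norm M w)\<^sup>2"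
    if "v \<in> V" "w \<in> V" for v w s
    using that by (simp add: J_def L2_norm_combination_squared sq V lin algebra_simps)
  define m where "m = Inf (J ` V)"
  have bb: "bdd_below (J ` V)" using J_low by (intro bdd_belowI[of _ "- C\<^sup>2"]) auto
  have m: "m \<le> J v" if "v \<in> V" for v unfolding m_def using bb that by (intro cINF_lower)
  have "\<exists>v\<in>V. J v < m + 1 / real (Suc n)" for n
    using cInf_lessD[of "J ` V" "m + 1 / real (Suc n)"] V(1) by (auto simp: m_def)
  then obtain v where v: "\<And>n. v n \<in> V" "\<And>n. J (v n) < m + 1 / real (Suc n)" by metis
  have par: "(L2_norm M (\<lambda>x. v i x - v j x))\<^sup>2 < 2 / real (Suc i) + 2 / real (Suc j)" for i j
  proof -
    have d: "(L2_norm M (\<lambda>x. v i x - v j x))\<^sup>2 = (L2_norm M (v i))\<^sup>2 - 2 * (LINT x|M. v i x \<bullet> v j x) + (L2_norm M (v j))\<^sup>2"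
      using L2_norm_combination_squared[OF sq sq, of "v i" "v j" "-1"] v(1) by simp
    \<comment> \<open>The value of \<open>J\<close> at the midpoint is at least the infimum m;
      expanding the squares turns this into a bound for the distance of two almost minimising
      elements.\<close>
    let ?h = "\<lambda>x. (1/2) *\<^sub>R (v i x + 1 *\<^sub>R v j x)"
    have hV: "?h \<in> V" using v(1) by (intro V) auto
    have "(L2_norm M ?h)\<^sup>2 = (1/4) * (L2_norm M (\<lambda>x. v i x + 1 *\<^sub>R v j x))\<^sup>2"
      by (simp add: L2_norm_squared power_divide)
    moreover have "\<phi> ?h = (1/2) * (\<phi> (v i) + \<phi> (v j))"
      using v(1) by (simp add: lin V)
    moreover have "m \<le> J ?h" by (rule m[OF hV])
    ultimately have "4 * m \<le> (L2_norm M (v i))\<^sup>2 + 2 * (LINT x|M. v i x \<bullet> v j x) + (L2_norm M (v j))\<^sup>2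
        - 4 * (\<phi> (v i) + \<phi> (v j))"
      using L2_norm_combination_squared[OF sq sq, of "v i" "v j" 1] v(1) unfolding J_def by simp
    moreover have "2 * J (v i) + 2 * J (v j) < 4 * m + (2 / real (Suc i) + 2 / real (Suc j))"
      using v(2)[of i] v(2)[of j] by simp
    moreover have "A - 2 * c + B < E" if "4 * m \<le> A + 2 * c + B - 4 * (p + q)" "2 * (A - 2 * p) + 2 * (B - 2 * q) < 4 * m + E"
      for A B c p q E :: real using that by (simp add: algebra_simps)
    ultimately show ?thesis unfolding d J_def by blast
  qed
  obtain g where g: "square_integrable M g" "(\<lambda>n. L2_norm M (\<lambda>x. v n x - g x)) \<longlonglongrightarrow> 0"
  proof (rule L2_complete[of M v])
    fix e :: real assume "0 < e"
    then obtain N :: nat where N: "4 / e < real N" using reals_Archimedean2 by blast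
    have "(L2_norm M (\<lambda>x. v i x - v j x))\<^sup>2 < e" if "N \<le> i" "N \<le> j" for i j
    proof -
      have "2 / real (Suc k) \<le> e / 2" if "N \<le> k" for k
      proof -
        have "4 / e \<le> real (Suc k)" using N that by simp
        then show ?thesis using \<open>0 < e\<close> by (simp add: field_simps)
      qed
      from this[OF that(1)] this[OF that(2)] par[of i j] show ?thesis by linarith
    qed
    then show "\<exists>N. \<forall>i\<ge>N. \<forall>j\<ge>N. (L2_norm M (\<lambda>x. v i x - v j x))\<^sup>2 < e" by blast
  qed (use sq v(1) in auto)
  show ?thesis
  proof (rule that[OF g(1)])
    fix w assume w: "w \<in> V"
    \<comment> \<open>First variation in the direction w: moving \<open>v n\<close> by s w cannot
      lower \<open>J\<close> below m. In the limit this is a nonnegative quadratic in s without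
      constant term, so its linear coefficient vanishes.\<close>
    have "(LINT x|M. g x \<bullet> w x) - \<phi> w = 0"
    proof (rule nonneg_quadratic_linear_coeff)
      fix s
      have "(\<lambda>n. LINT x|M. v n x \<bullet> w x) \<longlonglongrightarrow> (LINT x|M. g x \<bullet> w x)"
        using sq v(1) w by (intro L2_inner_tendsto g) auto
      then have "(\<lambda>n. 1 / real (Suc n) + 2 * s * ((LINT x|M. v n x \<bullet> w x) - \<phi> w) + s\<^sup>2 * (L2_norm M w)\<^sup>2)
        \<longlonglongrightarrow> 0 + 2 * s * ((LINT x|M. g x \<bullet> w x) - \<phi> w) + s\<^sup>2 * (L2_norm M w)\<^sup>2"
        by (intro tendsto_intros LIMSEQ_Suc[OF lim_const_over_n])
      moreover have "0 \<le> 1 / real (Suc n) + 2 * s * ((LINT x|M. v n x \<bullet> w x) - \<phi> w) + s\<^sup>2 * (L2_norm M w)\<^sup>2" for n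
        using m[of "\<lambda>x. v n x + s *\<^sub>R w x"] v[of n] w J_comb[of "v n" w s] V by simp
      ultimately show "0 \<le> 2 * s * ((LINT x|M. g x \<bullet> w x) - \<phi> w) + s\<^sup>2 * (L2_norm M w)\<^sup>2"
        by (intro LIMSEQ_le_const[where a = 0]) auto
    qed simp
    then show "\<phi> w = (LINT x|M. g x \<bullet> w x)" by simp
  qed
qed

section \<open>Smooth functions\<close>

lemma partial_deriv_eqI: "(f has_derivative f') (at x) \<Longrightarrow> partial_deriv i f x = f' (axis i 1)"
  unfolding partial_deriv_def by (metis frechet_derivative_at)

lemma smooth_partial_deriv: "smooth f \<Longrightarrow> smooth (partial_deriv i f)"
  unfolding smooth_def
proof
  fix js assume "\<forall>is. foldr partial_deriv is f differentiable_on UNIV"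
  from this[rule_format, of "js @ [i]"]
  show "foldr partial_deriv js (partial_deriv i f) differentiable_on UNIV" by simp
qed

lemma smooth_differentiable: "smooth f \<Longrightarrow> f differentiable (at x)"
  unfolding smooth_def differentiable_on_def by (metis UNIV_I foldr.simps(1) id_apply)

text \<open>Smoothness as a greatest fixed point: a class of differentiable functions that is closed
  under partial derivatives contains all iterated derivatives of its members, so none has to be
  computed explicitly.\<close>

lemma smooth_coinduct:
  assumes "f \<in> S" "\<And>g x. g \<in> S \<Longrightarrow> g differentiable (at x)" "\<And>g i. g \<in> S \<Longrightarrow> partial_deriv i g \<in> S"
  shows "smooth f"
proof -
  have "foldr partial_deriv is f \<in> S" for "is" by (induction "is") (use assms in auto)
  then show ?thesis unfolding smooth_def differentiable_on_def using assms(2) by blast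
qed

text \<open>Up to scalars, the derivatives of \<open>exp_bump 0\<close> are sums of functions \<open>exp_bump k\<close>. Including
  all of them in one algebra of functions makes it closed under partial derivatives, hence smooth.\<close>

definition exp_bump :: "nat \<Rightarrow> real \<Rightarrow> real" where
  "exp_bump k s = (if 0 < s then exp (- 1 / s) / s ^ k else 0)"

lemma exp_bump_tendsto_0: "(exp_bump k \<longlongrightarrow> 0) (at 0)"
proof -
  have "((\<lambda>u. u ^ k / exp u) \<longlongrightarrow> 0) (at_top :: real filter)" by (rule tendsto_power_div_exp_0)
  then have "((\<lambda>s. inverse s ^ k / exp (inverse s)) \<longlongrightarrow> 0) (at_right (0::real))"
    by (rule filterlim_compose) (rule filterlim_inverse_at_top_right)
  then have "(exp_bump k \<longlongrightarrow> 0) (at_right 0)"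
  proof (rule Lim_transform_eventually)
    show "\<forall>\<^sub>F s in at_right 0. inverse s ^ k / exp (inverse s) = exp_bump k s"
      by (auto simp: eventually_at_filter exp_bump_def exp_minus field_simps intro!: always_eventually)
  qed
  moreover have "(exp_bump k \<longlongrightarrow> 0) (at_left 0)"
    by (rule tendsto_eventually) (auto simp: eventually_at_filter exp_bump_def)
  ultimately show ?thesis by (simp add: filterlim_split_at_real)
qed

text \<open>Away from 0 this is the quotient rule. At 0 the difference quotient of
  \<open>exp_bump k\<close> is \<open>exp_bump (k + 1)\<close>, which tends to 0.\<close>

lemma DERIV_exp_bump:
  "(exp_bump k has_real_derivative exp_bump (k + 2) s - real k * exp_bump (k + 1) s) (at s)"
proof (cases s "0 :: real" rule: linorder_cases)
  case less
  have "((\<lambda>_. 0) has_real_derivative 0) (at s)" by simp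
  then have "(exp_bump k has_real_derivative 0) (at s)"
    by (rule DERIV_cong_ev[THEN iffD1, rotated -1])
      (use less in \<open>auto simp: exp_bump_def eventually_nhds intro!: exI[of _ "{..<0}"]\<close>)
  then show ?thesis using less by (simp add: exp_bump_def)
next
  case equal
  have "((\<lambda>h. (exp_bump k (0 + h) - exp_bump k 0) / h) \<longlongrightarrow> 0) (at 0)"
    using exp_bump_tendsto_0[of "k + 1"]
    by (rule Lim_transform_eventually) (auto simp: exp_bump_def eventually_at_filter)
  then show ?thesis using equal by (simp add: DERIV_def exp_bump_def)
next
  case greater
  have "((\<lambda>s. exp (- 1 / s) / s ^ k) has_real_derivative
      (exp (- 1 / s) * (1 / s^2) * s ^ k - exp (- 1 / s) * (real k * s ^ (k - 1))) / (s ^ k * s ^ k)) (at s)"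
    using greater by (auto intro!: derivative_eq_intros simp: power2_eq_square)
  also have "(exp (- 1 / s) * (1 / s^2) * s ^ k - exp (- 1 / s) * (real k * s ^ (k - 1))) / (s ^ k * s ^ k)
     = exp_bump (k + 2) s - real k * exp_bump (k + 1) s"
    using greater by (cases k) (simp_all add: exp_bump_def field_simps power2_eq_square)
  finally have "((\<lambda>s. exp (- 1 / s) / s ^ k) has_real_derivative exp_bump (k + 2) s - real k * exp_bump (k + 1) s) (at s)" .
  then show ?thesis
    by (rule DERIV_cong_ev[THEN iffD1, rotated -1])
      (use greater in \<open>auto simp: exp_bump_def eventually_nhds intro!: exI[of _ "{0<..}"]\<close>)
qed

text \<open>As all smooth functions are among the generators, the algebra turns out to be exactly
  the set of smooth functions, and closure of smoothness under sums and products can be read off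
  from the rules.\<close>

inductive_set smooth_algebra :: "(real^'n::finite \<Rightarrow> real) set" where
  smooth: "smooth f \<Longrightarrow> f \<in> smooth_algebra"
| const: "(\<lambda>x. c) \<in> smooth_algebra"
| coord: "(\<lambda>x. x $ i) \<in> smooth_algebra"
| bump: "(\<lambda>x. exp_bump k (a * x $ i + b)) \<in> smooth_algebra"
| add: "f \<in> smooth_algebra \<Longrightarrow> g \<in> smooth_algebra \<Longrightarrow> (\<lambda>x. f x + g x) \<in> smooth_algebra"
| mult: "f \<in> smooth_algebra \<Longrightarrow> g \<in> smooth_algebra \<Longrightarrow> (\<lambda>x. f x * g x) \<in> smooth_algebra"

lemma smooth_algebra_deriv:
  assumes "f \<in> smooth_algebra"
  shows "(\<forall>x. f differentiable (at x)) \<and> (\<forall>i. partial_deriv i f \<in> smooth_algebra)"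
  using assms
proof induction
  case (smooth f)
  then show ?case using smooth_differentiable smooth_partial_deriv smooth_algebra.smooth by blast
next
  case (const c)
  have "partial_deriv i (\<lambda>x. c) = (\<lambda>x. 0)" for i :: 'a
    by (rule ext, subst partial_deriv_eqI[OF has_derivative_const]) simp
  then show ?case using smooth_algebra.const by simp
next
  case (coord j)
  have d: "((\<lambda>x. x $ j) has_derivative (\<lambda>h. h $ j)) (at x)" for x :: "real^'a"
    by (rule bounded_linear_imp_has_derivative[OF bounded_linear_vec_nth])
  have "partial_deriv i (\<lambda>x. x $ j) = (\<lambda>x. axis i 1 $ j)" for i :: 'a
    by (rule ext, subst partial_deriv_eqI[OF d]) simp
  then show ?case using smooth_algebra.const d by (auto simp: differentiable_def)
next
  case (bump k a j b)
  have d: "((\<lambda>x. exp_bump k (a * x $ j + b)) has_derivative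
      (\<lambda>h. (exp_bump (k + 2) (a * x $ j + b) - real k * exp_bump (k + 1) (a * x $ j + b)) * (a * h $ j))) (at x)"
    for x :: "real^'a"
    by (rule has_derivative_compose[of "\<lambda>x. a * x $ j + b" "\<lambda>h. a * h $ j", OF _ DERIV_exp_bump[unfolded has_field_derivative_def]])
      (auto intro!: derivative_eq_intros bounded_linear_imp_has_derivative[OF bounded_linear_vec_nth])
  have "partial_deriv i (\<lambda>x. exp_bump k (a * x $ j + b)) =
     (\<lambda>x. (exp_bump (k + 2) (a * x $ j + b) + (- real k) * exp_bump (k + 1) (a * x $ j + b)) * (a * axis i 1 $ j))" for i :: 'a
    by (rule ext, subst partial_deriv_eqI[OF d]) simp
  moreover have "\<dots> i \<in> smooth_algebra" for i :: 'a
    by (intro smooth_algebra.intros)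
  ultimately show ?case using d by (auto simp: differentiable_def)
next
  case (add f g)
  then have d: "f differentiable (at x)" "g differentiable (at x)" for x by auto
  have "partial_deriv i (\<lambda>x. f x + g x) = (\<lambda>x. partial_deriv i f x + partial_deriv i g x)" for i
    by (rule ext, subst partial_deriv_eqI[OF has_derivative_add[OF frechet_derivative_works[THEN iffD1, OF d(1)]
          frechet_derivative_works[THEN iffD1, OF d(2)]]]) (simp add: partial_deriv_def)
  then show ?case using add d by (auto intro: smooth_algebra.add)
next
  case (mult f g)
  then have d: "f differentiable (at x)" "g differentiable (at x)" for x by auto
  have "partial_deriv i (\<lambda>x. f x * g x) = (\<lambda>x. f x * partial_deriv i g x + partial_deriv i f x * g x)" for i
    by (rule ext, subst partial_deriv_eqI[OF has_derivative_mult[OF frechet_derivative_works[THEN iffD1, OF d(1)]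
          frechet_derivative_works[THEN iffD1, OF d(2)]]]) (simp add: partial_deriv_def)
  then show ?case using mult d by (auto intro!: smooth_algebra.add smooth_algebra.mult)
qed

lemma smooth_algebra_smooth: "f \<in> smooth_algebra \<longleftrightarrow> smooth f"
  using smooth_coinduct[of f smooth_algebra] smooth_algebra_deriv smooth_algebra.smooth by blast

lemma smooth_const [intro]: "smooth (\<lambda>x. c)"
  and smooth_coord [intro]: "smooth (\<lambda>x. x $ i)"
  and smooth_bump [intro]: "smooth (\<lambda>x. exp_bump k (a * x $ i + b))"
  and smooth_add [intro]: "smooth f \<Longrightarrow> smooth g \<Longrightarrow> smooth (\<lambda>x. f x + g x)"
  and smooth_mult [intro]: "smooth f \<Longrightarrow> smooth g \<Longrightarrow> smooth (\<lambda>x. f x * g x)"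
  using smooth_algebra.intros by (simp_all flip: smooth_algebra_smooth)

lemma smooth_sum [intro]: "finite A \<Longrightarrow> (\<And>i. i \<in> A \<Longrightarrow> smooth (f i)) \<Longrightarrow> smooth (\<lambda>x. \<Sum>i\<in>A. f i x)"
  by (induction A rule: finite_induct) auto

lemma smooth_prod [intro]: "finite A \<Longrightarrow> (\<And>i. i \<in> A \<Longrightarrow> smooth (f i)) \<Longrightarrow> smooth (\<lambda>x. \<Prod>i\<in>A. f i x)"
  by (induction A rule: finite_induct) auto

section \<open>Smooth approximation of box indicators\<close>

text \<open>Each coordinate contributes a factor that vanishes left of \<open>a\<close> and one that
  vanishes right of \<open>b\<close>. Inside the box the factor \<open>Suc n\<close> drives the
  arguments to infinity, where \<open>exp_bump 0\<close> tends to 1; the indicator of the open box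
  is thus a bounded pointwise limit.\<close>

definition box_bump :: "real^'n::finite \<Rightarrow> real^'n \<Rightarrow> nat \<Rightarrow> real^'n \<Rightarrow> real" where
  "box_bump a b n x = (\<Prod>i\<in>UNIV. exp_bump 0 (real (Suc n) * x $ i + - real (Suc n) * a $ i)
      * exp_bump 0 (- real (Suc n) * x $ i + real (Suc n) * b $ i))"

lemma smooth_box_bump: "smooth (box_bump a b n)"
  unfolding box_bump_def[abs_def] by (intro smooth_prod smooth_mult smooth_bump) simp

lemma exp_bump_0_bounds: "0 \<le> exp_bump 0 s" "exp_bump 0 s \<le> 1"
  by (auto simp: exp_bump_def)

lemma box_bump_bounds: "0 \<le> box_bump a b n x" "box_bump a b n x \<le> 1"
  unfolding box_bump_def
  by (auto intro!: prod_nonneg prod_le_1 mult_nonneg_nonneg mult_le_one exp_bump_0_bounds)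

lemma box_bump_outside: "x \<notin> box a b \<Longrightarrow> box_bump a b n x = 0"
proof -
  assume "x \<notin> box a b"
  then obtain i where "x $ i \<le> a $ i \<or> b $ i \<le> x $ i" by (auto simp: mem_box_cart not_less)
  then have "real (Suc n) * x $ i \<le> real (Suc n) * a $ i \<or> real (Suc n) * b $ i \<le> real (Suc n) * x $ i"
    by (meson mult_left_mono of_nat_0_le_iff)
  then have "exp_bump 0 (real (Suc n) * x $ i + - real (Suc n) * a $ i)
      * exp_bump 0 (- real (Suc n) * x $ i + real (Suc n) * b $ i) = 0"
    unfolding exp_bump_def by (auto simp del: of_nat_Suc)
  then show ?thesis unfolding box_bump_def by (intro prod_zero) auto
qed

lemma exp_bump_0_tendsto_1:
  assumes "0 < s" shows "(\<lambda>n. exp_bump 0 (real (Suc n) * s)) \<longlonglongrightarrow> 1"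
proof -
  have "(\<lambda>n. exp (- (1 / s) * (1 / real (Suc n)))) \<longlonglongrightarrow> exp (- (1 / s) * 0)"
    by (intro tendsto_intros LIMSEQ_Suc[OF lim_const_over_n])
  moreover have "exp_bump 0 (real (Suc n) * s) = exp (- (1 / s) * (1 / real (Suc n)))" for n
    using assms by (simp add: exp_bump_def mult.commute del: of_nat_Suc)
  ultimately show ?thesis by simp
qed

lemma box_bump_tendsto: "(\<lambda>n. box_bump a b n x) \<longlonglongrightarrow> indicator (box a b) x"
proof (cases "x \<in> box a b")
  case True
  have "(\<lambda>n. exp_bump 0 (real (Suc n) * (x $ i - a $ i)) * exp_bump 0 (real (Suc n) * (b $ i - x $ i))) \<longlonglongrightarrow> 1 * 1" for i
    using True by (intro tendsto_mult exp_bump_0_tendsto_1) (auto simp: mem_box_cart)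
  moreover have "real (Suc n) * (x $ i - a $ i) = real (Suc n) * x $ i + - real (Suc n) * a $ i"
    "real (Suc n) * (b $ i - x $ i) = - real (Suc n) * x $ i + real (Suc n) * b $ i" for n i
    by (simp_all add: right_diff_distrib del: of_nat_Suc)
  ultimately have "(\<lambda>n. box_bump a b n x) \<longlonglongrightarrow> (\<Prod>i\<in>(UNIV :: 'a set). 1 * 1)"
    unfolding box_bump_def by (intro tendsto_prod) simp
  then show ?thesis using True by simp
next
  case False then show ?thesis by (simp add: box_bump_outside)
qed

lemma box_bump_test_function:
  assumes "cbox a b \<subseteq> \<Omega>" shows "box_bump a b n \<in> test_functions \<Omega>"
proof -
  have "box_bump a b n x = 0" if "x \<notin> cbox a b" for x
    using that box_subset_cbox by (intro box_bump_outside) blast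
  then show ?thesis
    unfolding test_functions_def using smooth_box_bump assms by (auto intro!: exI[of _ "cbox a b"])
qed

section \<open>Weak Jacobians\<close>

lemma smooth_continuous_on: "smooth f \<Longrightarrow> continuous_on S f"
  by (meson continuous_at_imp_continuous_on differentiable_imp_continuous_within smooth_differentiable)

section \<open>The fundamental lemma of the calculus of variations\<close>

text \<open>Open boxes form an intersection-stable generator of the Borel sets, so a Dynkin argument
  extends the vanishing of integrals to all Borel sets, in particular to those where g is positive
  or negative.\<close>

lemma AE_zero_of_box_integrals:
  fixes g :: "'a::euclidean_space \<Rightarrow> real"
  assumes int: "integrable lborel g" and box: "\<And>a b. (LINT x|lborel. indicator (box a b) x * g x) = 0"
  shows "AE x in lborel. g x = 0"
proof -
  have gm [measurable]: "g \<in> borel_measurable borel" using int by simp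
  have ii: "integrable lborel (\<lambda>x. indicator A x * g x)" if "A \<in> sets borel" for A
    using that by (intro Bochner_Integration.integrable_bound[OF int]) (auto simp: indicator_def)
  \<comment> \<open>Complements in the Dynkin induction need the integral over the whole space,
    which is exhausted by centred boxes.\<close>
  have total: "(LINT x|lborel. g x) = 0"
  proof -
    have "(\<lambda>n. LINT x|lborel. indicator (box (- (real n *\<^sub>R One)) (real n *\<^sub>R One)) x * g x) \<longlonglongrightarrow> (LINT x|lborel. g x)"
    proof (rule integral_dominated_convergence[where w = "\<lambda>x. \<bar>g x\<bar>"])
      show "AE x in lborel. (\<lambda>n. indicator (box (- (real n *\<^sub>R One)) (real n *\<^sub>R One)) x * g x) \<longlonglongrightarrow> g x"
      proof (intro AE_I2 tendsto_eventually)
        fix x :: 'a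
        obtain n0 :: nat where n0: "x \<in> box (- (real n0 *\<^sub>R One)) (real n0 *\<^sub>R One)"
          using UN_box_eq_UNIV by blast
        have "x \<in> box (- (real n *\<^sub>R One)) (real n *\<^sub>R One)" if "n0 \<le> n" for n
          using n0 that by (auto simp: mem_box inner_diff_left)
        then show "\<forall>\<^sub>F n in sequentially. indicator (box (- (real n *\<^sub>R One)) (real n *\<^sub>R One)) x * g x = g x"
          by (auto simp: eventually_sequentially intro!: exI[of _ n0])
      qed
    qed (use int in \<open>auto simp: indicator_def\<close>)
    then show ?thesis unfolding box by (simp add: LIMSEQ_const_iff)
  qed
  let ?G = "range (\<lambda>(a, b). box a b :: 'a set)"
  have zero: "(LINT x|lborel. indicator A x * g x) = 0" if A: "A \<in> sets borel" for A
  proof -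
    have sA: "A \<in> sigma_sets UNIV ?G" using A by (simp add: borel_eq_box)
    have st: "Int_stable ?G"
    proof (rule Int_stableI)
      fix X Y assume "X \<in> ?G" "Y \<in> ?G"
      then obtain a b c d where "X = box a b" "Y = box c d" by auto
      then obtain p q where "X \<inter> Y = box p q" using box_Int_box by blast
      then show "X \<inter> Y \<in> ?G" by (intro image_eqI[of _ _ "(p, q)"]) auto
    qed
    have pw: "?G \<subseteq> Pow UNIV" by simp
    from st pw sA show ?thesis
    proof (induction rule: sigma_sets_induct_disjoint)
      case (basic A) then show ?case using box by auto
    next
      case (compl A)
      then have "A \<in> sets borel" by (simp add: borel_eq_box)
      have "(LINT x|lborel. indicator (UNIV - A) x * g x) = (LINT x|lborel. g x - indicator A x * g x)"
        by (intro Bochner_Integration.integral_cong) (auto simp: indicator_def)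
      also have "\<dots> = 0" using compl total ii[OF \<open>A \<in> sets borel\<close>] int by simp
      finally show ?case .
    next
      case (union A)
      then have A: "\<And>i. A i \<in> sets borel" by (auto simp: borel_eq_box)
      have "(LINT x:(\<Union>i. A i)|lborel. g x) = (\<Sum>i. (LINT x:(A i)|lborel. g x))"
        using A union(1) ii[of "\<Union>i. A i"]
        by (intro lebesgue_integral_countable_add) (auto simp: disjoint_family_on_def set_integrable_def)
      then show ?case using union by (simp add: set_lebesgue_integral_def)
    qed auto
  qed
  have "AE x in lborel. indicator {x. 0 < g x} x * g x = 0"
    using zero[of "{x. 0 < g x}"] ii[of "{x. 0 < g x}"]
    by (subst integral_nonneg_eq_0_iff_AE[symmetric]) (auto simp: indicator_def)
  moreover have "AE x in lborel. - (indicator {x. g x < 0} x * g x) = 0"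
    using zero[of "{x. g x < 0}"] ii[of "{x. g x < 0}"]
    by (subst integral_nonneg_eq_0_iff_AE[symmetric]) (auto simp: indicator_def)
  ultimately show ?thesis by eventually_elim (auto simp: indicator_def split: if_splits)
qed

text \<open>Box bumps turn the hypothesis into vanishing integrals over boxes whose closure lies in
  \<Omega>; on each such box the function is then zero almost everywhere, and countably many closed
  boxes fill \<Omega>.\<close>

lemma AE_zero_of_test_functions:
  fixes h :: "real^'n::finite \<Rightarrow> real"
  assumes \<Omega>: "open \<Omega>" and int: "integrable (lebesgue_on \<Omega>) h"
    and test: "\<And>\<phi>. \<phi> \<in> test_functions \<Omega> \<Longrightarrow> (LINT x|lebesgue_on \<Omega>. h x * \<phi> x) = 0"
  shows "AE x in lebesgue_on \<Omega>. h x = 0"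
proof -
  have \<Omega>m: "\<Omega> \<in> sets lebesgue" using \<Omega> by auto
  define k where "k x = indicator \<Omega> x *\<^sub>R h x" for x
  have ki: "integrable lebesgue k"
    unfolding k_def[abs_def] using int \<Omega>m by (simp add: integrable_restrict_space)
  \<comment> \<open>A Borel representative of the extension of h by zero, so that the arguments can
    take place in \<open>lborel\<close>.\<close>
  obtain g where gm: "g \<in> borel_measurable lborel" and "AE x in lborel. k x = g x"
    using completion_ex_borel_measurable_real[of k lborel] ki by blast
  then have kg: "AE x in lebesgue. k x = g x" by (simp add: AE_completion)
  have "integrable lebesgue g"
    using integrable_cong_AE[THEN iffD1, OF _ _ kg ki] ki gm by (simp add: measurable_completion)
  then have gi: "integrable lborel g" using gm by (simp add: integrable_completion)
  have test': "(LINT x|lborel. \<phi> x * g x) = 0" if \<phi>: "\<phi> \<in> test_functions \<Omega>" "\<phi> \<in> borel_measurable borel" for \<phi>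
  proof -
    have "(LINT x|lborel. \<phi> x * g x) = (LINT x|lebesgue. \<phi> x * g x)"
      using gm \<phi>(2) by (subst integral_completion) auto
    also have "\<dots> = (LINT x|lebesgue. \<phi> x * k x)"
      using gm \<phi>(2) ki kg by (intro integral_cong_AE) (auto simp: measurable_completion intro!: borel_measurable_times)
    also have "\<dots> = (LINT x|lebesgue. indicator \<Omega> x *\<^sub>R (h x * \<phi> x))"
      by (simp add: k_def mult_ac)
    also have "\<dots> = (LINT x|lebesgue_on \<Omega>. h x * \<phi> x)"
      using \<Omega>m by (intro integral_restrict_space[symmetric]) auto
    finally show ?thesis using test[OF \<phi>(1)] by simp
  qed
  have sub: "(LINT x|lborel. indicator (box a b) x * g x) = 0" if ab: "cbox a b \<subseteq> \<Omega>" for a b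
  proof -
    have bm: "box_bump a b n \<in> borel_measurable borel" for n
      by (intro borel_measurable_continuous_onI smooth_continuous_on smooth_box_bump)
    have "(\<lambda>n. LINT x|lborel. box_bump a b n x * g x) \<longlonglongrightarrow> (LINT x|lborel. indicator (box a b) x * g x)"
    proof (rule integral_dominated_convergence[where w = "\<lambda>x. \<bar>g x\<bar>"])
      show "AE x in lborel. (\<lambda>n. box_bump a b n x * g x) \<longlonglongrightarrow> indicator (box a b) x * g x"
        by (intro AE_I2 tendsto_mult box_bump_tendsto tendsto_const)
      show "AE x in lborel. norm (box_bump a b n x * g x) \<le> \<bar>g x\<bar>" for n
        by (intro AE_I2) (simp add: abs_mult box_bump_bounds mult_left_le_one_le)
      show "(\<lambda>x. box_bump a b n x * g x) \<in> borel_measurable lborel" for n using bm gm by simp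
    qed (use gi gm in auto)
    then show ?thesis
      using test'[OF box_bump_test_function[OF ab] bm] by (simp add: LIMSEQ_const_iff)
  qed
  \<comment> \<open>The box criterion is applied to g cut off to \<open>box a b\<close>: an
    arbitrary box meets this one in a box whose closure is still inside \<Omega>. The faces of the
    box are a null set.\<close>
  have cell: "AE x in lebesgue. x \<in> cbox a b \<longrightarrow> g x = 0" if ab: "cbox a b \<subseteq> \<Omega>" for a b
  proof -
    have "AE x in lborel. indicator (box a b) x * g x = 0"
    proof (rule AE_zero_of_box_integrals)
      show "integrable lborel (\<lambda>x. indicator (box a b) x * g x)"
        using gm by (intro Bochner_Integration.integrable_bound[OF gi]) (auto simp: indicator_def)
      fix c d :: "real^'n"
      obtain a' b' where ab': "box c d \<inter> box a b = box a' b'" using box_Int_box by blast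
      have "(LINT x|lborel. indicator (box c d) x * (indicator (box a b) x * g x))
          = (LINT x|lborel. indicator (box a' b') x * g x)"
        unfolding ab'[symmetric] by (intro Bochner_Integration.integral_cong) (auto simp: indicator_def)
      also have "\<dots> = 0"
      proof (cases "box a' b' = {}")
        case False
        have "cbox a' b' = closure (box a' b')" using False by (simp add: closure_box)
        also have "\<dots> \<subseteq> cbox a b" using ab' box_subset_cbox by (intro closure_minimal) auto
        finally show ?thesis using ab by (intro sub) auto
      qed simp
      finally show "(LINT x|lborel. indicator (box c d) x * (indicator (box a b) x * g x)) = 0" .
    qed
    then have "AE x in lebesgue. indicator (box a b) x * g x = 0" by (simp add: AE_completion)
    moreover have "AE x in lebesgue. x \<notin> cbox a b - box a b"
      using negligible_frontier_interval[of a b] by (intro AE_not_in) (simp add: negligible_iff_null_sets)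
    ultimately show ?thesis by eventually_elim (auto simp: indicator_def)
  qed
  obtain \<D> where D: "countable \<D>" "\<D> \<subseteq> Pow \<Omega>" "\<And>X. X \<in> \<D> \<Longrightarrow> \<exists>a b. X = cbox a b" "\<Union>\<D> = \<Omega>"
    using open_countable_Union_open_cbox[OF \<Omega>] by blast
  have "AE x in lebesgue. \<forall>X\<in>\<D>. x \<in> X \<longrightarrow> g x = 0"
    unfolding AE_ball_countable[OF D(1)]
  proof
    fix X assume "X \<in> \<D>"
    then obtain a b where "X = cbox a b" "cbox a b \<subseteq> \<Omega>" using D by blast
    then show "AE x in lebesgue. x \<in> X \<longrightarrow> g x = 0" using cell by simp
  qed
  with kg have "AE x in lebesgue. x \<in> \<Omega> \<longrightarrow> h x = 0"
  proof eventually_elim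
    case (elim x) then show ?case using D(4) by (auto simp: k_def indicator_def)
  qed
  then show ?thesis using \<Omega>m by (subst AE_restrict_space_iff) auto
qed

lemma square_integrable_lebesgue_on:
  fixes f :: "'a::euclidean_space \<Rightarrow> 'b::euclidean_space"
  assumes "continuous_on K f" "compact K" "S \<in> sets lebesgue" "S \<subseteq> K"
  shows "square_integrable (lebesgue_on S) f"
  unfolding square_integrable_def
proof
  show m: "f \<in> borel_measurable (lebesgue_on S)"
    using assms by (intro continuous_imp_measurable_on_sets_lebesgue) (auto intro: continuous_on_subset)
  have "bounded (f ` K)" using assms(1,2) by (intro compact_imp_bounded compact_continuous_image)
  then obtain B where "\<forall>y\<in>f ` K. norm y \<le> B" unfolding bounded_iff by blast
  then have B: "norm (f x) \<le> B" if "x \<in> S" for x using that assms(4) by auto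
  have "emeasure (lebesgue_on S) (space (lebesgue_on S)) \<noteq> \<infinity>"
  proof -
    have "emeasure (lebesgue_on S) (space (lebesgue_on S)) = emeasure lebesgue S"
      using assms(3) by (simp add: emeasure_restrict_space space_restrict_space)
    also have "\<dots> \<le> emeasure lebesgue K"
      using assms(2) by (intro emeasure_mono[OF assms(4)]) (auto dest: compact_imp_closed)
    also have "\<dots> < \<infinity>" using emeasure_compact_finite[OF assms(2)] assms(2) by (simp add: borel_compact)
    finally show ?thesis by simp
  qed
  then interpret finite_measure "lebesgue_on S" by (rule finite_measureI)
  show "integrable (lebesgue_on S) (\<lambda>x. (norm (f x))\<^sup>2)"
  proof (rule integrable_const_bound[of _ "B\<^sup>2"])
    show "AE x in lebesgue_on S. norm ((norm (f x))\<^sup>2) \<le> B\<^sup>2"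
      using B by (intro AE_I2) (auto intro!: power_mono simp: space_restrict_space)
  qed (use m in measurable)
qed

lemma square_integrable_component:
  assumes "square_integrable M (J :: _ \<Rightarrow> real^3^3)" shows "square_integrable M (\<lambda>x. J x $ i $ j)"
  unfolding square_integrable_def
proof
  have [measurable]: "J \<in> borel_measurable M" using assms by (rule square_integrable_measurable)
  show m: "(\<lambda>x. J x $ i $ j) \<in> borel_measurable M"
    by (intro measurable_compose[OF \<open>J \<in> borel_measurable M\<close>] borel_measurable_continuous_onI continuous_intros)
  have le: "\<bar>J x $ i $ j\<bar> \<le> norm (J x)" for x
    using component_le_norm_cart[of "J x $ i" j] Finite_Cartesian_Product.norm_nth_le[of "J x" i] by simp
  show "integrable M (\<lambda>x. (norm (J x $ i $ j))\<^sup>2)"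
  proof (rule Bochner_Integration.integrable_bound[of _ "\<lambda>x. (norm (J x))\<^sup>2"])
    show "AE x in M. norm ((norm (J x $ i $ j))\<^sup>2) \<le> norm ((norm (J x))\<^sup>2)"
      using power_mono[OF le, of _ 2] by (intro AE_I2) simp
  qed (use assms m in \<open>auto simp: square_integrable_def\<close>)
qed

section \<open>Domains with a boundary estimate for integrals of derivatives\<close>

text \<open>The interface through which the boundary enters from here on: finite area, and the
  estimate of the integral of a directional derivative by the boundary values. The functions live on
  a ball that contains the closure of the domain.\<close>

locale regular_domain =
  fixes \<Omega> :: "(real^3) set" and R C :: real
  assumes open_\<Omega>: "open \<Omega>" and closure_\<Omega>: "closure \<Omega> \<subseteq> ball 0 R"
    and finite_area: "hausdorff2_outer (frontier \<Omega>) < \<infinity>"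
    and integral_partial_le: "\<And>f g e. continuous_on (cball 0 R) f \<Longrightarrow> continuous_on (cball 0 R) g \<Longrightarrow> norm e = 1 \<Longrightarrow>
      (\<And>x. x \<in> ball 0 R \<Longrightarrow> ((\<lambda>s. f (x + s *\<^sub>R e)) has_real_derivative g x) (at 0)) \<Longrightarrow>
      \<bar>LINT x|lebesgue_on \<Omega>. g x\<bar> \<le> C * (LINT y|surface_measure \<Omega>. \<bar>f y\<bar>)"
begin

lemma \<Omega>_measurable: "\<Omega> \<in> sets lebesgue" using open_\<Omega> by auto

lemma \<Omega>_ball: "\<Omega> \<subseteq> ball 0 R" and \<Omega>_cball: "\<Omega> \<subseteq> cball 0 R" and frontier_cball: "frontier \<Omega> \<subseteq> cball 0 R"
  using closure_\<Omega> closure_subset[of \<Omega>] ball_subset_cball[of 0 R] by (auto simp: frontier_def)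

lemma bounded_\<Omega>: "bounded \<Omega>" using \<Omega>_ball bounded_subset bounded_ball by blast

sublocale surf: finite_measure "surface_measure \<Omega>"
  using finite_measure_surface_measure[OF finite_area] .

lemma square_integrable_\<Omega>:
  fixes f :: "real^3 \<Rightarrow> 'b::euclidean_space"
  shows "continuous_on (cball 0 R) f \<Longrightarrow> square_integrable (lebesgue_on \<Omega>) f"
  by (rule square_integrable_lebesgue_on[OF _ compact_cball \<Omega>_measurable \<Omega>_cball])

sublocale dom: finite_measure "lebesgue_on \<Omega>"
proof -
  have "square_integrable (lebesgue_on \<Omega>) (\<lambda>x. 1 :: real)"
    by (rule square_integrable_\<Omega>) (rule continuous_on_const)
  then have "integrable (lebesgue_on \<Omega>) (\<lambda>x. 1 :: real)" by (simp add: square_integrable_def)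
  then show "finite_measure (lebesgue_on \<Omega>)" by (intro finite_measureI) (simp add: integrable_iff_bounded less_top)
qed

lemma square_integrable_surface:
  fixes f :: "real^3 \<Rightarrow> 'b::euclidean_space"
  assumes "continuous_on (cball 0 R) f" shows "square_integrable (surface_measure \<Omega>) f"
proof -
  have c: "continuous_on (frontier \<Omega>) f" using assms frontier_cball continuous_on_subset by blast
  then have "f \<in> borel_measurable (restrict_space borel (frontier \<Omega>))"
    by (rule borel_measurable_continuous_on_restrict)
  then have "f \<in> borel_measurable (surface_measure \<Omega>)"
    using measurable_cong_sets[OF sets_surface_measure refl] by blast
  moreover have "integrable (surface_measure \<Omega>) (\<lambda>x. (norm (f x))\<^sup>2)"
    by (rule integrable_surface_measure_continuous[OF finite_area bounded_\<Omega>]) (intro continuous_intros c)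
  ultimately show ?thesis by (simp add: square_integrable_def)
qed

lemma integrable_\<Omega>_square:
  fixes f :: "real^3 \<Rightarrow> real"
  assumes "square_integrable (lebesgue_on \<Omega>) f" shows "integrable (lebesgue_on \<Omega>) f"
  using integrable_inner_square_integrable[OF assms square_integrable_\<Omega>[of "\<lambda>x. 1 :: real"]] by simp

text \<open>Integration by parts against a test function is the case of vanishing boundary values in
  \<open>integral_partial_le\<close>.\<close>

lemma has_L2_jacobian_classical:
  fixes u :: "real^3 \<Rightarrow> real^3" and J :: "real^3 \<Rightarrow> real^3^3"
  assumes u: "continuous_on (cball 0 R) u" and J: "continuous_on (cball 0 R) J"
    and d: "\<And>x. x \<in> ball 0 R \<Longrightarrow> (u has_derivative (\<lambda>h. J x *v h)) (at x)"
  shows "has_L2_jacobian \<Omega> u J"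
  unfolding has_L2_jacobian_def
proof (intro conjI ballI allI)
  show "square_integrable (lebesgue_on \<Omega>) u" "square_integrable (lebesgue_on \<Omega>) J"
    using u J by (auto intro: square_integrable_\<Omega>)
  fix \<phi> and i j :: 3 assume "\<phi> \<in> test_functions \<Omega>"
  then obtain K where K: "smooth \<phi>" "K \<subseteq> \<Omega>" "\<And>x. x \<notin> K \<Longrightarrow> \<phi> x = 0" by (auto simp: test_functions_def)
  have \<phi>d: "\<phi> differentiable (at x)" "partial_deriv j \<phi> differentiable (at x)" for x
    using smooth_differentiable[OF K(1)] smooth_differentiable[OF smooth_partial_deriv[OF K(1)]] by auto
  have \<phi>c: "continuous_on S \<phi>" "continuous_on S (partial_deriv j \<phi>)" for S
    using K(1) smooth_continuous_on smooth_partial_deriv by auto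
  let ?e = "axis j 1 :: real^3"
  have c1: "continuous_on (cball 0 R) (\<lambda>x. u x $ i * partial_deriv j \<phi> x)"
    and c2: "continuous_on (cball 0 R) (\<lambda>x. J x $ i $ j * \<phi> x)"
    and c3: "continuous_on (cball 0 R) (\<lambda>x. u x $ i * \<phi> x)"
    by (intro continuous_intros u J \<phi>c)+
  have "\<bar>LINT x|lebesgue_on \<Omega>. u x $ i * partial_deriv j \<phi> x + J x $ i $ j * \<phi> x\<bar>
      \<le> C * (LINT y|surface_measure \<Omega>. \<bar>u y $ i * \<phi> y\<bar>)"
  proof (rule integral_partial_le[where e = "axis j 1"])
    fix x :: "real^3" assume x: "x \<in> ball 0 R"
    have l: "((\<lambda>s. x + s *\<^sub>R ?e) has_derivative (\<lambda>s. s *\<^sub>R ?e)) (at 0)"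
      by (auto intro!: derivative_eq_intros)
    have "((\<lambda>s. u (x + s *\<^sub>R ?e)) has_derivative (\<lambda>s. J x *v (s *\<^sub>R ?e))) (at 0)"
      by (rule has_derivative_compose[OF l]) (simp add: d[OF x])
    then have 1: "((\<lambda>s. u (x + s *\<^sub>R ?e) $ i) has_derivative (\<lambda>s. (J x *v (s *\<^sub>R ?e)) $ i)) (at 0)"
      by (rule bounded_linear.has_derivative[OF bounded_linear_vec_nth])
    have 2: "((\<lambda>s. \<phi> (x + s *\<^sub>R ?e)) has_derivative (\<lambda>s. frechet_derivative \<phi> (at x) (s *\<^sub>R ?e))) (at 0)"
      by (rule has_derivative_compose[OF l]) (use \<phi>d(1)[of x] in \<open>simp add: frechet_derivative_works\<close>)
    have lin: "frechet_derivative \<phi> (at x) (s *\<^sub>R ?e) = s * partial_deriv j \<phi> x" for s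
      using linear_cmul[OF linear_frechet_derivative[OF \<phi>d(1)[of x]]] by (simp add: partial_deriv_def)
    have mv: "(J x *v (s *\<^sub>R ?e)) $ i = s * J x $ i $ j" for s
      by (simp add: matrix_vector_mult_scaleR matrix_vector_mul_component inner_axis)
    have "((\<lambda>s. u (x + s *\<^sub>R ?e) $ i * \<phi> (x + s *\<^sub>R ?e)) has_derivative
      (\<lambda>s. u x $ i * (s * partial_deriv j \<phi> x) + (s * J x $ i $ j) * \<phi> x)) (at 0)"
      using has_derivative_mult[OF 1 2] by (simp add: lin mv)
    then show "((\<lambda>s. u (x + s *\<^sub>R ?e) $ i * \<phi> (x + s *\<^sub>R ?e)) has_real_derivative
        u x $ i * partial_deriv j \<phi> x + J x $ i $ j * \<phi> x) (at 0)"
      unfolding has_field_derivative_def by (rule has_derivative_eq_rhs) (simp add: fun_eq_iff algebra_simps)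
  qed (use c1 c2 c3 in \<open>auto intro: continuous_on_add\<close>)
  also have "(LINT y|surface_measure \<Omega>. \<bar>u y $ i * \<phi> y\<bar>) = (LINT y|surface_measure \<Omega>. 0)"
  proof (rule Bochner_Integration.integral_cong[OF refl])
    fix y assume "y \<in> space (surface_measure \<Omega>)"
    then have "y \<notin> \<Omega>" using open_\<Omega> by (auto simp: frontier_def interior_open)
    then show "\<bar>u y $ i * \<phi> y\<bar> = 0" using K by auto
  qed
  finally have "(LINT x|lebesgue_on \<Omega>. u x $ i * partial_deriv j \<phi> x + J x $ i $ j * \<phi> x) = 0" by simp
  then show "(LINT x|lebesgue_on \<Omega>. u x $ i * partial_deriv j \<phi> x) = - (LINT x|lebesgue_on \<Omega>. J x $ i $ j * \<phi> x)"
    using integrable_\<Omega>_square[OF square_integrable_\<Omega>[OF c1]] integrable_\<Omega>_square[OF square_integrable_\<Omega>[OF c2]]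
    by simp
qed

text \<open>Links the choice made in \<open>weak_jacobian\<close> to a Jacobian known explicitly:
  each entry of the difference of two weak Jacobians integrates to zero against all test
  functions.\<close>

lemma weak_jacobian_unique:
  assumes J: "has_L2_jacobian \<Omega> u J"
  shows "AE x in lebesgue_on \<Omega>. weak_jacobian \<Omega> u x = J x"
proof -
  let ?W = "weak_jacobian \<Omega> u"
  have W: "has_L2_jacobian \<Omega> u ?W" unfolding weak_jacobian_def by (rule someI[of "has_L2_jacobian \<Omega> u", OF J])
  have "AE x in lebesgue_on \<Omega>. ?W x $ i $ j - J x $ i $ j = 0" for i j
  proof (rule AE_zero_of_test_functions[OF open_\<Omega>])
    have sq: "square_integrable (lebesgue_on \<Omega>) (\<lambda>x. ?W x $ i $ j)" "square_integrable (lebesgue_on \<Omega>) (\<lambda>x. J x $ i $ j)"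
      using J W by (auto intro!: square_integrable_component simp: has_L2_jacobian_def)
    then show "integrable (lebesgue_on \<Omega>) (\<lambda>x. ?W x $ i $ j - J x $ i $ j)"
      using integrable_\<Omega>_square by simp
    fix \<phi> assume \<phi>: "\<phi> \<in> test_functions \<Omega>"
    then have "smooth \<phi>" by (simp add: test_functions_def)
    then have "continuous_on (cball 0 R) \<phi>" by (rule smooth_continuous_on)
    then have s\<phi>: "square_integrable (lebesgue_on \<Omega>) \<phi>" by (rule square_integrable_\<Omega>)
    have "(LINT x|lebesgue_on \<Omega>. ?W x $ i $ j * \<phi> x) = (LINT x|lebesgue_on \<Omega>. J x $ i $ j * \<phi> x)"
    proof -
      have "(LINT x|lebesgue_on \<Omega>. u x $ i * partial_deriv j \<phi> x) = - (LINT x|lebesgue_on \<Omega>. ?W x $ i $ j * \<phi> x)"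
        using W \<phi> by (simp add: has_L2_jacobian_def)
      moreover have "(LINT x|lebesgue_on \<Omega>. u x $ i * partial_deriv j \<phi> x) = - (LINT x|lebesgue_on \<Omega>. J x $ i $ j * \<phi> x)"
        using J \<phi> by (simp add: has_L2_jacobian_def)
      ultimately show ?thesis by linarith
    qed
    then show "(LINT x|lebesgue_on \<Omega>. (?W x $ i $ j - J x $ i $ j) * \<phi> x) = 0"
      using integrable_inner_square_integrable[OF sq(1) s\<phi>] integrable_inner_square_integrable[OF sq(2) s\<phi>]
      by (simp add: left_diff_distrib)
  qed
  then have "AE x in lebesgue_on \<Omega>. \<forall>i\<in>UNIV. \<forall>j\<in>UNIV. ?W x $ i $ j - J x $ i $ j = 0"
    by (intro AE_finite_allI) auto
  then show ?thesis by eventually_elim (auto simp: vec_eq_iff)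
qed

end

section \<open>Boundary loads of divergence-free stresses\<close>

text \<open>The normal equations for projecting u onto the functions \<open>r p\<close> read
  \<open>T p = l\<close>, with \<open>T\<close> the Gram operator. \<open>T\<close> may be singular,
  so solvability needs an argument: if z is the component of l orthogonal to the range of
  \<open>T\<close>, then \<open>r z\<close> has norm zero, hence \<open>L z = 0\<close> and z =
  0.\<close>

lemma L2_projection_exists:
  fixes r :: "'e::euclidean_space \<Rightarrow> 'a \<Rightarrow> 'b::euclidean_space"
  assumes lin: "\<And>x. linear (\<lambda>p. r p x)" and sq: "\<And>p. square_integrable M (r p)" and u: "square_integrable M u"
  shows "\<exists>p. \<forall>q. (LINT x|M. (u x - r p x) \<bullet> r q x) = 0"
proof -
  define b where "b p q = (LINT x|M. r p x \<bullet> r q x)" for p q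
  define L where "L q = (LINT x|M. u x \<bullet> r q x)" for q
  note int = integrable_inner_square_integrable[OF sq sq] integrable_inner_square_integrable[OF u sq]
  have lin_b2: "linear (b p)" for p
    unfolding b_def[abs_def] using int
    by (intro linearI) (simp_all add: linear_add[OF lin] linear_cmul[OF lin] inner_add_right)
  have lin_L: "linear L"
    unfolding L_def[abs_def] using int
    by (intro linearI) (simp_all add: linear_add[OF lin] linear_cmul[OF lin] inner_add_right)
  have b_sym: "b p q = b q p" for p q by (simp add: b_def inner_commute)
  have repr: "(\<Sum>e\<in>Basis. F e *\<^sub>R e) \<bullet> q = F q" if F: "linear F" for F :: "'e \<Rightarrow> real" and q
  proof -
    have "F q = F (\<Sum>e\<in>Basis. (q \<bullet> e) *\<^sub>R e)" by (simp add: euclidean_representation)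
    also have "\<dots> = (\<Sum>e\<in>Basis. (q \<bullet> e) * F e)" by (simp add: linear_sum[OF F] linear_cmul[OF F])
    also have "\<dots> = (\<Sum>e\<in>Basis. F e *\<^sub>R e) \<bullet> q" by (simp add: inner_commute[of _ q] inner_sum_right mult.commute)
    finally show ?thesis by simp
  qed
  define T where "T p = (\<Sum>e\<in>Basis. b p e *\<^sub>R e)" for p
  define l where "l = (\<Sum>e\<in>Basis. L e *\<^sub>R e)"
  have T: "T p \<bullet> q = b p q" for p q unfolding T_def using repr[OF lin_b2] .
  have l: "l \<bullet> q = L q" for q unfolding l_def using repr[OF lin_L] .
  have "linear T"
  proof (intro linearI)
    fix p q c
    have "T (p + q) \<bullet> w = (T p + T q) \<bullet> w" for w
      unfolding inner_add_left T by (simp add: b_sym[of _ w] linear_add[OF lin_b2])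
    then show "T (p + q) = T p + T q" using vector_eq_rdot by blast
    have "T (c *\<^sub>R p) \<bullet> w = (c *\<^sub>R T p) \<bullet> w" for w
      unfolding inner_scaleR_left T by (simp add: b_sym[of _ w] linear_cmul[OF lin_b2])
    then show "T (c *\<^sub>R p) = c *\<^sub>R T p" using vector_eq_rdot by blast
  qed
  then have sub: "subspace (range T)" by (rule linear_subspace_image[OF _ subspace_UNIV])
  obtain y z where yz: "y \<in> span (range T)" "\<And>w. w \<in> span (range T) \<Longrightarrow> orthogonal z w" "l = y + z"
    using orthogonal_subspace_decomp_exists[of "range T" l] by metis
  have span: "span (range T) = range T" using sub by (simp add: span_eq_iff)
  have "b z z = 0" using yz(2)[of "T z"] T[of z z] span by (simp add: orthogonal_def inner_commute)
  then have "L2_norm M (r z) = 0" by (simp add: b_def L2_norm_def power2_norm_eq_inner)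
  then have "L z = 0" using L2_Cauchy_Schwarz[OF u sq, of z] by (simp add: L_def)
  moreover have "z \<bullet> y = 0" using yz(2)[OF yz(1)] by (simp add: orthogonal_def)
  ultimately have "z \<bullet> z = 0" using l[of z] yz(3) by (simp add: inner_add_left inner_commute[of y])
  then have "l \<in> range T" using yz span by simp
  then obtain p where p: "l = T p" by auto
  have "(LINT x|M. (u x - r p x) \<bullet> r q x) = 0" for q
  proof -
    have "(LINT x|M. (u x - r p x) \<bullet> r q x) = L q - b p q"
      using int by (simp add: inner_diff_left L_def b_def)
    then show ?thesis using T[of p q] l[of q] p by simp
  qed
  then show ?thesis by blast
qed

section \<open>Smooth vector fields and their Jacobian matrices\<close>

definition smooth_field :: "(real^'n::finite \<Rightarrow> real^'m::finite) \<Rightarrow> bool" where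
  "smooth_field \<phi> \<longleftrightarrow> (\<forall>i. smooth (\<lambda>x. \<phi> x $ i))"

definition jacobian_matrix :: "(real^'n::finite \<Rightarrow> real^'m::finite) \<Rightarrow> real^'n \<Rightarrow> real^'n^'m" where
  "jacobian_matrix \<phi> x = (\<chi> i k. partial_deriv k (\<lambda>x. \<phi> x $ i) x)"

lemma jacobian_matrix_nth [simp]: "jacobian_matrix \<phi> x $ i $ k = partial_deriv k (\<lambda>x. \<phi> x $ i) x"
  by (simp add: jacobian_matrix_def)

lemma partial_deriv_along:
  assumes "f differentiable (at x)"
  shows "((\<lambda>s. f (x + s *\<^sub>R axis k 1)) has_real_derivative partial_deriv k f x) (at 0)"
proof -
  have l: "((\<lambda>s. x + s *\<^sub>R axis k 1) has_derivative (\<lambda>s. s *\<^sub>R axis k 1)) (at 0)"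
    by (auto intro!: derivative_eq_intros)
  have "((\<lambda>s. f (x + s *\<^sub>R axis k 1)) has_derivative (\<lambda>s. frechet_derivative f (at x) (s *\<^sub>R axis k 1))) (at 0)"
    by (rule has_derivative_compose[OF l]) (use assms in \<open>simp add: frechet_derivative_works\<close>)
  moreover have "frechet_derivative f (at x) (s *\<^sub>R axis k 1) = partial_deriv k f x * s" for s
    using linear_cmul[OF linear_frechet_derivative[OF assms]] by (simp add: partial_deriv_def)
  ultimately show ?thesis by (simp add: has_field_derivative_def)
qed

lemma smooth_field_jacobian:
  assumes "smooth_field \<phi>"
  shows "matrix (frechet_derivative \<phi> (at x)) = jacobian_matrix \<phi> x"
proof -
  have d: "(\<lambda>x. \<phi> x $ i) differentiable (at x)" for i
    using assms smooth_differentiable by (auto simp: smooth_field_def)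
  have "(\<phi> has_derivative (\<lambda>h. \<chi> i. frechet_derivative (\<lambda>x. \<phi> x $ i) (at x) h)) (at x)"
    unfolding has_derivative_componentwise_within[of \<phi> _ x UNIV]
    using d by (auto simp: Basis_vec_def inner_axis frechet_derivative_works)
  then have "frechet_derivative \<phi> (at x) = (\<lambda>h. \<chi> i. frechet_derivative (\<lambda>x. \<phi> x $ i) (at x) h)"
    by (rule frechet_derivative_at[symmetric])
  then show ?thesis by (simp add: vec_eq_iff matrix_def partial_deriv_def)
qed

lemma smooth_field_continuous_on:
  assumes "smooth_field \<phi>" shows "continuous_on S \<phi>"
proof -
  have "continuous_on S (\<lambda>x. \<chi> i. \<phi> x $ i)"
    using assms by (intro continuous_on_vec_lambda smooth_continuous_on) (auto simp: smooth_field_def)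
  then show ?thesis by simp
qed

lemma smooth_field_jacobian_continuous_on:
  assumes "smooth_field \<phi>" shows "continuous_on S (jacobian_matrix \<phi>)"
  unfolding jacobian_matrix_def[abs_def]
  using assms by (intro continuous_on_vec_lambda smooth_continuous_on smooth_partial_deriv) (auto simp: smooth_field_def)

lemma smooth_field_add: "smooth_field \<phi> \<Longrightarrow> smooth_field \<psi> \<Longrightarrow> smooth_field (\<lambda>x. \<phi> x + \<psi> x)"
  and smooth_field_scaleR: "smooth_field \<phi> \<Longrightarrow> smooth_field (\<lambda>x. c *\<^sub>R \<phi> x)"
  by (auto simp: smooth_field_def)

lemma has_derivative_smooth_component:
  "smooth_field \<phi> \<Longrightarrow> ((\<lambda>x. \<phi> x $ i) has_derivative frechet_derivative (\<lambda>x. \<phi> x $ i) (at x)) (at x)"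
  using smooth_differentiable unfolding smooth_field_def frechet_derivative_works[symmetric] by blast

lemma jacobian_matrix_add:
  assumes "smooth_field \<phi>" "smooth_field \<psi>"
  shows "jacobian_matrix (\<lambda>x. \<phi> x + \<psi> x) x = jacobian_matrix \<phi> x + jacobian_matrix \<psi> x"
  using partial_deriv_eqI[OF has_derivative_add[OF assms[THEN has_derivative_smooth_component]]]
  by (simp add: vec_eq_iff partial_deriv_def)

lemma jacobian_matrix_scaleR:
  assumes "smooth_field \<phi>"
  shows "jacobian_matrix (\<lambda>x. c *\<^sub>R \<phi> x) x = c *\<^sub>R jacobian_matrix \<phi> x"
  using partial_deriv_eqI[OF has_derivative_mult_right[OF assms[THEN has_derivative_smooth_component]]]
  by (simp add: vec_eq_iff partial_deriv_def)

lemma inner_matrix_eq: "(A :: real^'n^'m) \<bullet> B = (\<Sum>i\<in>UNIV. \<Sum>k\<in>UNIV. A $ i $ k * B $ i $ k)"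
  by (simp add: inner_vec_def)

lemma inner_transpose: "transpose (A :: real^'n^'m) \<bullet> transpose B = A \<bullet> B"
  unfolding inner_matrix_eq transpose_def by (subst sum.swap) simp

context regular_domain
begin

text \<open>By the product rule the k-th derivative of \<sigma>_ik \<phi>_i is \<sigma>_ik times the
  k-th derivative of \<phi>_i plus \<tau>_ik \<phi>_i, and the second terms cancel in the sum over k
  by \<open>div\<close>. The boundary estimate for each product, followed by Cauchy-Schwarz, bounds
  the pairing by the boundary norm of \<phi>; in particular it depends only on boundary
  values.\<close>

lemma traction_exists:
  fixes \<sigma> :: "real^3 \<Rightarrow> real^3^3"
  assumes \<sigma>: "continuous_on (cball 0 R) \<sigma>" and \<tau>: "\<And>i k. continuous_on (cball 0 R) (\<tau> i k)"
    and d: "\<And>x i k. x \<in> ball 0 R \<Longrightarrow> ((\<lambda>s. \<sigma> (x + s *\<^sub>R axis k 1) $ i $ k) has_real_derivative \<tau> i k x) (at 0)"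
    and div: "\<And>x i. x \<in> ball 0 R \<Longrightarrow> (\<Sum>k\<in>UNIV. \<tau> i k x) = 0"
  obtains g where "square_integrable (surface_measure \<Omega>) g"
    "\<And>\<phi>. smooth_field \<phi> \<Longrightarrow> (LINT x|lebesgue_on \<Omega>. \<sigma> x \<bullet> jacobian_matrix \<phi> x) = (LINT x|surface_measure \<Omega>. g x \<bullet> \<phi> x)"
proof -
  let ?\<Omega> = "lebesgue_on \<Omega>" and ?M = "surface_measure \<Omega>"
  define l where "l \<phi> = (LINT x|?\<Omega>. \<sigma> x \<bullet> jacobian_matrix \<phi> x)" for \<phi>
  define B where "B = (\<Sum>i\<in>(UNIV :: 3 set). \<Sum>k\<in>(UNIV :: 3 set). \<bar>C\<bar> * L2_norm ?M (\<lambda>y. \<bar>\<sigma> y $ i $ k\<bar>))"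
  have \<sigma>sq: "square_integrable ?\<Omega> \<sigma>" using \<sigma> by (rule square_integrable_\<Omega>)
  have Jsq: "square_integrable ?\<Omega> (jacobian_matrix \<phi>)" if "smooth_field \<phi>" for \<phi> :: "real^3 \<Rightarrow> real^3"
    using that by (intro square_integrable_\<Omega> smooth_field_jacobian_continuous_on)
  have \<sigma>c: "continuous_on S (\<lambda>x. \<sigma> x $ i $ k)" if "S \<subseteq> cball 0 R" for S i k
    by (intro continuous_intros continuous_on_subset[OF \<sigma> that])
  have bound: "\<bar>l \<phi>\<bar> \<le> B * L2_norm ?M \<phi>" if \<phi>: "smooth_field \<phi>" for \<phi>
  proof -
    have \<phi>s: "smooth (\<lambda>x. \<phi> x $ i)" for i using \<phi> by (simp add: smooth_field_def)
    note \<phi>c = smooth_continuous_on[OF \<phi>s] and p\<phi>c = smooth_continuous_on[OF smooth_partial_deriv[OF \<phi>s]]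
    have c1: "continuous_on (cball 0 R) (\<lambda>x. \<sigma> x $ i $ k * partial_deriv k (\<lambda>x. \<phi> x $ i) x)" for i k
      by (intro continuous_intros \<sigma>c p\<phi>c) simp
    have c2: "continuous_on (cball 0 R) (\<lambda>x. \<tau> i k x * \<phi> x $ i)" for i k
      by (intro continuous_on_mult \<tau> \<phi>c)
    note i1 = integrable_\<Omega>_square[OF square_integrable_\<Omega>[OF c1]] and i2 = integrable_\<Omega>_square[OF square_integrable_\<Omega>[OF c2]]
    have zero: "(\<Sum>i\<in>UNIV. \<Sum>k\<in>UNIV. (LINT x|?\<Omega>. \<tau> i k x * \<phi> x $ i)) = 0"
    proof -
      have "(\<Sum>k\<in>UNIV. (LINT x|?\<Omega>. \<tau> i k x * \<phi> x $ i)) = 0" for i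
      proof -
        have "(\<Sum>k\<in>UNIV. (LINT x|?\<Omega>. \<tau> i k x * \<phi> x $ i)) = (LINT x|?\<Omega>. (\<Sum>k\<in>UNIV. \<tau> i k x * \<phi> x $ i))"
          using i2 by (subst Bochner_Integration.integral_sum) auto
        also have "\<dots> = (LINT x|?\<Omega>. 0)"
        proof (rule Bochner_Integration.integral_cong[OF refl])
          fix x assume "x \<in> space ?\<Omega>"
          then have "x \<in> ball 0 R" using \<Omega>_ball by (auto simp: space_restrict_space)
          then show "(\<Sum>k\<in>UNIV. \<tau> i k x * \<phi> x $ i) = 0" by (simp add: div flip: sum_distrib_right)
        qed
        finally show ?thesis by simp
      qed
      then show ?thesis by simp
    qed
    have "l \<phi> = (\<Sum>i\<in>UNIV. \<Sum>k\<in>UNIV. (LINT x|?\<Omega>. \<sigma> x $ i $ k * partial_deriv k (\<lambda>x. \<phi> x $ i) x))"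
      unfolding l_def inner_matrix_eq jacobian_matrix_nth
      using i1 by (simp add: Bochner_Integration.integral_sum)
    \<comment> \<open>Adding terms whose sum is zero completes every summand to a full
      derivative.\<close>
    also have "\<dots> = (\<Sum>i\<in>UNIV. \<Sum>k\<in>UNIV. (LINT x|?\<Omega>. \<sigma> x $ i $ k * partial_deriv k (\<lambda>x. \<phi> x $ i) x + \<tau> i k x * \<phi> x $ i))"
      using i1 i2 zero by (simp add: sum.distrib)
    finally have eq: "l \<phi> = (\<Sum>i\<in>UNIV. \<Sum>k\<in>UNIV. (LINT x|?\<Omega>. \<sigma> x $ i $ k * partial_deriv k (\<lambda>x. \<phi> x $ i) x + \<tau> i k x * \<phi> x $ i))" .
    have "\<bar>l \<phi>\<bar> \<le> (\<Sum>i\<in>UNIV. \<Sum>k\<in>UNIV. \<bar>LINT x|?\<Omega>. \<sigma> x $ i $ k * partial_deriv k (\<lambda>x. \<phi> x $ i) x + \<tau> i k x * \<phi> x $ i\<bar>)"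
      unfolding eq by (rule order.trans[OF sum_abs sum_mono]) (rule sum_abs)
    also have "\<dots> \<le> (\<Sum>i\<in>UNIV. \<Sum>k\<in>UNIV. \<bar>C\<bar> * L2_norm ?M (\<lambda>y. \<bar>\<sigma> y $ i $ k\<bar>) * L2_norm ?M \<phi>)"
    proof (intro sum_mono)
      fix i k :: 3
      have "\<bar>LINT x|?\<Omega>. \<sigma> x $ i $ k * partial_deriv k (\<lambda>x. \<phi> x $ i) x + \<tau> i k x * \<phi> x $ i\<bar>
          \<le> C * (LINT y|?M. \<bar>\<sigma> y $ i $ k * \<phi> y $ i\<bar>)"
      proof (rule integral_partial_le[where e = "axis k 1"])
        show "continuous_on (cball 0 R) (\<lambda>x. \<sigma> x $ i $ k * \<phi> x $ i)"
          by (intro continuous_on_mult \<sigma>c \<phi>c) simp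
        show "continuous_on (cball 0 R) (\<lambda>x. \<sigma> x $ i $ k * partial_deriv k (\<lambda>x. \<phi> x $ i) x + \<tau> i k x * \<phi> x $ i)"
          by (intro continuous_on_add c1 c2)
        fix x :: "real^3" assume x: "x \<in> ball 0 R"
        show "((\<lambda>s. \<sigma> (x + s *\<^sub>R axis k 1) $ i $ k * \<phi> (x + s *\<^sub>R axis k 1) $ i) has_real_derivative
          \<sigma> x $ i $ k * partial_deriv k (\<lambda>x. \<phi> x $ i) x + \<tau> i k x * \<phi> x $ i) (at 0)"
          using DERIV_mult[OF d[OF x, of k i] partial_deriv_along[OF smooth_differentiable[OF \<phi>s[of i]], where k = k and x = x]]
          by (simp add: algebra_simps)
      qed simp
      also have "\<dots> \<le> \<bar>C\<bar> * (LINT y|?M. \<bar>\<sigma> y $ i $ k * \<phi> y $ i\<bar>)"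
        by (intro mult_right_mono integral_nonneg_AE) auto
      also have "(LINT y|?M. \<bar>\<sigma> y $ i $ k * \<phi> y $ i\<bar>) \<le> L2_norm ?M (\<lambda>y. \<bar>\<sigma> y $ i $ k\<bar>) * L2_norm ?M (\<lambda>y. \<bar>\<phi> y $ i\<bar>)"
      proof -
        have "\<bar>LINT y|?M. \<bar>\<sigma> y $ i $ k\<bar> \<bullet> \<bar>\<phi> y $ i\<bar>\<bar> \<le> L2_norm ?M (\<lambda>y. \<bar>\<sigma> y $ i $ k\<bar>) * L2_norm ?M (\<lambda>y. \<bar>\<phi> y $ i\<bar>)"
          by (intro L2_Cauchy_Schwarz square_integrable_surface continuous_on_rabs \<sigma>c \<phi>c) simp
        then show ?thesis by (simp add: abs_mult)
      qed
      also have "L2_norm ?M (\<lambda>y. \<bar>\<phi> y $ i\<bar>) \<le> L2_norm ?M \<phi>"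
        unfolding L2_norm_def
      proof (intro real_sqrt_le_mono integral_mono)
        show "integrable ?M (\<lambda>x. (norm \<bar>\<phi> x $ i\<bar>)\<^sup>2)" "integrable ?M (\<lambda>x. (norm (\<phi> x))\<^sup>2)"
          using square_integrable_surface[OF continuous_on_rabs[OF \<phi>c]]
            square_integrable_surface[OF smooth_field_continuous_on[OF \<phi>]]
          by (auto simp: square_integrable_def)
        show "(norm \<bar>\<phi> x $ i\<bar>)\<^sup>2 \<le> (norm (\<phi> x))\<^sup>2" for x
          by (intro power_mono) (auto simp: component_le_norm_cart)
      qed
      finally show "\<bar>LINT x|?\<Omega>. \<sigma> x $ i $ k * partial_deriv k (\<lambda>x. \<phi> x $ i) x + \<tau> i k x * \<phi> x $ i\<bar>
        \<le> \<bar>C\<bar> * L2_norm ?M (\<lambda>y. \<bar>\<sigma> y $ i $ k\<bar>) * L2_norm ?M \<phi>"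
        by (simp add: mult.assoc mult_left_mono L2_norm_nonneg)
    qed
    also have "\<dots> = B * L2_norm ?M \<phi>" by (simp add: B_def sum_distrib_right)
    finally show ?thesis .
  qed
  have int: "integrable ?\<Omega> (\<lambda>x. \<sigma> x \<bullet> jacobian_matrix \<phi> x)" if "smooth_field \<phi>" for \<phi> :: "real^3 \<Rightarrow> real^3"
    by (rule integrable_inner_square_integrable[OF \<sigma>sq Jsq[OF that]])
  show ?thesis
  proof (rule L2_Riesz_representation[of "Collect smooth_field" ?M l B])
    have "(\<lambda>x. 0) \<in> Collect (smooth_field :: (real^3 \<Rightarrow> real^3) \<Rightarrow> bool)" by (auto simp: smooth_field_def)
    then show "Collect (smooth_field :: (real^3 \<Rightarrow> real^3) \<Rightarrow> bool) \<noteq> {}" by blast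
    show "l (\<lambda>x. \<phi> x + \<psi> x) = l \<phi> + l \<psi>" if "\<phi> \<in> Collect smooth_field" "\<psi> \<in> Collect smooth_field" for \<phi> \<psi>
      using that int by (simp add: l_def jacobian_matrix_add inner_add_right)
    show "l (\<lambda>x. c *\<^sub>R \<phi> x) = c * l \<phi>" if "\<phi> \<in> Collect smooth_field" for \<phi> c
      using that by (simp add: l_def jacobian_matrix_scaleR)
    fix g assume "square_integrable ?M g" "\<And>\<phi>. \<phi> \<in> Collect smooth_field \<Longrightarrow> l \<phi> = (LINT x|?M. g x \<bullet> \<phi> x)"
    then show thesis by (intro that) (auto simp: l_def)
  qed (use bound in \<open>auto intro: smooth_field_add smooth_field_scaleR square_integrable_surface smooth_field_continuous_on\<close>)
qed

end

section \<open>Measurability of weak derivatives, and rigid motions\<close>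

lemma L2_norm_cong_AE:
  fixes f g :: "'a \<Rightarrow> 'b::euclidean_space"
  assumes "f \<in> borel_measurable M" "g \<in> borel_measurable M" "AE x in M. f x = g x"
  shows "L2_norm M f = L2_norm M g"
  unfolding L2_norm_def using assms by (intro arg_cong[where f = sqrt] integral_cong_AE) auto

lemma has_L2_weak_jacobian: "u \<in> H1 \<Omega> \<Longrightarrow> has_L2_jacobian \<Omega> u (weak_jacobian \<Omega> u)"
  unfolding H1_def weak_jacobian_def by (auto intro: someI[of "has_L2_jacobian \<Omega> u"])

lemma borel_measurable_weak_jacobian:
  "u \<in> H1 \<Omega> \<Longrightarrow> weak_jacobian \<Omega> u \<in> borel_measurable (lebesgue_on \<Omega>)"
  using has_L2_weak_jacobian by (auto simp: has_L2_jacobian_def square_integrable_def)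

lemma borel_measurable_weak_div:
  assumes "u \<in> H1 \<Omega>" shows "weak_div \<Omega> u \<in> borel_measurable (lebesgue_on \<Omega>)"
proof -
  have "(\<lambda>A :: real^3^3. trace A) \<in> borel_measurable borel"
    unfolding trace_def by (intro borel_measurable_continuous_onI continuous_intros)
  from measurable_compose[OF borel_measurable_weak_jacobian[OF assms] this]
  show ?thesis by (simp add: weak_div_def[abs_def])
qed

lemma borel_measurable_sym_grad:
  assumes "u \<in> H1 \<Omega>" shows "sym_grad \<Omega> u \<in> borel_measurable (lebesgue_on \<Omega>)"
proof -
  have "(\<lambda>A :: real^3^3. (1/2) *\<^sub>R (A + transpose A)) \<in> borel_measurable borel"
    unfolding transpose_def by (intro borel_measurable_continuous_onI continuous_intros continuous_on_vec_lambda)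
  from measurable_compose[OF borel_measurable_weak_jacobian[OF assms] this]
  show ?thesis by (simp add: sym_grad_def[abs_def])
qed

lemma rigid_motion_smooth:
  assumes "r = (\<lambda>x. B *v x + \<eta> :: real^3)"
  shows "smooth_field r" and "jacobian_matrix r x = B"
proof -
  have eq: "(\<lambda>x. r x $ i) = (\<lambda>x. (\<Sum>j\<in>UNIV. B $ i $ j * x $ j) + \<eta> $ i)" for i
    by (simp add: assms matrix_vector_mult_def)
  show "smooth_field r" unfolding smooth_field_def eq
    by (intro allI smooth_add smooth_sum smooth_mult smooth_const smooth_coord) simp
  have d: "((\<lambda>x. (\<Sum>j\<in>UNIV. B $ i $ j * x $ j) + \<eta> $ i) has_derivative (\<lambda>h. (\<Sum>j\<in>UNIV. B $ i $ j * h $ j))) (at x)" for i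
    by (auto intro!: derivative_eq_intros bounded_linear_imp_has_derivative[OF bounded_linear_vec_nth])
  show "jacobian_matrix r x = B"
    by (simp add: vec_eq_iff eq partial_deriv_eqI[OF d] axis_def if_distrib cong: if_cong)
qed

lemma inner_symmetric_antisymmetric:
  fixes A B :: "real^'n^'n"
  assumes "transpose A = A" "transpose B = - B" shows "A \<bullet> B = 0"
  using inner_transpose[of A B] assms by simp

lemma trace_antisymmetric: "transpose (B :: real^'n^'n) = - B \<Longrightarrow> trace B = 0"
proof -
  assume "transpose B = - B"
  then have "transpose B $ i $ i = (- B) $ i $ i" for i by (rule arg_cong)
  then have "B $ i $ i = - B $ i $ i" for i by (simp only: transpose_def vec_lambda_beta vector_uminus_component)
  then show ?thesis by (simp add: trace_def)
qed

context regular_domain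
begin

lemma centered_part_exists:
  assumes u: "square_integrable (lebesgue_on \<Omega>) (u :: real^3 \<Rightarrow> real^3)"
  obtains B :: "real^3^3" and \<eta> where "transpose B = - B"
    "\<And>r. r \<in> rigid_motions \<Longrightarrow> (LINT x|lebesgue_on \<Omega>. (u x - (B *v x + \<eta>)) \<bullet> r x) = 0"
proof -
  \<comment> \<open>All matrices serve as parameters, antisymmetrised on the fly, because the
    projection lemma wants a linear parametrisation by a Euclidean space. The symmetric part is
    redundant; an antisymmetric A is recovered from the parameter A/2.\<close>
  define r where "r p x = (fst p - transpose (fst p)) *v x + snd p" for p :: "(real^3^3) \<times> (real^3)" and x :: "real^3"
  have anti: "transpose (A - transpose A) = - (A - transpose A)" for A :: "real^3^3"
    by (simp add: transpose_def vec_eq_iff)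
  have comp: "r p x $ i = (\<Sum>j\<in>UNIV. fst p $ i $ j * x $ j - fst p $ j $ i * x $ j) + snd p $ i" for p x i
    by (simp add: r_def matrix_vector_mult_def transpose_def left_diff_distrib)
  have "linear (\<lambda>p. r p x)" for x
  proof (intro linearI)
    show "r (p + q) x = r p x + r q x" for p q
      by (simp add: vec_eq_iff comp distrib_right sum.distrib sum_subtractf)
    show "r (c *\<^sub>R p) x = c *\<^sub>R r p x" for c p
      unfolding vec_eq_iff vector_scaleR_component comp real_scaleR_def
      by (simp add: distrib_left sum_distrib_left right_diff_distrib mult.assoc)
  qed
  moreover have "square_integrable (lebesgue_on \<Omega>) (r p)" for p
    by (intro square_integrable_\<Omega> smooth_field_continuous_on rigid_motion_smooth(1)[of _ "fst p - transpose (fst p)" "snd p"]) (simp add: r_def[abs_def])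
  ultimately obtain p where p: "\<And>q. (LINT x|lebesgue_on \<Omega>. (u x - r p x) \<bullet> r q x) = 0"
    using L2_projection_exists[OF _ _ u] by blast
  show ?thesis
  proof (rule that[of "fst p - transpose (fst p)" "snd p"])
    fix s :: "real^3 \<Rightarrow> real^3" assume "s \<in> rigid_motions"
    then obtain A \<zeta> where A: "s = (\<lambda>x. A *v x + \<zeta>)" "transpose A = - A" by (auto simp: rigid_motions_def)
    moreover have "(1/2) *\<^sub>R A - transpose ((1/2) *\<^sub>R A) = A"
    proof -
      have "transpose ((1/2) *\<^sub>R A) = (1/2) *\<^sub>R transpose A" by (simp add: transpose_def vec_eq_iff)
      then show ?thesis unfolding A(2) by (simp add: vec_eq_iff)
    qed
    ultimately have "s = r ((1/2) *\<^sub>R A, \<zeta>)" by (simp add: r_def fun_eq_iff)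
    then show "(LINT x|lebesgue_on \<Omega>. (u x - ((fst p - transpose (fst p)) *v x + snd p)) \<bullet> s x) = 0"
      using p[of "((1/2) *\<^sub>R A, \<zeta>)"] by (simp add: r_def)
  qed (rule anti)
qed

text \<open>The solution is u minus its rigid part, with Jacobian J - B. As B is antisymmetric, the
  symmetric derivative remains J and the divergence remains 0.\<close>

lemma divergence_free_solution:
  fixes u :: "real^3 \<Rightarrow> real^3" and J :: "real^3 \<Rightarrow> real^3^3"
  assumes u: "continuous_on (cball 0 R) u" and J: "continuous_on (cball 0 R) J"
    and \<tau>: "\<And>i k. continuous_on (cball 0 R) (\<tau> i k)"
    and du: "\<And>x. x \<in> ball 0 R \<Longrightarrow> (u has_derivative (\<lambda>h. J x *v h)) (at x)"
    and dJ: "\<And>x i k. x \<in> ball 0 R \<Longrightarrow> ((\<lambda>s. J (x + s *\<^sub>R axis k 1) $ i $ k) has_real_derivative \<tau> i k x) (at 0)"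
    and div: "\<And>x i. x \<in> ball 0 R \<Longrightarrow> (\<Sum>k\<in>UNIV. \<tau> i k x) = 0"
    and sym: "\<And>x. transpose (J x) = J x" and tr: "\<And>x. x \<in> ball 0 R \<Longrightarrow> trace (J x) = 0"
  shows "\<exists>g w. g \<in> rigid_perp \<Omega> \<and> w \<in> centered_displacements \<Omega> \<and> weak_lame_solution lam0 mu0 \<Omega> g w \<and>
    (AE x in lebesgue_on \<Omega>. weak_div \<Omega> w x = 0) \<and> (AE x in lebesgue_on \<Omega>. sym_grad \<Omega> w x = J x)"
proof -
  let ?\<Omega> = "lebesgue_on \<Omega>" and ?M = "surface_measure \<Omega>"
  obtain B :: "real^3^3" and \<eta> where B: "transpose B = - B"
    "\<And>r. r \<in> rigid_motions \<Longrightarrow> (LINT x|?\<Omega>. (u x - (B *v x + \<eta>)) \<bullet> r x) = 0"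
    using centered_part_exists[OF square_integrable_\<Omega>[OF u]] by blast
  define w where "w x = u x - (B *v x + \<eta>)" for x
  have wJ: "has_L2_jacobian \<Omega> w (\<lambda>x. J x - B)"
  proof (rule has_L2_jacobian_classical)
    show "continuous_on (cball 0 R) w" unfolding w_def[abs_def]
      by (intro continuous_intros u linear_continuous_on matrix_vector_mul_bounded_linear)
    show "continuous_on (cball 0 R) (\<lambda>x. J x - B)" by (intro continuous_intros J)
    fix x :: "real^3" assume "x \<in> ball 0 R"
    then have "((\<lambda>x. u x - (B *v x + \<eta>)) has_derivative (\<lambda>h. J x *v h - (B *v h + 0))) (at x)"
      by (intro has_derivative_diff has_derivative_add du has_derivative_const
          bounded_linear_imp_has_derivative matrix_vector_mul_bounded_linear)
    then show "(w has_derivative (\<lambda>h. (J x - B) *v h)) (at x)"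
      by (simp add: w_def[abs_def] matrix_vector_mult_diff_rdistrib)
  qed
  have wH: "w \<in> H1 \<Omega>" using wJ by (auto simp: H1_def)
  have W: "AE x in ?\<Omega>. weak_jacobian \<Omega> w x = J x - B" by (rule weak_jacobian_unique[OF wJ])
  have S: "AE x in ?\<Omega>. sym_grad \<Omega> w x = J x"
    using W
  proof eventually_elim
    case (elim x)
    have "transpose (J x - B) = transpose (J x) - transpose B" by (simp add: transpose_def vec_eq_iff)
    then have "transpose (J x - B) = J x + B" unfolding B(1) sym by simp
    then show ?case unfolding sym_grad_def elim by (simp add: vec_eq_iff)
  qed
  have D: "AE x in ?\<Omega>. weak_div \<Omega> w x = 0"
    using W AE_space
  proof eventually_elim
    case (elim x)
    then have "x \<in> ball 0 R" using \<Omega>_ball by (auto simp: space_restrict_space)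
    then show ?case unfolding weak_div_def elim using tr B(1) by (simp add: trace_sub trace_antisymmetric)
  qed
  have wc: "w \<in> centered_displacements \<Omega>"
    using wH B(2) by (simp add: centered_displacements_def w_def)
  \<comment> \<open>The full stress: the term with \<open>lam0\<close> carries the divergence and
    drops out.\<close>
  define \<sigma> where "\<sigma> x = (2 * mu0) *\<^sub>R J x" for x
  have \<sigma>c: "continuous_on (cball 0 R) \<sigma>" unfolding \<sigma>_def[abs_def] by (intro continuous_intros J)
  obtain g where g: "square_integrable ?M g"
    "\<And>\<phi>. smooth_field \<phi> \<Longrightarrow> (LINT x|?\<Omega>. \<sigma> x \<bullet> jacobian_matrix \<phi> x) = (LINT x|?M. g x \<bullet> \<phi> x)"
  proof (rule traction_exists[OF \<sigma>c, of "\<lambda>i k x. 2 * mu0 * \<tau> i k x"])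
    show "((\<lambda>s. \<sigma> (x + s *\<^sub>R axis k 1) $ i $ k) has_real_derivative 2 * mu0 * \<tau> i k x) (at 0)" if "x \<in> ball 0 R" for x i k
      unfolding \<sigma>_def vector_scaleR_component by (simp add: DERIV_cmult dJ[OF that] del: times_divide_eq_left)
  qed (auto intro!: continuous_intros \<tau> simp: div simp flip: sum_distrib_left)
  have \<sigma>sq: "square_integrable ?\<Omega> \<sigma>" using \<sigma>c by (rule square_integrable_\<Omega>)
  have gp: "g \<in> rigid_perp \<Omega>"
    unfolding rigid_perp_def
  proof (intro CollectI conjI ballI g(1))
    fix r :: "real^3 \<Rightarrow> real^3" assume "r \<in> rigid_motions"
    then obtain A \<zeta> where A: "r = (\<lambda>x. A *v x + \<zeta>)" "transpose A = - A" by (auto simp: rigid_motions_def)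
    \<comment> \<open>A rigid motion has a constant antisymmetric Jacobian, to which the symmetric
      stress is orthogonal pointwise; the load inherits the orthogonality.\<close>
    have "\<sigma> x \<bullet> A = 0" for x using inner_symmetric_antisymmetric[OF sym A(2)] by (simp add: \<sigma>_def)
    then show "(LINT x|?M. g x \<bullet> r x) = 0"
      using g(2)[OF rigid_motion_smooth(1)[OF A(1)]] rigid_motion_smooth(2)[OF A(1)] by simp
  qed
  have weak: "weak_lame_solution lam0 mu0 \<Omega> g w"
    unfolding weak_lame_solution_def
  proof (intro conjI ballI allI impI wH)
    fix v t assume v: "v \<in> H1 \<Omega>" and t: "has_trace \<Omega> v t"
    let ?V = "weak_jacobian \<Omega> v"
    have "has_L2_jacobian \<Omega> v ?V" using v by (rule has_L2_weak_jacobian)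
    then have Vsq: "square_integrable ?\<Omega> ?V" by (simp add: has_L2_jacobian_def)
    \<comment> \<open>The load is tested against smooth fields so far. The fields that define the
      trace converge both in the interior with their Jacobians and on the boundary, so the identity
      passes to v and t.\<close>
    from t obtain \<phi> :: "nat \<Rightarrow> real^3 \<Rightarrow> real^3" where tsq: "square_integrable ?M t"
      and \<phi>: "\<And>n. smooth_field (\<phi> n)"
        "(\<lambda>n. L2_norm ?\<Omega> (\<lambda>x. matrix (frechet_derivative (\<phi> n) (at x)) - ?V x)) \<longlonglongrightarrow> 0"
        "(\<lambda>n. L2_norm ?M (\<lambda>x. \<phi> n x - t x)) \<longlonglongrightarrow> 0"
      unfolding has_trace_def smooth_field_def by blast
    have "(\<lambda>n. LINT x|?\<Omega>. jacobian_matrix (\<phi> n) x \<bullet> \<sigma> x) \<longlonglongrightarrow> (LINT x|?\<Omega>. ?V x \<bullet> \<sigma> x)"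
      using \<phi> by (intro L2_inner_tendsto Vsq \<sigma>sq)
        (auto intro: square_integrable_\<Omega> smooth_field_jacobian_continuous_on simp: smooth_field_jacobian)
    moreover have "(\<lambda>n. LINT x|?M. \<phi> n x \<bullet> g x) \<longlonglongrightarrow> (LINT x|?M. t x \<bullet> g x)"
      using \<phi> by (intro L2_inner_tendsto tsq g(1)) (auto intro: square_integrable_surface smooth_field_continuous_on)
    moreover have "(LINT x|?\<Omega>. jacobian_matrix (\<phi> n) x \<bullet> \<sigma> x) = (LINT x|?M. \<phi> n x \<bullet> g x)" for n
      using g(2)[OF \<phi>(1)[of n]] by (simp add: inner_commute)
    ultimately have lim: "(LINT x|?\<Omega>. \<sigma> x \<bullet> ?V x) = (LINT x|?M. g x \<bullet> t x)"
      using LIMSEQ_unique by (simp add: inner_commute) 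
    have "(LINT x|?\<Omega>. lam0 * (weak_div \<Omega> w x * weak_div \<Omega> v x) + 2 * mu0 * (sym_grad \<Omega> w x \<bullet> sym_grad \<Omega> v x))
        = (LINT x|?\<Omega>. \<sigma> x \<bullet> ?V x)"
    proof (rule integral_cong_AE)
      note [measurable] = borel_measurable_weak_div[OF wH] borel_measurable_weak_div[OF v]
        borel_measurable_sym_grad[OF wH] borel_measurable_sym_grad[OF v]
      have [measurable]: "?V \<in> borel_measurable ?\<Omega>" using Vsq by (rule square_integrable_measurable)
      show "(\<lambda>x. lam0 * (weak_div \<Omega> w x * weak_div \<Omega> v x) + 2 * mu0 * (sym_grad \<Omega> w x \<bullet> sym_grad \<Omega> v x))
          \<in> borel_measurable ?\<Omega>" by measurable
      show "(\<lambda>x. \<sigma> x \<bullet> ?V x) \<in> borel_measurable ?\<Omega>"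
        using square_integrable_measurable[OF \<sigma>sq] by measurable
      show "AE x in ?\<Omega>. lam0 * (weak_div \<Omega> w x * weak_div \<Omega> v x) + 2 * mu0 * (sym_grad \<Omega> w x \<bullet> sym_grad \<Omega> v x)
          = \<sigma> x \<bullet> ?V x"
        using D S
      proof eventually_elim
        case (elim x)
        \<comment> \<open>Contraction with a symmetric matrix does not see the antisymmetric part,
          so the symmetric derivative of v may be replaced by its whole Jacobian.\<close>
        have "J x \<bullet> transpose (?V x) = J x \<bullet> ?V x" using inner_transpose[of "J x" "?V x"] sym[of x] by simp
        then show ?case by (simp add: elim \<sigma>_def sym_grad_def[of \<Omega> v] inner_add_right)
      qed
    qed
    with lim show "(LINT x|?\<Omega>. lam0 * (weak_div \<Omega> w x * weak_div \<Omega> v x) + 2 * mu0 * (sym_grad \<Omega> w x \<bullet> sym_grad \<Omega> v x))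
        = (LINT x|?M. g x \<bullet> t x)" by simp
  qed
  show ?thesis using gp wc weak D S by blast
qed

end

section \<open>Hessians of harmonic functions\<close>

text \<open>The Hessian of 1/|w|. Division by zero gives the value 0 at the pole, so that symmetry
  and vanishing trace hold everywhere.\<close>

definition newton_hessian :: "real^3 \<Rightarrow> real^3^3" where
  "newton_hessian w = (1 / norm w ^ 5) *\<^sub>R (\<chi> i k. 3 * w $ i * w $ k - (if i = k then (norm w)\<^sup>2 else 0))"

lemma newton_hessian_nth:
  "newton_hessian w $ i $ k = (3 * w $ i * w $ k - (if i = k then (norm w)\<^sup>2 else 0)) / norm w ^ 5"
  by (simp add: newton_hessian_def)

lemma norm_sq_3: "(norm (w :: real^3))\<^sup>2 = (w $ 1)\<^sup>2 + (w $ 2)\<^sup>2 + (w $ 3)\<^sup>2"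
  unfolding power2_norm_eq_inner inner_vec_def sum_3 by (simp add: power2_eq_square)

text \<open>The eigenvalues are 2, -1 and -1 times 1/|w|^3, and 4 + 1 + 1 = 6.\<close>

lemma norm_newton_hessian: "(norm (newton_hessian w))\<^sup>2 = 6 / norm w ^ 6"
proof (cases "w = 0")
  case False
  define n where "n = norm w"
  have n: "n \<noteq> 0" "n\<^sup>2 = (w $ 1)\<^sup>2 + (w $ 2)\<^sup>2 + (w $ 3)\<^sup>2" using False norm_sq_3[of w] by (auto simp: n_def)
  have "(norm (\<chi> i k. 3 * w $ i * w $ k - (if i = k then n\<^sup>2 else 0) :: real^3^3))\<^sup>2 = 6 * (n\<^sup>2)\<^sup>2"
    unfolding power2_norm_eq_inner inner_matrix_eq sum_3
    by (simp add: n(2)) (simp add: power2_eq_square algebra_simps)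
  moreover have "newton_hessian w = (1 / n ^ 5) *\<^sub>R (\<chi> i k. 3 * w $ i * w $ k - (if i = k then n\<^sup>2 else 0))"
    by (simp only: newton_hessian_def n_def)
  ultimately have "(norm (newton_hessian w))\<^sup>2 = 6 * (n\<^sup>2)\<^sup>2 / (n ^ 5)\<^sup>2"
    by (simp add: power_mult_distrib power_divide)
  also have "\<dots> = 6 / n ^ 6"
    using n(1) by (simp add: power2_eq_square field_simps eval_nat_numeral)
  finally show ?thesis by (simp add: n_def)
qed (simp add: newton_hessian_def)

lemma newton_hessian_symmetric: "transpose (newton_hessian w) = newton_hessian w"
  by (simp add: vec_eq_iff transpose_def newton_hessian_nth mult_ac)

lemma newton_hessian_trace: "trace (newton_hessian w) = 0"
proof -
  have "trace (newton_hessian w) = (3 * ((w $ 1)\<^sup>2 + (w $ 2)\<^sup>2 + (w $ 3)\<^sup>2) - 3 * (norm w)\<^sup>2) / norm w ^ 5"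
    by (simp add: trace_def sum_3 newton_hessian_nth power2_eq_square add_divide_distrib[symmetric] diff_divide_distrib[symmetric])
  then show ?thesis by (simp add: norm_sq_3)
qed

definition newton_hessian_deriv :: "3 \<Rightarrow> 3 \<Rightarrow> real^3 \<Rightarrow> real" where
  "newton_hessian_deriv i k w =
     (3 * (w $ i + (if i = k then w $ k else 0)) - (if i = k then 2 * w $ k else 0)) / norm w ^ 5
     - 5 * (3 * w $ i * w $ k - (if i = k then (norm w)\<^sup>2 else 0)) * w $ k / norm w ^ 7"

lemma norm_along_axis:
  fixes w :: "real^3"
  assumes "w \<noteq> 0"
  shows "((\<lambda>s. norm (w + s *\<^sub>R axis k 1)) has_real_derivative w $ k / norm w) (at 0)"
proof -
  have "((\<lambda>s. w + s *\<^sub>R axis k 1) has_derivative (\<lambda>s. s *\<^sub>R axis k 1)) (at 0)"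
    by (auto intro!: derivative_eq_intros)
  then have "((\<lambda>s. norm (w + s *\<^sub>R axis k 1)) has_derivative (\<lambda>s. (s *\<^sub>R axis k 1) \<bullet> sgn w)) (at 0)"
    by (rule has_derivative_compose) (use assms in \<open>simp add: has_derivative_norm\<close>)
  then show ?thesis
    unfolding has_field_derivative_def
    by (rule has_derivative_eq_rhs) (simp add: fun_eq_iff sgn_div_norm inner_axis' field_simps)
qed

lemma newton_hessian_along_axis:
  assumes "w \<noteq> 0"
  shows "((\<lambda>s. newton_hessian (w + s *\<^sub>R axis k 1) $ i $ k) has_real_derivative newton_hessian_deriv i k w) (at 0)"
proof -
  have n: "norm w \<noteq> 0" using assms by simp
  have c: "((\<lambda>s. (w + s *\<^sub>R axis k 1) $ j) has_real_derivative (if j = k then 1 else 0)) (at 0)" for j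
    by (auto intro!: derivative_eq_intros simp: axis_def)
  have prod: "((\<lambda>s. 3 * (w + s *\<^sub>R axis k 1) $ i * (w + s *\<^sub>R axis k 1) $ k)
      has_real_derivative 3 * (w $ i + (if i = k then w $ k else 0))) (at 0)"
    by (rule DERIV_cong[OF DERIV_mult[OF DERIV_cmult[OF c] c]]) simp
  have sq: "((\<lambda>s. if i = k then (norm (w + s *\<^sub>R axis k 1))\<^sup>2 else 0)
      has_real_derivative (if i = k then 2 * w $ k else 0)) (at 0)"
  proof (cases "i = k")
    case True
    have "((\<lambda>s. (norm (w + s *\<^sub>R axis k 1))\<^sup>2) has_real_derivative 2 * w $ k) (at 0)"
      by (rule DERIV_cong[OF DERIV_power[OF norm_along_axis[OF assms]]]) (use n in simp)
    then show ?thesis using True by simp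
  qed simp
  note num = DERIV_diff[OF prod sq]
  have den: "((\<lambda>s. norm (w + s *\<^sub>R axis k 1) ^ 5) has_real_derivative 5 * norm w ^ 3 * w $ k) (at 0)"
    by (rule DERIV_cong[OF DERIV_power[OF norm_along_axis[OF assms]]]) (use n in \<open>simp add: eval_nat_numeral field_simps\<close>)
  show ?thesis
    unfolding newton_hessian_nth
  proof (rule DERIV_cong[OF DERIV_divide[OF num den]])
    show "((3 * (w $ i + (if i = k then w $ k else 0)) - (if i = k then 2 * w $ k else 0)) * norm (w + 0 *\<^sub>R axis k 1) ^ 5 -
     (3 * (w + 0 *\<^sub>R axis k 1) $ i * (w + 0 *\<^sub>R axis k 1) $ k - (if i = k then (norm (w + 0 *\<^sub>R axis k 1))\<^sup>2 else 0)) *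
     (5 * norm w ^ 3 * w $ k)) / (norm (w + 0 *\<^sub>R axis k 1) ^ 5 * norm (w + 0 *\<^sub>R axis k 1) ^ 5) = newton_hessian_deriv i k w"
    proof -
      have "(a * n ^ 5 - b * (5 * n ^ 3 * c)) / (n ^ 5 * n ^ 5) = a / n ^ 5 - 5 * b * c / n ^ 7" if "n \<noteq> 0" for a b c n :: real
        using that by (simp add: field_simps eval_nat_numeral)
      from this[OF n] show ?thesis by (simp add: newton_hessian_deriv_def)
    qed
  qed (use n in simp)
qed

text \<open>The divergence of the i-th row of a Hessian is the i-th derivative of the Laplacian,
  which is zero for 1/|w|.\<close>

lemma newton_hessian_deriv_sum: "(\<Sum>k\<in>UNIV. newton_hessian_deriv i k w) = 0"
proof (cases "w = 0")
  case False
  define n where "n = norm w"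
  have n: "n \<noteq> 0" using False by (simp add: n_def)
  have ww: "(\<Sum>k\<in>UNIV. w $ k * w $ k) = n\<^sup>2"
    unfolding n_def norm_sq_3 sum_3 by (simp add: power2_eq_square)
  have "(\<Sum>k\<in>UNIV. newton_hessian_deriv i k w) = (\<Sum>k\<in>UNIV. 3 * w $ i / n ^ 5 + (if i = k then w $ k / n ^ 5 + 5 * n\<^sup>2 * w $ k / n ^ 7 else 0)
     - 15 * w $ i / n ^ 7 * (w $ k * w $ k))"
    by (intro sum.cong refl) (auto simp: newton_hessian_deriv_def n_def[symmetric] add_divide_distrib diff_divide_distrib algebra_simps)
  also have "\<dots> = 9 * w $ i / n ^ 5 + (w $ i / n ^ 5 + 5 * n\<^sup>2 * w $ i / n ^ 7) - 15 * w $ i / n ^ 7 * n\<^sup>2"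
    unfolding sum.distrib sum_subtractf sum_distrib_left[symmetric] ww by simp
  also have "\<dots> = 0" using n by (simp add: field_simps eval_nat_numeral)
  finally show ?thesis .
qed (simp add: newton_hessian_deriv_def)

lemma newton_gradient_derivative:
  fixes w :: "real^3"
  assumes "w \<noteq> 0"
  shows "((\<lambda>w. - (1 / norm w ^ 3) *\<^sub>R w) has_derivative (\<lambda>h. newton_hessian w *v h)) (at w)"
proof -
  have n: "norm w \<noteq> 0" using assms by simp
  have "((\<lambda>w. norm w ^ 3) has_derivative (\<lambda>h. 3 * (h \<bullet> sgn w) * norm w ^ 2)) (at w)"
    by (rule has_derivative_eq_rhs[OF has_derivative_power[OF has_derivative_norm[OF assms]]]) simp
  from has_derivative_minus[OF has_derivative_scaleR[OF Deriv.has_derivative_inverse[OF _ this] has_derivative_ident]]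
  have d: "((\<lambda>w. - (inverse (norm w ^ 3) *\<^sub>R w)) has_derivative
      (\<lambda>h. - (inverse (norm w ^ 3) *\<^sub>R h + (- (inverse (norm w ^ 3) * (3 * (h \<bullet> sgn w) * (norm w)\<^sup>2) * inverse (norm w ^ 3))) *\<^sub>R w))) (at w)"
    using n by simp
  have e: "- (inverse (norm w ^ 3) *\<^sub>R h + (- (inverse (norm w ^ 3) * (3 * (h \<bullet> sgn w) * (norm w)\<^sup>2) * inverse (norm w ^ 3))) *\<^sub>R w)
      = (- 1 / norm w ^ 3) *\<^sub>R h + (3 * (h \<bullet> w) / norm w ^ 5) *\<^sub>R w" for h
  proof -
    have "inverse (norm w ^ 3) * (3 * (h \<bullet> sgn w) * (norm w)\<^sup>2) * inverse (norm w ^ 3) = 3 * (h \<bullet> w) / norm w ^ 5"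
      using n by (simp add: sgn_div_norm field_simps eval_nat_numeral)
    then show ?thesis by (simp add: inverse_eq_divide)
  qed
  have "((\<lambda>w. - (1 / norm w ^ 3) *\<^sub>R w) has_derivative
      (\<lambda>h. (- 1 / norm w ^ 3) *\<^sub>R h + (3 * (h \<bullet> w) / norm w ^ 5) *\<^sub>R w)) (at w)"
    using has_derivative_eq_rhs[OF d ext[OF e]] by (simp add: inverse_eq_divide)
  moreover have "(- 1 / norm w ^ 3) *\<^sub>R h + (3 * (h \<bullet> w) / norm w ^ 5) *\<^sub>R w = newton_hessian w *v h" for h
  proof -
    have n3: "(norm w)\<^sup>2 / norm w ^ 5 = 1 / norm w ^ 3" using n by (simp add: field_simps eval_nat_numeral)
    have "(newton_hessian w *v h) $ i = 3 * w $ i / norm w ^ 5 * (h \<bullet> w) - 1 / norm w ^ 3 * h $ i" for i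
    proof -
      have "(newton_hessian w *v h) $ i = (\<Sum>k\<in>UNIV. 3 * w $ i / norm w ^ 5 * (h $ k * w $ k) - (if i = k then (norm w)\<^sup>2 / norm w ^ 5 * h $ k else 0))"
        unfolding matrix_vector_mult_def newton_hessian_nth
        by (simp, intro sum.cong refl) (auto simp: diff_divide_distrib algebra_simps)
      also have "\<dots> = 3 * w $ i / norm w ^ 5 * (h \<bullet> w) - (norm w)\<^sup>2 / norm w ^ 5 * h $ i"
        unfolding sum_subtractf sum_distrib_left[symmetric] inner_vec_def by simp
      finally show ?thesis unfolding n3 .
    qed
    then show ?thesis by (simp add: vec_eq_iff mult_ac)
  qed
  ultimately show ?thesis by simp
qed

lemma continuous_on_newton_hessian:
  assumes "\<And>x. x \<in> S \<Longrightarrow> f x \<noteq> 0" "continuous_on S f"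
  shows "continuous_on S (\<lambda>x. newton_hessian (f x))"
proof -
  have "continuous_on S (\<lambda>x. (\<chi> i k. 3 * f x $ i * f x $ k - (if i = k then (norm (f x))\<^sup>2 else 0)) :: real^3^3)"
  proof (intro continuous_on_vec_lambda)
    fix i k :: 3
    show "continuous_on S (\<lambda>x. 3 * f x $ i * f x $ k - (if i = k then (norm (f x))\<^sup>2 else 0))"
      by (cases "i = k") (auto intro!: continuous_intros assms)
  qed
  then show ?thesis
    unfolding newton_hessian_def using assms by (intro continuous_on_scaleR) (auto intro!: continuous_intros)
qed

text \<open>\<open>J\<close> is the Jacobian of a field \<open>u = \<nabla>\<phi>\<close> with \<open>\<phi>\<close> harmonic; \<open>\<tau> i k\<close> is
  \<open>\<partial>\<^sub>k J\<^sub>i\<^sub>k\<close>, so that the rows of \<open>J\<close> are divergence free.\<close>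

definition harmonic_hessian :: "real \<Rightarrow> (real^3 \<Rightarrow> real^3^3) \<Rightarrow> bool" where
  "harmonic_hessian R J \<longleftrightarrow> continuous_on (cball 0 R) J \<and> (\<forall>x. transpose (J x) = J x) \<and> (\<forall>x. trace (J x) = 0) \<and>
    (\<exists>u. continuous_on (cball 0 R) u \<and> (\<forall>x\<in>ball 0 R. (u has_derivative (\<lambda>h. J x *v h)) (at x))) \<and>
    (\<exists>\<tau>. (\<forall>i k. continuous_on (cball 0 R) (\<tau> i k)) \<and> (\<forall>x\<in>ball 0 R. \<forall>i. (\<Sum>k\<in>UNIV. \<tau> i k x) = 0) \<and>
      (\<forall>x\<in>ball 0 R. \<forall>i k. ((\<lambda>s. J (x + s *\<^sub>R axis k 1) $ i $ k) has_real_derivative \<tau> i k x) (at 0)))"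

lemma harmonic_hessian_newton:
  fixes z :: "real^3" assumes "R < norm z" shows "harmonic_hessian R (\<lambda>x. newton_hessian (x - z))"
  unfolding harmonic_hessian_def
proof (intro conjI allI)
  have ne: "x - z \<noteq> 0" if "x \<in> cball 0 R" for x :: "real^3" using that assms by auto
  show "continuous_on (cball 0 R) (\<lambda>x. newton_hessian (x - z))"
    using ne by (intro continuous_on_newton_hessian continuous_intros)
  show "\<exists>u. continuous_on (cball 0 R) u \<and> (\<forall>x\<in>ball 0 R. (u has_derivative (*v) (newton_hessian (x - z))) (at x))"
  proof (intro exI[of _ "\<lambda>x. - (1 / norm (x - z) ^ 3) *\<^sub>R (x - z)"] conjI ballI)
    show "continuous_on (cball 0 R) (\<lambda>x. - (1 / norm (x - z) ^ 3) *\<^sub>R (x - z))"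
      using ne by (intro continuous_intros) auto
    fix x :: "real^3" assume "x \<in> ball 0 R"
    then have "x - z \<noteq> 0" using ne by auto
    have "((\<lambda>x. x - z) has_derivative (\<lambda>h. h)) (at x)" by (auto intro!: derivative_eq_intros)
    from has_derivative_compose[OF this newton_gradient_derivative[OF \<open>x - z \<noteq> 0\<close>]]
    show "((\<lambda>x. - (1 / norm (x - z) ^ 3) *\<^sub>R (x - z)) has_derivative (*v) (newton_hessian (x - z))) (at x)" .
  qed
  show "\<exists>\<tau>. (\<forall>i k. continuous_on (cball 0 R) (\<tau> i k)) \<and> (\<forall>x\<in>ball 0 R. \<forall>i. (\<Sum>k\<in>UNIV. \<tau> i k x) = 0) \<and>
      (\<forall>x\<in>ball 0 R. \<forall>i k. ((\<lambda>s. newton_hessian (x + s *\<^sub>R axis k 1 - z) $ i $ k) has_real_derivative \<tau> i k x) (at 0))"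
  proof (intro exI[of _ "\<lambda>i k x. newton_hessian_deriv i k (x - z)"] conjI ballI allI newton_hessian_deriv_sum)
    show "continuous_on (cball 0 R) (\<lambda>x. newton_hessian_deriv i k (x - z))" for i k
      unfolding newton_hessian_deriv_def using ne
      by (cases "i = k") (auto intro!: continuous_intros)
    show "((\<lambda>s. newton_hessian (x + s *\<^sub>R axis k 1 - z) $ i $ k) has_real_derivative newton_hessian_deriv i k (x - z)) (at 0)"
      if "x \<in> ball 0 R" for x i k
      using newton_hessian_along_axis[of "x - z" k i] ne[of x] that by (simp add: algebra_simps)
  qed
qed (simp_all add: newton_hessian_symmetric newton_hessian_trace)

section \<open>Linear combinations of harmonic Hessians\<close>

lemma harmonic_hessian_add:
  assumes "harmonic_hessian R F" "harmonic_hessian R G"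
  shows "harmonic_hessian R (\<lambda>x. F x + G x)"
proof -
  obtain u where u: "continuous_on (cball 0 R) u" "\<forall>x\<in>ball 0 R. (u has_derivative (\<lambda>h. F x *v h)) (at x)"
    using assms(1) unfolding harmonic_hessian_def by blast
  obtain \<tau> where \<tau>: "\<forall>i k. continuous_on (cball 0 R) (\<tau> i k)" "\<forall>x\<in>ball 0 R. \<forall>i. (\<Sum>k\<in>UNIV. \<tau> i k x) = 0"
      "\<forall>x\<in>ball 0 R. \<forall>i k. ((\<lambda>s. F (x + s *\<^sub>R axis k 1) $ i $ k) has_real_derivative \<tau> i k x) (at 0)"
    using assms(1) unfolding harmonic_hessian_def by blast
  obtain v where v: "continuous_on (cball 0 R) v" "\<forall>x\<in>ball 0 R. (v has_derivative (\<lambda>h. G x *v h)) (at x)"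
    using assms(2) unfolding harmonic_hessian_def by blast
  obtain \<rho> where \<rho>: "\<forall>i k. continuous_on (cball 0 R) (\<rho> i k)" "\<forall>x\<in>ball 0 R. \<forall>i. (\<Sum>k\<in>UNIV. \<rho> i k x) = 0"
      "\<forall>x\<in>ball 0 R. \<forall>i k. ((\<lambda>s. G (x + s *\<^sub>R axis k 1) $ i $ k) has_real_derivative \<rho> i k x) (at 0)"
    using assms(2) unfolding harmonic_hessian_def by blast
  have "\<exists>w. continuous_on (cball 0 R) w \<and> (\<forall>x\<in>ball 0 R. (w has_derivative (\<lambda>h. (F x + G x) *v h)) (at x))"
    using u v by (intro exI[of _ "\<lambda>x. u x + v x"])
      (auto intro!: continuous_intros has_derivative_add simp: matrix_vector_mult_add_rdistrib)
  moreover have "\<exists>\<omega>. (\<forall>i k. continuous_on (cball 0 R) (\<omega> i k)) \<and> (\<forall>x\<in>ball 0 R. \<forall>i. (\<Sum>k\<in>UNIV. \<omega> i k x) = 0) \<and>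
      (\<forall>x\<in>ball 0 R. \<forall>i k. ((\<lambda>s. (F (x + s *\<^sub>R axis k 1) + G (x + s *\<^sub>R axis k 1)) $ i $ k) has_real_derivative \<omega> i k x) (at 0))"
    using \<tau> \<rho> by (intro exI[of _ "\<lambda>i k x. \<tau> i k x + \<rho> i k x"])
      (auto intro!: continuous_intros DERIV_add simp: sum.distrib)
  moreover have "transpose (F x + G x) = F x + G x" "trace (F x + G x) = 0" for x
  proof -
    have "transpose (F x + G x) = transpose (F x) + transpose (G x)" by (simp add: transpose_def vec_eq_iff)
    then show "transpose (F x + G x) = F x + G x" using assms by (simp add: harmonic_hessian_def)
    show "trace (F x + G x) = 0" using assms by (simp add: harmonic_hessian_def trace_add)
  qed
  ultimately show ?thesis
    using assms unfolding harmonic_hessian_def by (auto intro!: continuous_on_add)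
qed

lemma harmonic_hessian_scaleR:
  assumes "harmonic_hessian R F" shows "harmonic_hessian R (\<lambda>x. c *\<^sub>R F x)"
proof -
  obtain u where u: "continuous_on (cball 0 R) u" "\<forall>x\<in>ball 0 R. (u has_derivative (\<lambda>h. F x *v h)) (at x)"
    using assms unfolding harmonic_hessian_def by blast
  obtain \<tau> where \<tau>: "\<forall>i k. continuous_on (cball 0 R) (\<tau> i k)" "\<forall>x\<in>ball 0 R. \<forall>i. (\<Sum>k\<in>UNIV. \<tau> i k x) = 0"
      "\<forall>x\<in>ball 0 R. \<forall>i k. ((\<lambda>s. F (x + s *\<^sub>R axis k 1) $ i $ k) has_real_derivative \<tau> i k x) (at 0)"
    using assms unfolding harmonic_hessian_def by blast
  have "\<exists>w. continuous_on (cball 0 R) w \<and> (\<forall>x\<in>ball 0 R. (w has_derivative (\<lambda>h. (c *\<^sub>R F x) *v h)) (at x))"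
    using u by (intro exI[of _ "\<lambda>x. c *\<^sub>R u x"])
      (auto intro!: continuous_intros has_derivative_scaleR_right simp: scaleR_matrix_vector_assoc[symmetric])
  moreover have "\<exists>\<omega>. (\<forall>i k. continuous_on (cball 0 R) (\<omega> i k)) \<and> (\<forall>x\<in>ball 0 R. \<forall>i. (\<Sum>k\<in>UNIV. \<omega> i k x) = 0) \<and>
      (\<forall>x\<in>ball 0 R. \<forall>i k. ((\<lambda>s. (c *\<^sub>R F (x + s *\<^sub>R axis k 1)) $ i $ k) has_real_derivative \<omega> i k x) (at 0))"
    using \<tau> by (intro exI[of _ "\<lambda>i k x. c * \<tau> i k x"])
      (auto intro!: continuous_intros DERIV_cmult simp flip: sum_distrib_left)
  moreover have "transpose (c *\<^sub>R F x) = c *\<^sub>R F x" "trace (c *\<^sub>R F x) = 0" for x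
  proof -
    have "transpose (c *\<^sub>R F x) = c *\<^sub>R transpose (F x)" by (simp add: transpose_def vec_eq_iff)
    then show "transpose (c *\<^sub>R F x) = c *\<^sub>R F x" using assms by (simp add: harmonic_hessian_def)
    have "trace (c *\<^sub>R F x) = c * trace (F x)" by (simp add: trace_def sum_distrib_left)
    then show "trace (c *\<^sub>R F x) = 0" using assms by (simp add: harmonic_hessian_def)
  qed
  ultimately show ?thesis
    using assms unfolding harmonic_hessian_def by (auto intro!: continuous_intros)
qed

section \<open>Moving poles\<close>

text \<open>The approximants have to be regular on the whole ball of radius R, while closeness is
  asked only on \<open>K\<close>. F itself may therefore have a pole inside the ball.\<close>

definition uniformly_approximable :: "real \<Rightarrow> (real^3) set \<Rightarrow> (real^3 \<Rightarrow> real^3^3) \<Rightarrow> bool" where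
  "uniformly_approximable R K F \<longleftrightarrow>
     (\<forall>\<epsilon>>0. \<exists>J. harmonic_hessian R J \<and> (\<forall>x\<in>K. norm (F x - J x) < \<epsilon>))"

lemma uniformly_approximable_harmonic: "harmonic_hessian R J \<Longrightarrow> uniformly_approximable R K J"
  unfolding uniformly_approximable_def by force

lemma uniformly_approximable_limit:
  assumes "\<And>\<epsilon>. 0 < \<epsilon> \<Longrightarrow> \<exists>G. uniformly_approximable R K G \<and> (\<forall>x\<in>K. norm (F x - G x) < \<epsilon>)"
  shows "uniformly_approximable R K F"
  unfolding uniformly_approximable_def
proof (intro allI impI)
  fix \<epsilon> :: real assume "0 < \<epsilon>"
  then have "0 < \<epsilon> / 2" by simp
  then obtain G where G: "uniformly_approximable R K G" "\<forall>x\<in>K. norm (F x - G x) < \<epsilon> / 2" using assms by blast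
  then obtain J where J: "harmonic_hessian R J" "\<forall>x\<in>K. norm (G x - J x) < \<epsilon> / 2"
    using \<open>0 < \<epsilon> / 2\<close> unfolding uniformly_approximable_def by blast
  have "norm (F x - J x) < \<epsilon>" if "x \<in> K" for x
    using norm_triangle_ineq[of "F x - G x" "G x - J x"] G(2) J(2) that by force
  then show "\<exists>J. harmonic_hessian R J \<and> (\<forall>x\<in>K. norm (F x - J x) < \<epsilon>)" using J(1) by blast
qed

lemma uniformly_approximable_add:
  assumes "uniformly_approximable R K F" "uniformly_approximable R K G"
  shows "uniformly_approximable R K (\<lambda>x. F x + G x)"
  unfolding uniformly_approximable_def
proof (intro allI impI)
  fix \<epsilon> :: real assume "0 < \<epsilon>"
  then have e: "0 < \<epsilon> / 2" by simp
  obtain I where I: "harmonic_hessian R I" "\<forall>x\<in>K. norm (F x - I x) < \<epsilon> / 2"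
    using assms(1) e unfolding uniformly_approximable_def by meson
  obtain J where J: "harmonic_hessian R J" "\<forall>x\<in>K. norm (G x - J x) < \<epsilon> / 2"
    using assms(2) e unfolding uniformly_approximable_def by meson
  have "norm ((F x + G x) - (I x + J x)) < \<epsilon>" if "x \<in> K" for x
  proof -
    have "(F x + G x) - (I x + J x) = (F x - I x) + (G x - J x)" by simp
    then have "norm ((F x + G x) - (I x + J x)) \<le> norm (F x - I x) + norm (G x - J x)"
      by (metis norm_triangle_ineq)
    moreover have "norm (F x - I x) < \<epsilon> / 2" "norm (G x - J x) < \<epsilon> / 2" using I J that by auto
    ultimately show ?thesis by linarith
  qed
  then show "\<exists>J. harmonic_hessian R J \<and> (\<forall>x\<in>K. norm (F x + G x - J x) < \<epsilon>)"
    using harmonic_hessian_add[OF I(1) J(1)] by blast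
qed

lemma uniformly_approximable_scaleR:
  assumes "uniformly_approximable R K F"
  shows "uniformly_approximable R K (\<lambda>x. c *\<^sub>R F x)"
  unfolding uniformly_approximable_def
proof (intro allI impI)
  fix \<epsilon> :: real assume "0 < \<epsilon>"
  then have e: "0 < \<epsilon> / (\<bar>c\<bar> + 1)" by (simp add: add_nonneg_pos)
  obtain J where J: "harmonic_hessian R J" "\<forall>x\<in>K. norm (F x - J x) < \<epsilon> / (\<bar>c\<bar> + 1)"
    using assms e unfolding uniformly_approximable_def by meson
  have "norm (c *\<^sub>R F x - c *\<^sub>R J x) < \<epsilon>" if "x \<in> K" for x
  proof -
    have "norm (c *\<^sub>R F x - c *\<^sub>R J x) = \<bar>c\<bar> * norm (F x - J x)" by (simp flip: scaleR_diff_right)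
    also have "\<dots> \<le> \<bar>c\<bar> * (\<epsilon> / (\<bar>c\<bar> + 1))" using J(2) that by (intro mult_left_mono) (auto intro: less_imp_le)
    also have "\<dots> < (\<bar>c\<bar> + 1) * (\<epsilon> / (\<bar>c\<bar> + 1))" using e by (intro mult_strict_right_mono) auto
    also have "\<dots> = \<epsilon>" by simp
    finally show ?thesis .
  qed
  then show "\<exists>J. harmonic_hessian R J \<and> (\<forall>x\<in>K. norm (c *\<^sub>R F x - J x) < \<epsilon>)"
    using harmonic_hessian_scaleR[OF J(1)] by (intro exI[of _ "\<lambda>x. c *\<^sub>R J x"]) auto
qed

text \<open>\<open>F0\<close> takes care of the empty sum: its zero multiple shows that the zero
  function is approximable.\<close>

lemma uniformly_approximable_sum:
  fixes n :: nat
  assumes "uniformly_approximable R K F0" "\<And>k. k < n \<Longrightarrow> uniformly_approximable R K (F k)"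
  shows "uniformly_approximable R K (\<lambda>x. \<Sum>k<n. F k x)"
  using assms(2)
proof (induction n)
  case 0
  show ?case using uniformly_approximable_scaleR[OF assms(1), of 0] by simp
next
  case (Suc n)
  then show ?case using uniformly_approximable_add[of R K "\<lambda>x. \<Sum>k<n. F k x" "F n"] by simp
qed

text \<open>The tail is dominated by a geometric series of ratio q \<le> 1/2, whose sum contributes
  the factor 2.\<close>

lemma power_series_remainder:
  fixes a :: "nat \<Rightarrow> 'b::banach"
  assumes a: "\<And>n. norm (a n) \<le> M / \<rho> ^ n" and s: "(\<lambda>n. t ^ n *\<^sub>R a n) sums S" and t: "\<bar>t\<bar> \<le> q * \<rho>" and q: "0 \<le> q" "q \<le> 1/2" and \<rho>: "0 < \<rho>"
  shows "norm (S - (\<Sum>k<n. t ^ k *\<^sub>R a k)) \<le> M * q ^ n * 2"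
proof -
  have M: "0 \<le> M" by (rule order.trans[OF norm_ge_zero[of "a 0"]]) (use a[of 0] in simp)
  have le: "norm (t ^ k *\<^sub>R a k) \<le> M * q ^ k" for k
  proof -
    have "norm (t ^ k *\<^sub>R a k) \<le> (q * \<rho>) ^ k * (M / \<rho> ^ k)"
      unfolding norm_scaleR using t a[of k] q \<rho> by (intro mult_mono) (auto simp: power_abs intro!: power_mono)
    also have "\<dots> = M * q ^ k" using \<rho> by (simp add: power_mult_distrib)
    finally show ?thesis .
  qed
  have "(\<lambda>k. t ^ (k + n) *\<^sub>R a (k + n)) sums (S - (\<Sum>k<n. t ^ k *\<^sub>R a k))"
    by (rule sums_split_initial_segment[OF s])
  moreover have g: "(\<lambda>k. M * q ^ n * q ^ k) sums (M * q ^ n * (1 / (1 - q)))"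
    using q by (intro sums_mult geometric_sums) auto
  ultimately have "norm (S - (\<Sum>k<n. t ^ k *\<^sub>R a k)) \<le> M * q ^ n * (1 / (1 - q))"
    by (rule norm_sums_le) (use le[of "_ + n"] in \<open>simp add: power_add mult_ac\<close>)
  also have "\<dots> \<le> M * q ^ n * 2"
    using q M by (intro mult_left_mono) (auto simp: field_simps)
  finally show ?thesis .
qed

text \<open>The coefficients of a power series are limits of divided differences of its values on an
  arbitrarily short segment; hence if the values there are approximable, so are the coefficients,
  and with them the values on half of the disc of convergence.\<close>

lemma uniformly_approximable_analytic_continuation:
  fixes F :: "real \<Rightarrow> real^3 \<Rightarrow> real^3^3"
  assumes \<rho>: "0 < \<rho>" and a: "\<And>n x. x \<in> K \<Longrightarrow> norm (a n x) \<le> M / \<rho> ^ n"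
    and s: "\<And>t x. x \<in> K \<Longrightarrow> \<bar>t\<bar> < \<rho> \<Longrightarrow> (\<lambda>n. t ^ n *\<^sub>R a n x) sums F t x"
    and \<epsilon>: "0 < \<epsilon>" and near: "\<And>t. \<bar>t\<bar> < \<epsilon> \<Longrightarrow> uniformly_approximable R K (F t)"
    and t: "\<bar>t\<bar> \<le> \<rho> / 2"
  shows "uniformly_approximable R K (F t)"
proof -
  \<comment> \<open>A positive bound in every case; \<open>M\<close> could be negative when
    \<open>K\<close> is empty.\<close>
  define M' where "M' = \<bar>M\<bar> + 1"
  have M': "0 < M'" by (simp add: M'_def)
  have a': "norm (a n x) \<le> M' / \<rho> ^ n" if "x \<in> K" for n x
  proof -
    have "M / \<rho> ^ n \<le> M' / \<rho> ^ n" using \<rho> by (intro divide_right_mono) (auto simp: M'_def)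
    then show ?thesis using a[OF that, of n] by linarith
  qed
  have rem: "norm (F t x - (\<Sum>k<n. t ^ k *\<^sub>R a k x)) \<le> M' * q ^ n * 2"
    if "x \<in> K" "\<bar>t\<bar> \<le> q * \<rho>" "0 \<le> q" "q \<le> 1/2" for t x q n
  proof (rule power_series_remainder[OF a'[OF that(1)] s[OF that(1)] that(2-4) \<rho>])
    have "q * \<rho> \<le> 1/2 * \<rho>" using that \<rho> by (intro mult_right_mono) auto
    then show "\<bar>t\<bar> < \<rho>" using that(2) \<rho> by linarith
  qed
  have zero: "uniformly_approximable R K (F 0)" using near \<epsilon> by simp
  have coeff: "uniformly_approximable R K (a n)" for n
  proof (induction n rule: less_induct)
    case (less n)
    show ?case
    proof (rule uniformly_approximable_limit)
      fix \<delta> :: real assume "0 < \<delta>"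
      define c where "c = 2 * M' / \<rho> ^ n"
      have c: "0 < c" using M' \<rho> by (simp add: c_def)
      \<comment> \<open>With t = q \<rho> the second bound keeps t within the segment where
        \<open>F t\<close> is known to be approximable. The third makes the error
        \<open>c * q\<close> of the divided difference at most \<delta>/2.\<close>
      define q where "q = min (1/2) (min (\<epsilon> / (2 * \<rho>)) (\<delta> / (2 * c)))"
      have q: "0 < q" "q \<le> 1/2" "q \<le> \<epsilon> / (2 * \<rho>)" "q \<le> \<delta> / (2 * c)"
        using \<epsilon> \<rho> c \<open>0 < \<delta>\<close> by (auto simp: q_def)
      define t where "t = q * \<rho>"
      have t: "0 < t" using q \<rho> by (simp add: t_def)
      have "t \<le> \<epsilon> / 2" using q(3) \<rho> by (simp add: t_def field_simps)
      then have te: "\<bar>t\<bar> < \<epsilon>" using t \<epsilon> by simp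
      have "uniformly_approximable R K (\<lambda>x. (1 / t ^ n) *\<^sub>R (F t x + (-1) *\<^sub>R (\<Sum>k<n. t ^ k *\<^sub>R a k x)))"
        by (intro uniformly_approximable_scaleR uniformly_approximable_add near te uniformly_approximable_sum[OF zero] less)
      moreover have "norm (a n x - (1 / t ^ n) *\<^sub>R (F t x + (-1) *\<^sub>R (\<Sum>k<n. t ^ k *\<^sub>R a k x))) < \<delta>" if x: "x \<in> K" for x
      proof -
        \<comment> \<open>The n-th term is included, so the remainder has order t^(n+1) and is still
          of order t after division by t^n.\<close>
        have "norm (F t x - (\<Sum>k<Suc n. t ^ k *\<^sub>R a k x)) \<le> M' * q ^ Suc n * 2"
          using q t by (intro rem[OF x]) (auto simp: t_def)
        moreover have "a n x - (1 / t ^ n) *\<^sub>R (F t x + (-1) *\<^sub>R (\<Sum>k<n. t ^ k *\<^sub>R a k x))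
            = (- 1 / t ^ n) *\<^sub>R (F t x - (\<Sum>k<Suc n. t ^ k *\<^sub>R a k x))"
          using t by (simp add: algebra_simps)
        ultimately have "norm (a n x - (1 / t ^ n) *\<^sub>R (F t x + (-1) *\<^sub>R (\<Sum>k<n. t ^ k *\<^sub>R a k x)))
            \<le> (1 / t ^ n) * (M' * q ^ Suc n * 2)"
          using t by (simp add: divide_right_mono)
        also have "\<dots> = c * q" using q(1) \<rho> by (simp add: t_def c_def power_mult_distrib)
        also have "\<dots> \<le> \<delta> / 2" using q(4) c by (simp add: field_simps)
        also have "\<dots> < \<delta>" using \<open>0 < \<delta>\<close> by simp
        finally show ?thesis .
      qed
      ultimately show "\<exists>G. uniformly_approximable R K G \<and> (\<forall>x\<in>K. norm (a n x - G x) < \<delta>)" by blast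
    qed
  qed
  show ?thesis
  proof (rule uniformly_approximable_limit)
    fix \<delta> :: real assume "0 < \<delta>"
    then have "0 < \<delta> / (2 * M')" using M' by simp
    then obtain n where n: "(1/2 :: real) ^ n < \<delta> / (2 * M')" using real_arch_pow_inv[of "\<delta> / (2 * M')" "1/2"] by auto
    have "norm (F t x - (\<Sum>k<n. t ^ k *\<^sub>R a k x)) < \<delta>" if x: "x \<in> K" for x
    proof -
      have "norm (F t x - (\<Sum>k<n. t ^ k *\<^sub>R a k x)) \<le> M' * (1/2) ^ n * 2" using t by (intro rem[OF x]) auto
      also have "\<dots> < \<delta>" using n M' by (simp add: field_simps)
      finally show ?thesis .
    qed
    then show "\<exists>G. uniformly_approximable R K G \<and> (\<forall>x\<in>K. norm (F t x - G x) < \<delta>)"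
      using coeff by (intro exI[of _ "\<lambda>x. \<Sum>k<n. t ^ k *\<^sub>R a k x"] conjI uniformly_approximable_sum[OF zero] uniformly_approximable_scaleR) auto
  qed
qed

section \<open>The Newton Hessian as a power series in its pole\<close>

lemma norm_matrix_le_sum: "norm (A :: real^'n^'m) \<le> (\<Sum>i\<in>UNIV. \<Sum>k\<in>UNIV. \<bar>A $ i $ k\<bar>)"
proof -
  have "norm A \<le> (\<Sum>i\<in>UNIV. norm (A $ i))" unfolding norm_vec_def by (rule L2_set_le_sum) simp
  also have "\<dots> \<le> (\<Sum>i\<in>UNIV. \<Sum>k\<in>UNIV. \<bar>A $ i $ k\<bar>)" by (intro sum_mono norm_le_l1_cart)
  finally show ?thesis .
qed

text \<open>The entries of \<open>newton_hessian (w - t e)\<close> extend holomorphically in \<open>t\<close>: the square of the norm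
  becomes the polynomial \<open>\<bar>w\<bar>\<^sup>2 - 2 t (w \<bullet> e) + t\<^sup>2\<close>, whose real part is positive for small \<open>t\<close>.\<close>

definition cnorm_sq :: "real^3 \<Rightarrow> real^3 \<Rightarrow> complex \<Rightarrow> complex" where
  "cnorm_sq w e t = of_real ((norm w)\<^sup>2) - 2 * t * of_real (w \<bullet> e) + t\<^sup>2"

definition chessian :: "real^3 \<Rightarrow> real^3 \<Rightarrow> 3 \<Rightarrow> 3 \<Rightarrow> complex \<Rightarrow> complex" where
  "chessian w e i k t =
     (3 * (of_real (w $ i) - t * of_real (e $ i)) * (of_real (w $ k) - t * of_real (e $ k))
       - (if i = k then cnorm_sq w e t else 0)) / ((cnorm_sq w e t)\<^sup>2 * csqrt (cnorm_sq w e t))"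

text \<open>For |t| \<le> |w|/3 the linear and the quadratic term cost at most 2/3 and 1/9 of |w|^2,
  which leaves 2/9. A positive real part keeps the argument of \<open>csqrt\<close> off its branch
  cut.\<close>

lemma Re_cnorm_sq:
  assumes e: "norm e = 1" and t: "norm t \<le> norm w / 3"
  shows "2 / 9 * (norm w)\<^sup>2 \<le> Re (cnorm_sq w e t)"
proof -
  have we: "\<bar>w \<bullet> e\<bar> \<le> norm w" using Cauchy_Schwarz_ineq2[of w e] e by simp
  have "\<bar>Re (2 * t * of_real (w \<bullet> e))\<bar> \<le> norm (2 * t * of_real (w \<bullet> e))" by (rule abs_Re_le_cmod)
  also have "\<dots> = 2 * norm t * \<bar>w \<bullet> e\<bar>" by (simp add: norm_mult)
  also have "\<dots> \<le> 2 * (norm w / 3) * norm w" using t we by (intro mult_mono) auto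
  finally have 1: "\<bar>Re (2 * t * of_real (w \<bullet> e))\<bar> \<le> 2 / 3 * (norm w)\<^sup>2" by (simp add: power2_eq_square)
  have "\<bar>Re (t\<^sup>2)\<bar> \<le> (norm t)\<^sup>2" using abs_Re_le_cmod[of "t\<^sup>2"] by (simp add: norm_power)
  also have "\<dots> \<le> (norm w / 3)\<^sup>2" using t by (intro power_mono) auto
  finally have 2: "\<bar>Re (t\<^sup>2)\<bar> \<le> 1 / 9 * (norm w)\<^sup>2" by (simp add: power_divide)
  have "Re (cnorm_sq w e t) = (norm w)\<^sup>2 - Re (2 * t * of_real (w \<bullet> e)) + Re (t\<^sup>2)"
    by (simp add: cnorm_sq_def)
  then show ?thesis using 1 2 by linarith
qed

lemma cnorm_sq_of_real:
  assumes "norm e = 1" shows "cnorm_sq w e (of_real t) = of_real ((norm (w - t *\<^sub>R e))\<^sup>2)"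
proof -
  have "(norm (w - t *\<^sub>R e))\<^sup>2 = (norm w)\<^sup>2 - 2 * t * (w \<bullet> e) + t\<^sup>2 * (norm e)\<^sup>2"
    unfolding power2_norm_eq_inner by (simp add: inner_diff_left inner_diff_right inner_commute algebra_simps power2_eq_square)
  then show ?thesis using assms by (simp add: cnorm_sq_def)
qed

lemma chessian_of_real:
  assumes "norm e = 1" shows "chessian w e i k (of_real t) = of_real (newton_hessian (w - t *\<^sub>R e) $ i $ k)"
proof -
  let ?n = "norm (w - t *\<^sub>R e)"
  have "csqrt (of_real (?n\<^sup>2)) = of_real ?n"
    by (subst csqrt_of_real_nonneg) auto
  moreover have "(?n\<^sup>2)\<^sup>2 * ?n = ?n ^ 5" by (simp add: eval_nat_numeral)
  then have "(complex_of_real (?n\<^sup>2))\<^sup>2 * of_real ?n = of_real (?n ^ 5)" by (metis of_real_mult of_real_power)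
  ultimately show ?thesis
    unfolding chessian_def cnorm_sq_of_real[OF assms] newton_hessian_nth by simp
qed

lemma chessian_holomorphic:
  assumes e: "norm e = 1" and w: "w \<noteq> 0" shows "chessian w e i k holomorphic_on ball 0 (norm w / 3)"
proof -
  have pos: "0 < Re (cnorm_sq w e t)" if "t \<in> ball 0 (norm w / 3)" for t
  proof -
    have "0 < 2 / 9 * (norm w)\<^sup>2" using w by simp
    also have "\<dots> \<le> Re (cnorm_sq w e t)" using that by (intro Re_cnorm_sq[OF e]) auto
    finally show ?thesis .
  qed
  have h: "cnorm_sq w e holomorphic_on ball 0 (norm w / 3)"
    unfolding cnorm_sq_def[abs_def] by (intro holomorphic_intros)
  have "cnorm_sq w e t \<notin> \<real>\<^sub>\<le>\<^sub>0" if "t \<in> ball 0 (norm w / 3)" for t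
    using pos[OF that] by (auto simp: complex_nonpos_Reals_iff)
  moreover have "cnorm_sq w e t \<noteq> 0" if "t \<in> ball 0 (norm w / 3)" for t
    using pos[OF that] by auto
  ultimately show ?thesis
    unfolding chessian_def[abs_def] using h
    by (cases "i = k") (auto intro!: holomorphic_intros simp: power2_eq_square)
qed

text \<open>The bound is uniform over all w in the shell between the radii d and W, so that one
  constant serves all points of a compact set at once.\<close>

lemma norm_chessian_le:
  assumes e: "norm e = 1" and t: "norm t \<le> d / 4" and w: "d \<le> norm w" "norm w \<le> W" "0 < d"
  shows "norm (chessian w e i k t) \<le> 4 * (2 * W)\<^sup>2 / ((2 / 9 * d\<^sup>2)\<^sup>2 * sqrt (2 / 9 * d\<^sup>2))"
proof -
  let ?q = "cnorm_sq w e t"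
  have tw: "norm t \<le> norm w / 3" "norm t \<le> W" using t w by auto
  have low: "2 / 9 * d\<^sup>2 \<le> norm ?q"
  proof -
    have "2 / 9 * d\<^sup>2 \<le> 2 / 9 * (norm w)\<^sup>2" using w by (intro mult_left_mono power_mono) auto
    also have "\<dots> \<le> norm ?q" using Re_cnorm_sq[OF e tw(1)] complex_Re_le_cmod order.trans by blast
    finally show ?thesis .
  qed
  have comp: "norm (complex_of_real (w $ j) - t * of_real (e $ j)) \<le> 2 * W" for j
  proof -
    have "norm (complex_of_real (w $ j) - t * of_real (e $ j)) \<le> \<bar>w $ j\<bar> + norm t * \<bar>e $ j\<bar>"
      using norm_triangle_ineq4[of "complex_of_real (w $ j)" "t * of_real (e $ j)"] by (simp add: norm_mult)
    also have "\<dots> \<le> norm w + norm t * 1"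
      using component_le_norm_cart[of w j] component_le_norm_cart[of e j] e
      by (intro add_mono mult_left_mono) auto
    finally show ?thesis using tw w by simp
  qed
  have qle: "norm ?q \<le> (2 * W)\<^sup>2"
  proof -
    have we: "\<bar>w \<bullet> e\<bar> \<le> norm w" using Cauchy_Schwarz_ineq2[of w e] e by simp
    have "norm ?q \<le> (norm w)\<^sup>2 + 2 * norm t * \<bar>w \<bullet> e\<bar> + (norm t)\<^sup>2"
      unfolding cnorm_sq_def
      using norm_triangle_ineq[of "of_real ((norm w)\<^sup>2) - 2 * t * of_real (w \<bullet> e)" "t\<^sup>2"]
        norm_triangle_ineq4[of "complex_of_real ((norm w)\<^sup>2)" "2 * t * of_real (w \<bullet> e)"]
      by (simp add: norm_mult norm_power)
    also have "\<dots> \<le> (norm w)\<^sup>2 + 2 * norm t * norm w + (norm t)\<^sup>2"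
      using we by (intro add_mono mult_left_mono) auto
    also have "\<dots> = (norm w + norm t)\<^sup>2" by (simp add: power2_eq_square algebra_simps)
    also have "\<dots> \<le> (2 * W)\<^sup>2" using tw w by (intro power_mono) auto
    finally show ?thesis .
  qed
  have num: "norm (3 * (of_real (w $ i) - t * of_real (e $ i)) * (of_real (w $ k) - t * of_real (e $ k))
       - (if i = k then ?q else 0)) \<le> 4 * (2 * W)\<^sup>2"
  proof -
    have "norm (3 * (complex_of_real (w $ i) - t * of_real (e $ i)) * (of_real (w $ k) - t * of_real (e $ k)))
      \<le> 3 * (2 * W) * (2 * W)"
      unfolding norm_mult using comp[of i] comp[of k] w by (intro mult_mono) auto
    moreover have "norm (if i = k then ?q else 0) \<le> (2 * W)\<^sup>2" using qle by auto
    ultimately show ?thesis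
      by (intro order.trans[OF norm_triangle_ineq4]) (simp add: power2_eq_square)
  qed
  have "(norm (csqrt ?q))\<^sup>2 = norm ?q" by (simp flip: norm_power)
  then have "norm (csqrt ?q) = sqrt (norm ?q)" by (metis norm_ge_zero real_sqrt_unique)
  then have den: "(2 / 9 * d\<^sup>2)\<^sup>2 * sqrt (2 / 9 * d\<^sup>2) \<le> norm (?q\<^sup>2 * csqrt ?q)"
    unfolding norm_mult norm_power using low w by (auto intro!: mult_mono power_mono real_sqrt_le_mono)
  show ?thesis
    unfolding chessian_def norm_divide using num den w by (intro frac_le) auto
qed

text \<open>The coefficients are real parts of complex Taylor coefficients, estimated by Cauchy's
  inequality on the circle of radius d/4. This circle lies inside the disc of radius |w|/3 where the
  entries are holomorphic. The factor 9 counts the entries.\<close>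

lemma newton_hessian_power_series:
  assumes e: "norm e = 1" and d: "0 < d"
  obtains a M where "\<And>n w. d \<le> norm w \<Longrightarrow> norm w \<le> W \<Longrightarrow> norm (a n w :: real^3^3) \<le> M / (d / 4) ^ n"
    "\<And>t w. d \<le> norm w \<Longrightarrow> norm w \<le> W \<Longrightarrow> \<bar>t\<bar> < d / 4 \<Longrightarrow> (\<lambda>n. t ^ n *\<^sub>R a n w) sums newton_hessian (w - t *\<^sub>R e)"
proof -
  define B where "B = 4 * (2 * W)\<^sup>2 / ((2 / 9 * d\<^sup>2)\<^sup>2 * sqrt (2 / 9 * d\<^sup>2))"
  define a :: "nat \<Rightarrow> real^3 \<Rightarrow> real^3^3"
    where "a n w = (\<chi> i k. Re ((deriv ^^ n) (chessian w e i k) 0 / fact n))" for n w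
  have "norm (a n w) \<le> (9 * B) / (d / 4) ^ n" if w: "d \<le> norm w" "norm w \<le> W" for n w
  proof -
    have "\<bar>a n w $ i $ k\<bar> \<le> B / (d / 4) ^ n" for i k
    proof -
      have hol: "chessian w e i k holomorphic_on ball 0 (norm w / 3)"
        using w d by (intro chessian_holomorphic[OF e]) auto
      have sub: "cball 0 (d / 4) \<subseteq> ball (0 :: complex) (norm w / 3)" using w d by (intro subsetI) auto
      have "norm ((deriv ^^ n) (chessian w e i k) 0) \<le> fact n * B / (d / 4) ^ n"
      proof (rule Cauchy_inequality)
        show "chessian w e i k holomorphic_on ball 0 (d / 4)"
          using hol sub ball_subset_cball holomorphic_on_subset by blast
        show "continuous_on (cball 0 (d / 4)) (chessian w e i k)"
          using hol sub holomorphic_on_subset holomorphic_on_imp_continuous_on by blast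
        fix t :: complex assume "norm (0 - t) = d / 4"
        then show "norm (chessian w e i k t) \<le> B"
          unfolding B_def using w d by (intro norm_chessian_le[OF e]) auto
      qed (use d in simp)
      then have "norm ((deriv ^^ n) (chessian w e i k) 0 / fact n) \<le> B / (d / 4) ^ n"
        by (simp add: norm_divide field_simps)
      then show ?thesis using abs_Re_le_cmod order.trans unfolding a_def by fastforce
    qed
    then have "(\<Sum>i\<in>UNIV. \<Sum>k\<in>UNIV. \<bar>a n w $ i $ k\<bar>) \<le> (\<Sum>i\<in>(UNIV :: 3 set). \<Sum>k\<in>(UNIV :: 3 set). B / (d / 4) ^ n)"
      by (intro sum_mono)
    then show ?thesis using norm_matrix_le_sum[of "a n w"] by simp
  qed
  moreover have "(\<lambda>n. t ^ n *\<^sub>R a n w) sums newton_hessian (w - t *\<^sub>R e)"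
    if w: "d \<le> norm w" "norm w \<le> W" and t: "\<bar>t\<bar> < d / 4" for t w
  proof -
    have "(\<lambda>n. (t ^ n *\<^sub>R a n w) $ i $ k) sums (newton_hessian (w - t *\<^sub>R e) $ i $ k)" for i k
    proof -
      have "chessian w e i k holomorphic_on ball 0 (norm w / 3)"
        using w d by (intro chessian_holomorphic[OF e]) auto
      moreover have "complex_of_real t \<in> ball 0 (norm w / 3)" using t w by simp
      ultimately have "(\<lambda>n. (deriv ^^ n) (chessian w e i k) 0 / fact n * (of_real t - 0) ^ n) sums chessian w e i k (of_real t)"
        by (rule holomorphic_power_series)
      from sums_Re[OF this] have "(\<lambda>n. Re ((deriv ^^ n) (chessian w e i k) 0 / fact n * of_real (t ^ n))) sums
        newton_hessian (w - t *\<^sub>R e) $ i $ k"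
        unfolding chessian_of_real[OF e] by simp
      moreover have "Re (z * of_real (t ^ n)) = t ^ n * Re z" for z n by simp
      ultimately show ?thesis by (simp only: a_def vector_scaleR_component vec_lambda_beta real_scaleR_def)
    qed
    then show ?thesis unfolding sums_def
      by (intro vec_tendstoI) (simp add: sum_component)
  qed
  ultimately show ?thesis by (rule that)
qed

text \<open>The interior of the set of admissible poles is open and closed in the complement of \<open>K\<close>, because the
  distance by which a pole can be moved only depends on its distance to \<open>K\<close>.\<close>

theorem uniformly_approximable_newton_hessian:
  assumes K: "compact K" and conn: "connected (- K)" and y: "y \<notin> K"
  shows "uniformly_approximable R K (\<lambda>x. newton_hessian (x - y))"
proof -
  define G where "G = {y. y \<notin> K \<and> uniformly_approximable R K (\<lambda>x. newton_hessian (x - y))}"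
  have bK: "bounded K" using K by (rule compact_imp_bounded)
  then obtain B where B: "\<And>x. x \<in> K \<Longrightarrow> norm x \<le> B" by (auto simp: bounded_iff)
  \<comment> \<open>The radius d/8 is half of the radius of convergence d/4, as far as the
    continuation lemma reaches. That \<open>y1\<close> is an interior point supplies the short
    segment of admissible poles from which continuation starts.\<close>
  have push: "ball y1 (d / 8) \<subseteq> G" if y1: "y1 \<in> interior G" and d: "0 < d" "\<And>x. x \<in> K \<Longrightarrow> d \<le> norm (x - y1)" for y1 d
  proof
    fix z assume z: "z \<in> ball y1 (d / 8)"
    show "z \<in> G"
    proof (cases "z = y1")
      case True then show ?thesis using y1 interior_subset by blast
    next
      case False
      define t where "t = norm (z - y1)"
      define e where "e = (1 / t) *\<^sub>R (z - y1)"
      have t: "0 < t" "t < d / 8" using z False by (auto simp: t_def dist_norm norm_minus_commute)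
      have e: "norm e = 1" using t(1) by (simp add: e_def t_def)
      have ze: "z = y1 + t *\<^sub>R e" using t(1) by (simp add: e_def)
      obtain r where r: "0 < r" "ball y1 r \<subseteq> G" using y1 by (auto simp: mem_interior)
      obtain a M where a: "\<And>n w. d \<le> norm w \<Longrightarrow> norm w \<le> B + norm y1 \<Longrightarrow> norm (a n w :: real^3^3) \<le> M / (d / 4) ^ n"
        "\<And>t w. d \<le> norm w \<Longrightarrow> norm w \<le> B + norm y1 \<Longrightarrow> \<bar>t\<bar> < d / 4 \<Longrightarrow> (\<lambda>n. t ^ n *\<^sub>R a n w) sums newton_hessian (w - t *\<^sub>R e)"
        using newton_hessian_power_series[OF e d(1)] by blast
      have nw: "norm (x - y1) \<le> B + norm y1" if "x \<in> K" for x
        using norm_triangle_ineq4[of x y1] B[OF that] by linarith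
      have "uniformly_approximable R K (\<lambda>x. newton_hessian ((x - y1) - t *\<^sub>R e))"
      proof (rule uniformly_approximable_analytic_continuation[where \<rho> = "d / 4" and \<epsilon> = r and M = M and
            a = "\<lambda>n x. a n (x - y1)" and F = "\<lambda>t x. newton_hessian ((x - y1) - t *\<^sub>R e)"])
        fix s :: real assume "\<bar>s\<bar> < r"
        then have "y1 + s *\<^sub>R e \<in> G" using r(2) e by (auto simp: dist_norm subset_iff)
        then show "uniformly_approximable R K (\<lambda>x. newton_hessian ((x - y1) - s *\<^sub>R e))"
          by (simp add: G_def diff_diff_eq)
      qed (use d a nw r t in auto)
      then have "uniformly_approximable R K (\<lambda>x. newton_hessian (x - z))" by (simp add: ze diff_diff_eq)
      moreover have "z \<notin> K"
      proof
        assume "z \<in> K"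
        from d(2)[OF this] have "d \<le> t" by (simp add: t_def)
        with t show False by linarith
      qed
      ultimately show ?thesis by (simp add: G_def)
    qed
  qed
  have "- K \<subseteq> interior G"
  proof -
    have sub: "interior G \<subseteq> - K" using interior_subset[of G] by (auto simp: G_def)
    \<comment> \<open>A pole outside the ball of radius R gives a harmonic Hessian itself; exceeding
      \<open>B\<close> keeps it away from \<open>K\<close>.\<close>
    have far: "z \<in> G" if "max R B < norm z" for z
    proof -
      have "z \<notin> K" using B[of z] that by auto
      then show ?thesis
        using that by (simp add: G_def uniformly_approximable_harmonic harmonic_hessian_newton)
    qed
    obtain z0 :: "real^3" where z0: "norm z0 = max (\<bar>R\<bar>) (\<bar>B\<bar>) + 1"
      using vector_choose_size[of "max (\<bar>R\<bar>) (\<bar>B\<bar>) + 1"] by auto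
    have "open {z :: real^3. max R B < norm z}" by (intro open_Collect_less continuous_intros)
    then have "{z :: real^3. max R B < norm z} \<subseteq> interior G" using far by (intro interior_maximal) auto
    moreover have "z0 \<in> {z. max R B < norm z}" using z0 by auto
    ultimately have ne: "interior G \<noteq> {}" by blast
    have cl: "z \<in> interior G" if z: "z \<in> closure (interior G)" "z \<notin> K" for z
    proof -
      have "open (- K)" using K by (simp add: compact_imp_closed open_Compl)
      then obtain d0 where d0: "0 < d0" "ball z d0 \<subseteq> - K" using z(2) open_contains_ball by (meson ComplI)
      \<comment> \<open>Close to z, \<open>y1\<close> has distance at least d0/2 from
        \<open>K\<close>, so it can be pushed by d0/16, far enough to cover z.\<close>
      obtain y1 where y1: "y1 \<in> interior G" "dist y1 z < d0 / 16"
        using z(1) d0(1) closure_approachable[of z "interior G"] by (metis divide_pos_pos zero_less_numeral)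
      have "d0 / 2 \<le> norm (x - y1)" if "x \<in> K" for x
      proof -
        have "d0 \<le> dist z x" using d0(2) that by (meson ComplD linorder_not_less mem_ball subsetD)
        also have "\<dots> \<le> dist z y1 + dist y1 x" by (rule dist_triangle)
        finally show ?thesis using y1(2) d0(1) by (simp add: dist_norm norm_minus_commute)
      qed
      then have "ball y1 (d0 / 2 / 8) \<subseteq> G" using y1(1) d0(1) by (intro push) auto
      then have "ball y1 (d0 / 2 / 8) \<subseteq> interior G" by (intro interior_maximal) auto
      then show ?thesis using y1(2) by auto
    qed
    have "closedin (top_of_set (- K)) (interior G)"
      unfolding closedin_closed using cl closure_subset[of "interior G"] sub
      by (intro exI[of _ "closure (interior G)"]) auto
    moreover have "openin (top_of_set (- K)) (interior G)"
      using sub by (simp add: open_subset)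
    ultimately have "interior G = - K"
      using conn ne unfolding connected_clopen by blast
    then show ?thesis by simp
  qed
  then show ?thesis using y interior_subset by (auto simp: G_def)
qed

section \<open>Localisation\<close>

context graph_chart
begin

text \<open>The inverse of the coordinates formed by horizontal projection and height, which
  straighten the boundary.\<close>

definition from_chart :: "(real^2) \<times> real \<Rightarrow> real^3" where
  "from_chart = (\<lambda>(a, s). up s (graph a))"

lemma height_from_chart [simp]: "height (from_chart (a, s)) = s"
  by (simp add: from_chart_def)

lemma from_chart_of [simp]: "from_chart (proj2 (Q x), height x) = x"
proof -
  define y where "y = up (- height x) x"
  have "height y = 0" by (simp add: y_def)
  moreover have "proj2 (Q y) = proj2 (Q x)"
    by (simp add: y_def up_def linear_add[OF linear_Q] linear_cmul[OF linear_Q] linear_neg[OF linear_Q] linear_diff[OF linear_Q] vec_eq_iff forall_2 axis_def)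
  ultimately have "graph (proj2 (Q x)) = y" using graph_proj2 by metis
  then show ?thesis by (simp add: from_chart_def y_def up_def)
qed

lemma continuous_on_from_chart: "continuous_on S from_chart"
  unfolding from_chart_def up_def graph_def split_beta'
  by (intro continuous_intros continuous_on_compose2[OF cont]) auto

text \<open>In straightened coordinates \<open>D \<inter> W\<close> is a disc times an open interval
  of positive heights, a convex set.\<close>

lemma connected_neighbourhood:
  assumes p: "p \<in> frontier D"
  obtains W where "open W" "p \<in> W" "connected (D \<inter> W)"
proof -
  have hp: "height p = 0" using p r_pos frontier_iff by simp
  let ?c = "(proj2 (Q p), height p)"
  have "open (from_chart -` ball p r)"
    by (rule open_vimage[OF open_ball continuous_on_from_chart])
  moreover have "?c \<in> from_chart -` ball p r" using r_pos by simp
  ultimately obtain e where e: "0 < e" "ball ?c e \<subseteq> from_chart -` ball p r"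
    using open_contains_ball by meson
  define \<rho> where "\<rho> = e / 2"
  have \<rho>: "0 < \<rho>" using e by (simp add: \<rho>_def)
  let ?A = "ball (proj2 (Q p)) \<rho>"
  have sub: "from_chart (a, s) \<in> ball p r" if "a \<in> ?A" "\<bar>s\<bar> < \<rho>" for a s
  proof -
    have "dist ?c (a, s) \<le> dist (proj2 (Q p)) a + dist (height p) s"
      unfolding dist_Pair_Pair by (rule sqrt_sum_squares_le_sum) auto
    also have "\<dots> < e" using that hp by (auto simp: \<rho>_def dist_real_def)
    finally show ?thesis using e(2) by auto
  qed
  define W where "W = {x. dist (proj2 (Q p)) (proj2 (Q x)) < \<rho>} \<inter> {x. \<bar>height x\<bar> < \<rho>}"
  have "open W" unfolding W_def by (intro open_Int open_Collect_less continuous_intros)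
  moreover have "p \<in> W" using \<rho> hp by (simp add: W_def)
  moreover have "D \<inter> W = from_chart ` (?A \<times> {0<..<\<rho>})"
  proof
    show "D \<inter> W \<subseteq> from_chart ` (?A \<times> {0<..<\<rho>})"
    proof
      fix x assume x: "x \<in> D \<inter> W"
      then have "x \<in> ball p r" using sub[of "proj2 (Q x)" "height x"] by (auto simp: W_def)
      then have "0 < height x" using x in_D_iff by auto
      then have "(proj2 (Q x), height x) \<in> ?A \<times> {0<..<\<rho>}" using x by (auto simp: W_def)
      then show "x \<in> from_chart ` (?A \<times> {0<..<\<rho>})"
        by (rule rev_image_eqI) simp
    qed
    show "from_chart ` (?A \<times> {0<..<\<rho>}) \<subseteq> D \<inter> W"
    proof
      fix x assume "x \<in> from_chart ` (?A \<times> {0<..<\<rho>})"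
      then obtain a s where as: "x = from_chart (a, s)" "a \<in> ?A" "0 < s" "s < \<rho>" by auto
      have "x \<in> ball p r" using sub as by auto
      then have "x \<in> D" using in_D_iff as by simp
      moreover have "proj2 (Q x) = a"
        by (simp add: as from_chart_def up_def linear_add[OF linear_Q] linear_cmul[OF linear_Q] vec_eq_iff forall_2 axis_def)
          (simp flip: proj2_nth)
      ultimately show "x \<in> D \<inter> W" using as by (simp add: W_def)
    qed
  qed
  moreover have "connected (from_chart ` (?A \<times> {0<..<\<rho>}))"
    by (intro connected_continuous_image continuous_on_from_chart convex_connected convex_Times convex_ball convex_real_interval)
  ultimately show ?thesis using that by metis
qed

end

text \<open>A common boundary point would have arbitrarily small neighbourhoods in which \<open>D1 \<union> D2\<close> is connected.\<close>

lemma disjoint_closures_lipschitz_boundary: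
  assumes "open D1" "open D2" "D1 \<inter> D2 = {}" "lipschitz_boundary (D1 \<union> D2)"
  shows "closure D1 \<inter> closure D2 = {}"
proof (rule ccontr)
  assume "closure D1 \<inter> closure D2 \<noteq> {}"
  then obtain p where p: "p \<in> closure D1" "p \<in> closure D2" by auto
  have "p \<notin> D1" "p \<notin> D2"
    using p assms open_Int_closure_eq_empty[of D1 D2] open_Int_closure_eq_empty[of D2 D1] by auto
  then have "p \<in> frontier (D1 \<union> D2)" using p assms by (auto simp: frontier_def interior_open open_Un)
  then obtain r Q \<gamma> where "graph_chart (D1 \<union> D2) p r Q \<gamma>"
    using boundary_of_class_chart[OF assms(4) lipschitz_function_locally_lipschitz open_Un[OF assms(1,2)]] by blast
  then obtain W where W: "open W" "p \<in> W" "connected ((D1 \<union> D2) \<inter> W)"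
    using graph_chart.connected_neighbourhood \<open>p \<in> frontier (D1 \<union> D2)\<close> by metis
  have "W \<inter> D1 \<noteq> {}" "W \<inter> D2 \<noteq> {}"
    using W p open_Int_closure_eq_empty[OF W(1)] by blast+
  then show False using W(3) assms(1-3) unfolding connected_def by blast
qed

lemma frontier_exterior_near:
  assumes "open D" "lipschitz_boundary D" "p \<in> frontier D" "0 < e"
  shows "\<exists>y. y \<notin> closure D \<and> dist y p < e"
proof -
  obtain r Q \<gamma> where "graph_chart D p r Q \<gamma>"
    using boundary_of_class_chart[OF assms(2) lipschitz_function_locally_lipschitz assms(1,3)] by blast
  then show ?thesis
    using graph_chart.exterior_near[OF _ _ assms(3,4)] graph_chart.r_pos by fastforce
qed

section \<open>Blow-up at a touching ball\<close>

text \<open>For any q in D let p be a nearest boundary point. The ball around q of radius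
  \<open>dist q p\<close> meets D but not its boundary, so by connectedness it stays in D.\<close>

lemma interior_touching_ball:
  fixes D :: "'a::euclidean_space set"
  assumes "open D" "bounded D" "D \<noteq> {}"
  obtains p q r where "p \<in> frontier D" "0 < r" "ball q r \<subseteq> D" "dist q p = r"
proof -
  obtain q where q: "q \<in> D" using assms by auto
  have "frontier D \<noteq> {}" using assms by (metis frontier_not_empty not_bounded_UNIV)
  then obtain p where p: "p \<in> frontier D" "\<And>y. y \<in> frontier D \<Longrightarrow> dist q p \<le> dist q y"
    using distance_attains_inf[OF frontier_closed] by metis
  have r: "0 < dist q p" using q p(1) assms(1) by (auto simp: frontier_def interior_open)
  have "ball q (dist q p) \<subseteq> D"
  proof (rule ccontr)
    assume "\<not> ball q (dist q p) \<subseteq> D"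
    then have "ball q (dist q p) \<inter> frontier D \<noteq> {}"
    proof (intro connected_Int_frontier)
      show "ball q (dist q p) \<inter> D \<noteq> {}" using q r centre_in_ball by blast
    qed auto
    then show False using p(2) by force
  qed
  then show ?thesis using that p r by blast
qed

lemma L2_norm_le_bound:
  fixes f :: "'a::euclidean_space \<Rightarrow> 'b::euclidean_space"
  assumes f: "square_integrable (lebesgue_on S) f" and S: "S \<in> lmeasurable" and b: "\<And>x. x \<in> S \<Longrightarrow> norm (f x) \<le> b" "0 \<le> b"
  shows "L2_norm (lebesgue_on S) f \<le> b * sqrt (measure lebesgue S)"
proof -
  have Sm: "S \<in> sets lebesgue" using S by auto
  have "(LINT x|lebesgue_on S. (norm (f x))\<^sup>2) \<le> (LINT x|lebesgue_on S. b\<^sup>2)"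
  proof (rule integral_mono)
    have "finite_measure (lebesgue_on S)"
      using S Sm by (intro finite_measureI) (simp add: emeasure_restrict_space fmeasurable_def less_top)
    then show "integrable (lebesgue_on S) (\<lambda>x. b\<^sup>2)" by (rule finite_measure.integrable_const)
    show "(norm (f x))\<^sup>2 \<le> b\<^sup>2" if "x \<in> space (lebesgue_on S)" for x
      using that b by (intro power_mono) auto
  qed (use f in \<open>simp add: square_integrable_def\<close>)
  also have "\<dots> = b\<^sup>2 * measure lebesgue S" using Sm by (simp add: measure_restrict_space)
  finally have "L2_norm (lebesgue_on S) f \<le> sqrt (b\<^sup>2 * measure lebesgue S)"
    unfolding L2_norm_def by (rule real_sqrt_le_mono)
  then show ?thesis using b(2) by (simp add: real_sqrt_mult)
qed

text \<open>A ball of radius s touching p fits into the given one, and all its points are within 3s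
  of the pole. There the squared Hessian is at least 6/(3s)^6, where 3^6 = 729, and multiplying by a
  volume of order s^3 leaves order 1/s^3.\<close>

lemma L2_norm_newton_hessian_lower:
  assumes K: "compact K" "y \<notin> K" "D \<subseteq> K" "open D" and q: "ball q r \<subseteq> D" "dist q p = r"
    and s: "0 < s" "s \<le> r" and y: "dist y p < s"
  shows "6 * unit_ball_vol 3 / (729 * s ^ 3) \<le> (L2_norm (lebesgue_on D) (\<lambda>x. newton_hessian (x - y)))\<^sup>2"
proof -
  \<comment> \<open>The point at distance s from p on the way to q; its distance from q is r -
    s.\<close>
  define c where "c = p + (s / r) *\<^sub>R (q - p)"
  have r: "0 < r" using s by linarith
  have cp: "dist c p = s"
    using r s q(2) by (simp add: c_def dist_norm)
  have "c - q = (1 - s / r) *\<^sub>R (p - q)" by (simp add: c_def algebra_simps)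
  then have "dist c q = (1 - s / r) * r"
    using r s q(2) by (simp add: dist_norm norm_minus_commute)
  also have "\<dots> = r - s" using r by (simp add: left_diff_distrib)
  finally have cq: "dist c q = r - s" .
  have sub: "ball c s \<subseteq> D"
  proof
    fix x assume "x \<in> ball c s"
    then have "dist q x < r" using cq dist_triangle[of q x c] by (simp add: dist_commute)
    then show "x \<in> D" using q(1) by auto
  qed
  have low: "6 / (729 * s ^ 6) \<le> (norm (newton_hessian (x - y)))\<^sup>2" if x: "x \<in> ball c s" for x
  proof -
    have "x \<noteq> y" using x sub K by auto
    have "dist x y \<le> dist x c + dist c p + dist p y"
      using dist_triangle[of x y c] dist_triangle[of c y p] by linarith
    then have "norm (x - y) \<le> 3 * s" using x y cp by (simp add: dist_norm norm_minus_commute)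
    then have "norm (x - y) ^ 6 \<le> (3 * s) ^ 6" by (intro power_mono) auto
    then have "6 / (3 * s) ^ 6 \<le> 6 / norm (x - y) ^ 6"
      using \<open>x \<noteq> y\<close> s by (intro divide_left_mono) auto
    then show ?thesis by (simp add: norm_newton_hessian power_mult_distrib)
  qed
  have Dm: "D \<in> sets lebesgue" using K(4) by auto
  have cont: "continuous_on K (\<lambda>x. newton_hessian (x - y))"
    using K(2) by (intro continuous_on_newton_hessian continuous_intros) auto
  have sq: "square_integrable (lebesgue_on D) (\<lambda>x. newton_hessian (x - y))"
    by (rule square_integrable_lebesgue_on[OF cont K(1) Dm K(3)])
  have bm: "ball c s \<in> sets (lebesgue_on D)" using sub Dm by (auto simp: sets_restrict_space_iff)
  have mb: "measure (lebesgue_on D) (ball c s) = unit_ball_vol 3 * s ^ 3"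
  proof -
    have "measure (lebesgue_on D) (ball c s) = measure lebesgue (ball c s)"
      using sub Dm by (intro measure_restrict_space) auto
    also have "\<dots> = unit_ball_vol 3 * s ^ 3" using s content_ball[of s c] by simp
    finally show ?thesis .
  qed
  have eb: "emeasure (lebesgue_on D) (ball c s) < \<infinity>"
    using sub Dm emeasure_lborel_ball_finite[of c s] by (simp add: emeasure_restrict_space less_top)
  have "6 * unit_ball_vol 3 / (729 * s ^ 3) = (LINT x|lebesgue_on D. indicator (ball c s) x * (6 / (729 * s ^ 6)))"
  proof -
    have "ball c s \<inter> D = ball c s" using sub by auto
    then show ?thesis using s mb by (simp add: eval_nat_numeral field_simps)
  qed
  also have "\<dots> \<le> (LINT x|lebesgue_on D. (norm (newton_hessian (x - y)))\<^sup>2)"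
  proof (rule integral_mono)
    show "integrable (lebesgue_on D) (\<lambda>x. indicator (ball c s) x * (6 / (729 * s ^ 6)))"
      using bm eb by (intro integrable_mult_left integrable_real_indicator) auto
    show "integrable (lebesgue_on D) (\<lambda>x. (norm (newton_hessian (x - y)))\<^sup>2)"
      using sq by (simp add: square_integrable_def)
    show "indicator (ball c s) x * (6 / (729 * s ^ 6)) \<le> (norm (newton_hessian (x - y)))\<^sup>2" for x
      using low[of x] by (cases "x \<in> ball c s") auto
  qed
  finally show ?thesis by (simp add: L2_norm_squared)
qed

lemma localized_hessians:
  fixes D1 D2 :: "(real^3) set"
  assumes D: "open D1" "open D2" "D1 \<inter> D2 = {}" "D2 \<noteq> {}" "lipschitz_boundary (D1 \<union> D2)"
    and K: "compact (closure (D1 \<union> D2))" and conn: "connected (- closure (D1 \<union> D2))"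
    and R: "closure (D1 \<union> D2) \<subseteq> ball 0 R"
  shows "\<exists>B J. 0 \<le> B \<and> (\<forall>j. harmonic_hessian R (J j)) \<and> (\<forall>j. \<forall>x\<in>D1. norm (J j x) \<le> B / real (Suc j)) \<and>
    filterlim (\<lambda>j :: nat. L2_norm (lebesgue_on D2) (J j)) at_top sequentially"
proof -
  let ?K = "closure (D1 \<union> D2)"
  have disj: "closure D1 \<inter> closure D2 = {}" by (rule disjoint_closures_lipschitz_boundary[OF D(1-3,5)])
  have sub: "D1 \<subseteq> ?K" "D2 \<subseteq> ?K" using closure_subset[of "D1 \<union> D2"] by auto
  have D2m: "D2 \<in> sets lebesgue" using D(2) by auto
  have bK: "bounded ?K" using K compact_imp_bounded by blast
  have D2l: "D2 \<in> lmeasurable" using D(2) bK sub bounded_subset by (blast intro: lmeasurable_open)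
  obtain p q r where pqr: "p \<in> frontier D2" "0 < r" "ball q r \<subseteq> D2" "dist q p = r"
    by (rule interior_touching_ball[OF D(2) bounded_subset[OF bK sub(2)] D(4)])
  have pD1: "p \<notin> closure D1" using pqr(1) disj by (auto simp: frontier_def)
  have pf: "p \<in> frontier (D1 \<union> D2)"
  proof -
    have "p \<notin> D1" using pD1 closure_subset by blast
    moreover have "p \<notin> D2" "p \<in> closure D2" using pqr(1) D(2) by (auto simp: frontier_def interior_open)
    moreover have "closure D2 \<subseteq> ?K" by (intro closure_mono) auto
    ultimately show ?thesis unfolding frontier_def interior_open[OF open_Un[OF D(1,2)]] by blast
  qed
  obtain \<delta> where \<delta>: "0 < \<delta>" "\<And>x. x \<in> closure D1 \<Longrightarrow> 2 * \<delta> \<le> dist p x"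
  proof -
    have "open (- closure D1)" by auto
    then obtain e where "0 < e" "ball p e \<subseteq> - closure D1" using pD1 open_contains_ball by (meson ComplI)
    then show thesis by (intro that[of "e / 2"]) (auto simp: subset_iff not_less[symmetric])
  qed
  \<comment> \<open>The norm of the Newton Hessian at distance \<delta> from its pole. Poles will be
    within \<delta> of p, which is at least 2 \<delta> away from \<open>D1\<close>.\<close>
  define B0 where "B0 = sqrt (6 / \<delta> ^ 6)"
  have ex: "\<exists>y. y \<notin> ?K \<and> real (Suc j) ^ 2 \<le> L2_norm (lebesgue_on D2) (\<lambda>x. newton_hessian (x - y)) \<and>
      (\<forall>x\<in>D1. norm (newton_hessian (x - y)) \<le> B0)" for j
  proof -
    define c where "c = 6 * unit_ball_vol 3 / (729 :: real)"
    have c: "0 < c" by (simp add: c_def)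
    \<comment> \<open>Here s \<le> r fits a small ball into the touching ball, s \<le> \<delta>
      keeps the pole away from \<open>D1\<close>, s \<le> 1 gives c/s \<le> c/s^3, and the last
      bound makes c/s at least (j+1)^4, the square of the desired norm.\<close>
    define s where "s = min (min r \<delta>) (min 1 (c / real (Suc j) ^ 4))"
    have s: "0 < s" "s \<le> r" "s \<le> \<delta>" "s \<le> 1" "s \<le> c / real (Suc j) ^ 4" using pqr(2) \<delta>(1) c by (auto simp: s_def)
    obtain y where y: "y \<notin> ?K" "dist y p < s"
      using frontier_exterior_near[OF open_Un[OF D(1,2)] D(5) pf s(1)] by blast
    have "real (Suc j) ^ 4 \<le> c / s" using s(1,5) by (simp add: field_simps)
    also have "\<dots> \<le> c / s ^ 3"
      using s(1,4) c by (intro divide_left_mono) (auto intro: power_le_one_iff[THEN iffD2] simp: power_decreasing[of 1 3 s, simplified])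
    also have "\<dots> = 6 * unit_ball_vol 3 / (729 * s ^ 3)" by (simp add: c_def)
    also have "\<dots> \<le> (L2_norm (lebesgue_on D2) (\<lambda>x. newton_hessian (x - y)))\<^sup>2"
      by (rule L2_norm_newton_hessian_lower[OF K y(1) sub(2) D(2) pqr(3,4) s(1,2) y(2)])
    finally have "(real (Suc j) ^ 2)\<^sup>2 \<le> (L2_norm (lebesgue_on D2) (\<lambda>x. newton_hessian (x - y)))\<^sup>2"
      by simp
    then have "real (Suc j) ^ 2 \<le> L2_norm (lebesgue_on D2) (\<lambda>x. newton_hessian (x - y))"
      by (rule power2_le_imp_le) (rule L2_norm_nonneg)
    moreover have "norm (newton_hessian (x - y)) \<le> B0" if "x \<in> D1" for x
      unfolding B0_def
    proof (rule real_le_rsqrt)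
      have "2 * \<delta> \<le> dist p x" using that closure_subset by (intro \<delta>(2)) blast
      then have "\<delta> \<le> norm (x - y)"
        using dist_triangle[of p x y] y(2) s(3) by (simp add: dist_norm norm_minus_commute)
      then show "(norm (newton_hessian (x - y)))\<^sup>2 \<le> 6 / \<delta> ^ 6"
        unfolding norm_newton_hessian using \<delta>(1)
        by (intro divide_left_mono power_mono mult_pos_pos zero_less_power) auto
    qed
    ultimately show ?thesis using y(1) by blast
  qed
  have "\<exists>J. harmonic_hessian R J \<and> (\<forall>x\<in>D1. norm (J x) \<le> (B0 + 1) / real (Suc j)) \<and>
      real (Suc j) - sqrt (measure lebesgue D2) \<le> L2_norm (lebesgue_on D2) J" for j
  proof -
    obtain y where y: "y \<notin> ?K" "real (Suc j) ^ 2 \<le> L2_norm (lebesgue_on D2) (\<lambda>x. newton_hessian (x - y))"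
      "\<And>x. x \<in> D1 \<Longrightarrow> norm (newton_hessian (x - y)) \<le> B0" using ex by blast
    \<comment> \<open>Scaling by 1/(j+1) trades part of the growth (j+1)^2 on \<open>D2\<close> for
      decay on \<open>D1\<close>. An approximation error of 1/(j+1) is of the order of that decay
      and changes the norm on \<open>D2\<close> by a bounded amount.\<close>
    let ?H = "\<lambda>x. (1 / real (Suc j)) *\<^sub>R newton_hessian (x - y)"
    have "uniformly_approximable R ?K ?H"
      by (intro uniformly_approximable_scaleR uniformly_approximable_newton_hessian K conn y(1))
    then obtain J where J: "harmonic_hessian R J" "\<And>x. x \<in> ?K \<Longrightarrow> norm (?H x - J x) < 1 / real (Suc j)"
      unfolding uniformly_approximable_def by (metis zero_less_divide_1_iff of_nat_0_less_iff zero_less_Suc)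
    have "norm (J x) \<le> (B0 + 1) / real (Suc j)" if x: "x \<in> D1" for x
    proof -
      have "norm (J x) \<le> norm (?H x) + norm (?H x - J x)"
        by (metis norm_minus_commute norm_triangle_sub)
      also have "norm (?H x) \<le> B0 / real (Suc j)" using y(3)[OF x] by (simp add: divide_right_mono)
      also have "norm (?H x - J x) \<le> 1 / real (Suc j)" using J(2)[of x] x sub by (auto intro: less_imp_le)
      finally show ?thesis by (simp add: add_divide_distrib)
    qed
    moreover have "real (Suc j) - sqrt (measure lebesgue D2) \<le> L2_norm (lebesgue_on D2) J"
    proof -
      have cH: "continuous_on ?K ?H"
        using y(1) by (intro continuous_intros continuous_on_newton_hessian) auto
      have "?K \<subseteq> cball 0 R" using R ball_subset_cball by blast
      then have cJ: "continuous_on ?K J" using J(1) continuous_on_subset unfolding harmonic_hessian_def by blast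
      note sq = square_integrable_lebesgue_on[OF _ K D2m sub(2)]
      have d: "square_integrable (lebesgue_on D2) (\<lambda>x. ?H x - J x)" by (intro sq continuous_intros cH cJ)
      have "L2_norm (lebesgue_on D2) (\<lambda>x. (?H x - J x) + J x) \<le>
          L2_norm (lebesgue_on D2) (\<lambda>x. ?H x - J x) + L2_norm (lebesgue_on D2) J"
        by (rule L2_norm_triangle[OF d sq[OF cJ]])
      moreover have "L2_norm (lebesgue_on D2) (\<lambda>x. ?H x - J x) \<le> 1 / real (Suc j) * sqrt (measure lebesgue D2)"
        using J(2) sub by (intro L2_norm_le_bound[OF d D2l]) (auto intro: less_imp_le)
      moreover have "1 / real (Suc j) * sqrt (measure lebesgue D2) \<le> 1 * sqrt (measure lebesgue D2)"
        by (intro mult_right_mono) auto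
      moreover have "L2_norm (lebesgue_on D2) ?H = 1 / real (Suc j) * L2_norm (lebesgue_on D2) (\<lambda>x. newton_hessian (x - y))"
        by (simp add: L2_norm_def power_divide real_sqrt_divide)
      moreover have "1 / real (Suc j) * real (Suc j) ^ 2 \<le> 1 / real (Suc j) * L2_norm (lebesgue_on D2) (\<lambda>x. newton_hessian (x - y))"
        by (intro mult_left_mono y(2)) simp
      moreover have "1 / real (Suc j) * real (Suc j) ^ 2 = real (Suc j)" by (simp add: power2_eq_square)
      ultimately show ?thesis by simp
    qed
    ultimately show ?thesis using J(1) by blast
  qed
  then obtain J where J: "\<And>j. harmonic_hessian R (J j)" "\<And>j x. x \<in> D1 \<Longrightarrow> norm (J j x) \<le> (B0 + 1) / real (Suc j)"
    "\<And>j. real (Suc j) - sqrt (measure lebesgue D2) \<le> L2_norm (lebesgue_on D2) (J j)" by metis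
  have "filterlim (\<lambda>j. real (Suc j) - sqrt (measure lebesgue D2)) at_top sequentially"
    using filterlim_tendsto_add_at_top[OF tendsto_const[of "- sqrt (measure lebesgue D2)"] filterlim_compose[OF filterlim_real_sequentially filterlim_Suc]]
    by simp
  then have "filterlim (\<lambda>j. L2_norm (lebesgue_on D2) (J j)) at_top sequentially"
    by (rule filterlim_at_top_mono) (intro always_eventually allI J(3))
  moreover have "0 \<le> B0 + 1" by (simp add: B0_def \<delta>(1) less_imp_le)
  ultimately show ?thesis using J by blast
qed

text \<open>A component of the complement of \<open>K\<close> which misses \<open>\<Omega>\<close> would be closed, since its boundary lies in
  \<open>K \<subseteq> \<Omega>\<close>.\<close>

lemma connected_Compl_compact:
  fixes K :: "'a::euclidean_space set"
  assumes K: "compact K" "K \<subseteq> \<Omega>" and \<Omega>: "open \<Omega>" and conn: "connected (\<Omega> - K)"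
  shows "connected (- K)"
proof -
  have meets: "C \<inter> (\<Omega> - K) \<noteq> {}" if C: "open C" "C \<noteq> {}" "C \<subseteq> - K" "- K \<subseteq> C \<union> C'" "open C'" "C \<inter> C' = {}" "C \<noteq> UNIV" for C C'
  proof
    assume e: "C \<inter> (\<Omega> - K) = {}"
    have "closure C \<subseteq> C \<union> K"
      using C open_Int_closure_eq_empty[OF C(5), of C] by blast
    moreover have "closure C \<inter> K = {}"
    proof -
      have "\<Omega> \<inter> C = {}" using e C by blast
      then have "\<Omega> \<inter> closure C = {}" using open_Int_closure_eq_empty[OF \<Omega>] by blast
      then show ?thesis using K by blast
    qed
    ultimately have "closed C" using closure_subset[of C] by (metis closure_closed closed_closure inf.absorb1 Int_Un_distrib inf_sup_aci(1) order_antisym sup_bot_right subset_Un_eq)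
    then show False using C clopen by blast
  qed
  show ?thesis
    unfolding connected_def
  proof
    assume "\<exists>A B. open A \<and> open B \<and> - K \<subseteq> A \<union> B \<and> A \<inter> B \<inter> - K = {} \<and> A \<inter> - K \<noteq> {} \<and> B \<inter> - K \<noteq> {}"
    then obtain A B where AB: "open A" "open B" "- K \<subseteq> A \<union> B" "A \<inter> B \<inter> - K = {}" "A \<inter> - K \<noteq> {}" "B \<inter> - K \<noteq> {}" by blast
    have oK: "open (- K)" using K by (simp add: compact_imp_closed open_Compl)
    define A' B' where "A' = A \<inter> - K" and "B' = B \<inter> - K"
    have A': "open A'" "open B'" "A' \<inter> B' = {}" "A' \<union> B' = - K" "A' \<noteq> {}" "B' \<noteq> {}"
      using AB oK by (auto simp: A'_def B'_def)
    have "A' \<inter> (\<Omega> - K) \<noteq> {}" using A' by (intro meets[of A' B']) auto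
    moreover have "B' \<inter> (\<Omega> - K) \<noteq> {}" using A' by (intro meets[of B' A']) auto
    ultimately show False
      using conn A' unfolding connected_def by blast
  qed
qed

section \<open>Application to the given domain\<close>

lemma regular_domain_exists:
  assumes \<Omega>: "open \<Omega>" "bounded \<Omega>" "C11_boundary \<Omega>"
  obtains R C where "regular_domain \<Omega> R C"
proof -
  have fin: "hausdorff2_outer (frontier \<Omega>) < \<infinity>"
    by (rule hausdorff2_frontier_finite[OF \<Omega>(3) C11_function_locally_lipschitz \<Omega>(1,2)])
  obtain c t0 where c: "0 < c" "0 < t0"
    "\<And>y t. y \<in> frontier \<Omega> \<Longrightarrow> 0 < t \<Longrightarrow> t \<le> t0 \<Longrightarrow> ennreal (c * t\<^sup>2) \<le> hausdorff2_outer (frontier \<Omega> \<inter> ball y t)"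
    using hausdorff2_frontier_lower[OF \<Omega>(3) C11_function_locally_lipschitz \<Omega>(1,2)] by blast
  have "bounded (closure \<Omega>)" using \<Omega>(2) by (rule bounded_closure)
  then obtain b where "\<forall>x\<in>closure \<Omega>. norm x \<le> b" by (auto simp: bounded_iff)
  then have sub: "closure \<Omega> \<subseteq> ball 0 (b + 1)" by force
  have "regular_domain \<Omega> (b + 1) (8 * unit_ball_vol 3 / c)"
    by unfold_locales (use \<Omega> sub fin integral_partial_le_boundary[OF \<Omega>(1) sub fin c] in auto)
  then show ?thesis by (rule that)
qed

theorem theorem4p3:
  fixes \<Omega> D1 D2 :: "(real^3) set" and lam0 mu0 :: real
  assumes "open \<Omega>" and "connected \<Omega>" and "bounded \<Omega>" and "\<Omega> \<noteq> {}" and "C11_boundary \<Omega>"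
    and "lam0 > 0" and "mu0 > 0"
    and "open D1" and "open D2" and "D1 \<subseteq> \<Omega>" and "D2 \<subseteq> \<Omega>"
    and "lipschitz_boundary D1" and "smooth_boundary D2"
    and "D2 \<noteq> {}" and "D1 \<inter> D2 = {}"
    and "connected (\<Omega> - closure (D1 \<union> D2))"
    and "compactly_contained (D1 \<union> D2) \<Omega>" and "lipschitz_boundary (D1 \<union> D2)"
  shows "\<exists>g u :: nat \<Rightarrow> real^3 \<Rightarrow> real^3.
    (\<forall>j. g j \<in> rigid_perp \<Omega> \<and> u j \<in> centered_displacements \<Omega> \<and>
         weak_lame_solution lam0 mu0 \<Omega> (g j) (u j) \<and>
         (AE x in lebesgue_on \<Omega>. weak_div \<Omega> (u j) x = 0)) \<and>
    (\<forall>D1' \<in> sets lebesgue. compactly_contained D1' D1 \<longrightarrow>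
         (\<lambda>j. L2_norm (lebesgue_on D1') (sym_grad \<Omega> (u j))) \<longlonglongrightarrow> 0) \<and>
    filterlim (\<lambda>j. L2_norm (lebesgue_on D2) (sym_grad \<Omega> (u j))) at_top sequentially"
proof -
  have K: "compact (closure (D1 \<union> D2))" "closure (D1 \<union> D2) \<subseteq> \<Omega>"
    using assms(17) by (auto simp: compactly_contained_def)
  obtain R C where reg: "regular_domain \<Omega> R C"
    using regular_domain_exists[OF assms(1,3,5)] by blast
  interpret regular_domain \<Omega> R C by (rule reg)
  have R: "closure (D1 \<union> D2) \<subseteq> ball 0 R" using K(2) \<Omega>_ball by blast
  have conn: "connected (- closure (D1 \<union> D2))"
    by (rule connected_Compl_compact[OF K assms(1,16)])
  obtain B J where B: "0 \<le> B" and J: "\<And>j. harmonic_hessian R (J j)"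
    "\<And>j x. x \<in> D1 \<Longrightarrow> norm (J j x) \<le> B / real (Suc j)"
    "filterlim (\<lambda>j :: nat. L2_norm (lebesgue_on D2) (J j)) at_top sequentially"
    using localized_hessians[OF assms(8,9,15,14,18) K(1) conn R] by blast
  define sol where "sol j g w \<longleftrightarrow> g \<in> rigid_perp \<Omega> \<and> w \<in> centered_displacements \<Omega> \<and> weak_lame_solution lam0 mu0 \<Omega> g w \<and>
    (AE x in lebesgue_on \<Omega>. weak_div \<Omega> w x = 0) \<and> (AE x in lebesgue_on \<Omega>. sym_grad \<Omega> w x = J j x)" for j g w
  have "\<exists>g w. sol j g w" for j
  proof -
    obtain u where "continuous_on (cball 0 R) u" "\<forall>x\<in>ball 0 R. (u has_derivative (\<lambda>h. J j x *v h)) (at x)"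
      using J(1)[of j] unfolding harmonic_hessian_def by blast
    moreover obtain \<tau> where "\<forall>i k. continuous_on (cball 0 R) (\<tau> i k)" "\<forall>x\<in>ball 0 R. \<forall>i. (\<Sum>k\<in>UNIV. \<tau> i k x) = 0"
      "\<forall>x\<in>ball 0 R. \<forall>i k. ((\<lambda>s. J j (x + s *\<^sub>R axis k 1) $ i $ k) has_real_derivative \<tau> i k x) (at 0)"
      using J(1)[of j] unfolding harmonic_hessian_def by blast
    moreover have "continuous_on (cball 0 R) (J j)" "\<And>x. transpose (J j x) = J j x" "\<And>x. trace (J j x) = 0"
      using J(1)[of j] unfolding harmonic_hessian_def by blast+
    ultimately show ?thesis
      unfolding sol_def by (intro divergence_free_solution[of u "J j" \<tau>]) auto
  qed
  then obtain g u where "\<And>j. sol j (g j) (u j)" by metis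
  then have gu: "\<And>j. g j \<in> rigid_perp \<Omega>" "\<And>j. u j \<in> centered_displacements \<Omega>"
    "\<And>j. weak_lame_solution lam0 mu0 \<Omega> (g j) (u j)" "\<And>j. AE x in lebesgue_on \<Omega>. weak_div \<Omega> (u j) x = 0"
    "\<And>j. AE x in lebesgue_on \<Omega>. sym_grad \<Omega> (u j) x = J j x" by (simp_all add: sol_def)
  have cJ: "continuous_on (cball 0 R) (J j)" for j using J(1)[of j] by (simp add: harmonic_hessian_def)
  \<comment> \<open>The symmetric derivative is known only almost everywhere on \<Omega>, which
    suffices for norms over measurable subsets.\<close>
  have norm_eq: "L2_norm (lebesgue_on S) (sym_grad \<Omega> (u j)) = L2_norm (lebesgue_on S) (J j)"
    and sqJ: "square_integrable (lebesgue_on S) (J j)"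
    if S: "S \<in> sets lebesgue" "S \<subseteq> \<Omega>" for S j
  proof -
    show sqJ: "square_integrable (lebesgue_on S) (J j)"
      using square_integrable_lebesgue_on[OF cJ compact_cball S(1)] S(2) \<Omega>_cball by blast
    show "L2_norm (lebesgue_on S) (sym_grad \<Omega> (u j)) = L2_norm (lebesgue_on S) (J j)"
    proof (rule L2_norm_cong_AE)
      have "u j \<in> H1 \<Omega>" using gu(2)[of j] by (simp add: centered_displacements_def)
      then show "sym_grad \<Omega> (u j) \<in> borel_measurable (lebesgue_on S)"
        using borel_measurable_sym_grad measurable_restrict_mono S(2) by blast
      show "J j \<in> borel_measurable (lebesgue_on S)" using sqJ by (rule square_integrable_measurable)
      have "AE x in lebesgue. x \<in> \<Omega> \<longrightarrow> sym_grad \<Omega> (u j) x = J j x"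
        using gu(5)[of j] \<Omega>_measurable by (subst (asm) AE_restrict_space_iff) auto
      then show "AE x in lebesgue_on S. sym_grad \<Omega> (u j) x = J j x"
        using S by (subst AE_restrict_space_iff) (auto elim: eventually_mono)
    qed
  qed
  have D1': "(\<lambda>j. L2_norm (lebesgue_on D1') (sym_grad \<Omega> (u j))) \<longlonglongrightarrow> 0"
    if S: "D1' \<in> sets lebesgue" "compactly_contained D1' D1" for D1'
  proof -
    have sub: "D1' \<subseteq> D1" using S(2) closure_subset by (auto simp: compactly_contained_def)
    have sub\<Omega>: "D1' \<subseteq> \<Omega>" using sub assms(10) by blast
    have lm: "D1' \<in> lmeasurable" using S(1) bounded_subset[OF assms(3) sub\<Omega>] by (rule bounded_set_imp_lmeasurable[rotated])
    \<comment> \<open>The Hessians are bounded by B/(j+1) on all of \<open>D1\<close>, so the norm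
      over a subset is at most this bound times the square root of its volume.\<close>
    have "(\<lambda>j. B * sqrt (measure lebesgue D1') / real (Suc j)) \<longlonglongrightarrow> 0"
      by (rule LIMSEQ_Suc[OF lim_const_over_n])
    then show ?thesis
    proof (rule tendsto_sandwich[OF _ _ tendsto_const, rotated 2])
      show "\<forall>\<^sub>F j in sequentially. L2_norm (lebesgue_on D1') (sym_grad \<Omega> (u j)) \<le> B * sqrt (measure lebesgue D1') / real (Suc j)"
      proof (intro always_eventually allI)
        fix j
        have "L2_norm (lebesgue_on D1') (J j) \<le> B / real (Suc j) * sqrt (measure lebesgue D1')"
          using B J(2) sub by (intro L2_norm_le_bound sqJ S(1) sub\<Omega> lm) auto
        then show "L2_norm (lebesgue_on D1') (sym_grad \<Omega> (u j)) \<le> B * sqrt (measure lebesgue D1') / real (Suc j)"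
          by (simp add: norm_eq[OF S(1) sub\<Omega>])
      qed
    qed (simp add: L2_norm_nonneg)
  qed
  have "filterlim (\<lambda>j. L2_norm (lebesgue_on D2) (sym_grad \<Omega> (u j))) at_top sequentially"
    using J(3) norm_eq[OF _ assms(11)] assms(9) by simp
  then show ?thesis using gu D1' by blast
qed

end
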